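(* Let $G$ be a locally finite connected graph with at least three vertices such that $|G|$ contains a spanning topological caterpillar. Then the square $G^2$ is Hamiltonian, i.e. $|G^2|$ contains a Hamilton circle.
   Context: All graphs are simple. For a locally finite connected graph $H$, an end of $H$ is an equivalence class of rays (one-way infinite paths) of $H$, two rays being equivalent if no finite set of vertices separates them. $|H|$ denotes the Freudenthal compactification of $H$: the graph $H$ viewed as a 1-complex together with its ends, with the standard topology in which, for every finite $S\subseteq V(H)$ and end $\omega$, the set consisting of the component $C$ of $H-S$ containing tails of all rays of $\omega$, all ends whose rays have tails in $C$, and the inner points of the edges between $S$ and $C$, is an open neighbourhood of $\omega$. A circle in $|H|$ is a homeomorphic image of the unit circle $S^1$ in $|H|$; an arc is a homeomorphic image of $[0,1]$. A Hamilton circle of $H$ is a circle in $|H|$ containing all vertices of $H$; $H$ is Hamiltonian if one exists. For a subgraph $F$ of $H$, $\overline{F}$ denotes its closure in $|H|$; such closures are called standard subspaces. A topological tree is an arc-connected standard subspace of $|H|$ containing no circle. A topological caterpillar is a topological tree $\overline{T}$, where $T$ is a forest in $H$, such that $\overline{T-L}$ is an arc, where $L$ is the set of vertices of degree $1$ in $T$. It is spanning if it contains all vertices of $H$. The square $G^2$ is obtained from $G$ by adding an edge between any two vertices at distance $2$ in $G$. *)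

theory Defs
  imports "HOL-Analysis.Analysis"
begin

type_synonym 'v graph = "'v set \<times> 'v set set"

definition simple_graph :: "'v graph \<Rightarrow> bool" where
  "simple_graph G \<longleftrightarrow>
     (\<forall>e\<in>snd G. \<exists>u v. e = {u, v} \<and> u \<noteq> v \<and> u \<in> fst G \<and> v \<in> fst G)"

definition locally_finite :: "'v graph \<Rightarrow> bool" where
  "locally_finite G \<longleftrightarrow> (\<forall>v\<in>fst G. finite {e\<in>snd G. v \<in> e})"

definition reach :: "'v graph \<Rightarrow> 'v set \<Rightarrow> 'v \<Rightarrow> 'v \<Rightarrow> bool" where
  "reach G W = (\<lambda>x y. {x, y} \<in> snd G \<and> x \<in> W \<and> y \<in> W)\<^sup>*\<^sup>*"

definition connected_graph :: "'v graph \<Rightarrow> bool" where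
  "connected_graph G \<longleftrightarrow> fst G \<noteq> {} \<and> (\<forall>u\<in>fst G. \<forall>v\<in>fst G. reach G (fst G) u v)"

definition comps :: "'v graph \<Rightarrow> 'v set \<Rightarrow> 'v set set" where
  "comps G S = {{u. reach G (fst G - S) v u} | v. v \<in> fst G - S}"

definition is_ray :: "'v graph \<Rightarrow> (nat \<Rightarrow> 'v) \<Rightarrow> bool" where
  "is_ray G r \<longleftrightarrow> inj r \<and> (\<forall>n. {r n, r (Suc n)} \<in> snd G)"

definition tail_in :: "(nat \<Rightarrow> 'v) \<Rightarrow> 'v set \<Rightarrow> bool" where
  "tail_in r C \<longleftrightarrow> (\<exists>n. \<forall>m\<ge>n. r m \<in> C)"

definition ray_equiv :: "'v graph \<Rightarrow> (nat \<Rightarrow> 'v) \<Rightarrow> (nat \<Rightarrow> 'v) \<Rightarrow> bool" where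
  "ray_equiv G r s \<longleftrightarrow>
     (\<forall>S. finite S \<and> S \<subseteq> fst G \<longrightarrow> (\<exists>C\<in>comps G S. tail_in r C \<and> tail_in s C))"

definition ends :: "'v graph \<Rightarrow> (nat \<Rightarrow> 'v) set set" where
  "ends G = {{s. is_ray G s \<and> ray_equiv G r s} | r. is_ray G r}"

text \<open>Points of the 1-complex G, in barycentric coordinates: a vertex v is the
indicator of v; an inner point of the edge uv is a function supported exactly on {u,v}
with positive values summing to 1.\<close>
definition vertex_pt :: "'v \<Rightarrow> 'v \<Rightarrow> real" where
  "vertex_pt v = (\<lambda>w. if w = v then 1 else 0)"

definition is_gpt :: "'v graph \<Rightarrow> ('v \<Rightarrow> real) \<Rightarrow> bool" where
  "is_gpt G p \<longleftrightarrow>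
     (\<exists>v\<in>fst G. p = vertex_pt v) \<or>
     (\<exists>u v. {u, v} \<in> snd G \<and> u \<noteq> v \<and> p u > 0 \<and> p v > 0 \<and> p u + p v = 1 \<and>
            (\<forall>w. w \<noteq> u \<and> w \<noteq> v \<longrightarrow> p w = 0))"

datatype 'v fpoint = Gp "'v \<Rightarrow> real" | Ep "(nat \<Rightarrow> 'v) set"

definition fpoints :: "'v graph \<Rightarrow> 'v fpoint set" where
  "fpoints G = Gp ` {p. is_gpt G p} \<union> Ep ` ends G"

text \<open>Basic neighbourhoods of points of the 1-complex (for locally finite graphs this
is the usual 1-complex topology: edges are unit intervals).\<close>
definition vball :: "'v graph \<Rightarrow> ('v \<Rightarrow> real) \<Rightarrow> real \<Rightarrow> 'v fpoint set" where
  "vball G p \<epsilon> = Gp ` {q. is_gpt G q \<and> (\<forall>w. \<bar>q w - p w\<bar> < \<epsilon>)}"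

text \<open>The set \<hat>C(S,\<omega>): the component C of G - S (with its inner edge points),
all ends living in C, and the inner points of the S--C edges.\<close>
definition end_nbhd :: "'v graph \<Rightarrow> 'v set \<Rightarrow> 'v set \<Rightarrow> 'v fpoint set" where
  "end_nbhd G S C =
     Gp ` {q. is_gpt G q \<and> {w. q w \<noteq> 0} \<subseteq> C \<union> S \<and> {w. q w \<noteq> 0} \<inter> C \<noteq> {}} \<union>
     Ep ` {\<omega>\<in>ends G. \<forall>r\<in>\<omega>. tail_in r C}"

definition basic_nbhd :: "'v graph \<Rightarrow> 'v fpoint \<Rightarrow> 'v fpoint set \<Rightarrow> bool" where
  "basic_nbhd G x N \<longleftrightarrow>
     (\<exists>p \<epsilon>. x = Gp p \<and> is_gpt G p \<and> \<epsilon> > 0 \<and> N = vball G p \<epsilon>) \<or>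
     (\<exists>\<omega> S C. x = Ep \<omega> \<and> \<omega> \<in> ends G \<and> finite S \<and> S \<subseteq> fst G \<and> C \<in> comps G S \<and>
              (\<forall>r\<in>\<omega>. tail_in r C) \<and> N = end_nbhd G S C)"

definition freudenthal :: "'v graph \<Rightarrow> 'v fpoint topology" where
  "freudenthal G = topology (\<lambda>U. U \<subseteq> fpoints G \<and> (\<forall>x\<in>U. \<exists>N. basic_nbhd G x N \<and> N \<subseteq> U))"

definition subgraph :: "'v graph \<Rightarrow> 'v graph \<Rightarrow> bool" where
  "subgraph F G \<longleftrightarrow> fst F \<subseteq> fst G \<and> snd F \<subseteq> snd G \<and> (\<forall>e\<in>snd F. e \<subseteq> fst F)"

definition graph_pts :: "'v graph \<Rightarrow> 'v graph \<Rightarrow> 'v fpoint set" where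
  "graph_pts G F = Gp ` {p. is_gpt G p \<and>
      ({w. p w \<noteq> 0} \<in> snd F \<or> (\<exists>v\<in>fst F. {w. p w \<noteq> 0} = {v}))}"

definition std_closure :: "'v graph \<Rightarrow> 'v graph \<Rightarrow> 'v fpoint set" where
  "std_closure G F = freudenthal G closure_of graph_pts G F"

definition is_circle :: "'a topology \<Rightarrow> 'a set \<Rightarrow> bool" where
  "is_circle X C \<longleftrightarrow> C \<subseteq> topspace X \<and>
     (\<exists>f. homeomorphic_map (top_of_set (sphere (0::complex) 1)) (subtopology X C) f)"

definition is_arc :: "'a topology \<Rightarrow> 'a set \<Rightarrow> bool" where
  "is_arc X A \<longleftrightarrow> A \<subseteq> topspace X \<and>
     (\<exists>f. homeomorphic_map (top_of_set {0..1::real}) (subtopology X A) f)"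

definition arc_connected_in :: "'a topology \<Rightarrow> 'a set \<Rightarrow> bool" where
  "arc_connected_in X S \<longleftrightarrow> S \<subseteq> topspace X \<and>
     (\<forall>x\<in>S. \<forall>y\<in>S. x \<noteq> y \<longrightarrow>
        (\<exists>A f. A \<subseteq> S \<and> homeomorphic_map (top_of_set {0..1::real}) (subtopology X A) f
               \<and> f 0 = x \<and> f 1 = y))"

definition topological_tree :: "'v graph \<Rightarrow> 'v fpoint set \<Rightarrow> bool" where
  "topological_tree G S \<longleftrightarrow>
     (\<exists>F. subgraph F G \<and> S = std_closure G F) \<and>
     arc_connected_in (freudenthal G) S \<and>
     \<not> (\<exists>C\<subseteq>S. is_circle (freudenthal G) C)"

definition forest :: "'v graph \<Rightarrow> bool" where
  "forest F \<longleftrightarrow> \<not> (\<exists>vs. length vs \<ge> 3 \<and> distinct vs \<and>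
      (\<forall>i<length vs. {vs ! i, vs ! ((i + 1) mod length vs)} \<in> snd F))"

definition degree :: "'v graph \<Rightarrow> 'v \<Rightarrow> nat" where
  "degree F v = card {e\<in>snd F. v \<in> e}"

definition leaves :: "'v graph \<Rightarrow> 'v set" where
  "leaves F = {v\<in>fst F. degree F v = 1}"

definition del_vertices :: "'v graph \<Rightarrow> 'v set \<Rightarrow> 'v graph" where
  "del_vertices F L = (fst F - L, {e\<in>snd F. e \<inter> L = {}})"

definition topological_caterpillar :: "'v graph \<Rightarrow> 'v graph \<Rightarrow> bool" where
  "topological_caterpillar G T \<longleftrightarrow>
     subgraph T G \<and> forest T \<and> topological_tree G (std_closure G T) \<and>
     is_arc (freudenthal G) (std_closure G (del_vertices T (leaves T)))"

definition spanning :: "'v graph \<Rightarrow> 'v graph \<Rightarrow> bool" where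
  "spanning G T \<longleftrightarrow> (\<forall>v\<in>fst G. Gp (vertex_pt v) \<in> std_closure G T)"

definition hamiltonian :: "'v graph \<Rightarrow> bool" where
  "hamiltonian G \<longleftrightarrow>
     (\<exists>C. is_circle (freudenthal G) C \<and> (\<forall>v\<in>fst G. Gp (vertex_pt v) \<in> C))"

definition graph_square :: "'v graph \<Rightarrow> 'v graph" where
  "graph_square G = (fst G, snd G \<union>
     {{u, w} | u v w. u \<noteq> w \<and> {u, v} \<in> snd G \<and> {v, w} \<in> snd G})"

end

theory Submission
  imports Defs
begin

text \<open>
  The closure of the spine of a spanning topological caterpillar is an arc, parametrised by the unit
  interval; the set of parameters of ends is closed, and the components of its complement
  (\<open>gaps\<close>) carry finite or infinite paths of spine vertices. In the square, the arc can be
  turned into a single strand through all vertices by inserting the leaves of every spine vertex next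
  to it, and this strand passes every end exactly once. It is closed up by a second strand that runs
  from one end point of the arc to the other: as the graph is connected, some walk (possibly one that
  converges to an end at either side) joins the two end points, and after loop erasure it enters every
  gap at most once. Between the entry and the exit the two strands run in parallel through the gap,
  alternately taking a spine vertex and the leaves of its neighbour, and between two gaps the second
  strand uses an edge of the graph.
\<close>

subsection \<open>Components and ends\<close>

text \<open>The parameters of the ends may form a complicated closed set, for instance a Cantor set.
  Gaps then have no successors and no induction along the arc is available. A strand is therefore
  only an injective assignment of real positions to vertices, and the circle arises from a compact
  set of positions all of whose complementary intervals carry an edge. The second strand must not
  approach an end that the first one passes, since that end would be visited twice; only the ends at
  0 and 1, where the strands meet, are exempt. This is why it uses only a finite stretch of each gap
  but the first and the last, and why it can be indexed by integers. The gaps on its way occur in no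
  particular order along the arc, so a stretch may have to be traversed to the left. Sharing a
  stretch is possible because a strand that omits every second spine vertex still moves by distance
  at most two. The delicate places are the borders of a stretch, where parity, leaves and the edge
  to the next gap have to fit together; the offsets of the leaves are designed for them.\<close>

locale lf_graph =
  fixes G :: "'v graph"
  assumes simple: "simple_graph G" and lf: "locally_finite G"
begin

abbreviation "FT \<equiv> freudenthal G"

lemma edge_vertices: "{u, v} \<in> snd G \<Longrightarrow> u \<in> fst G \<and> v \<in> fst G \<and> u \<noteq> v"
  using simple unfolding simple_graph_def by (metis doubleton_eq_iff)

lemma finite_neighbours: "v \<in> fst G \<Longrightarrow> finite {u. {v, u} \<in> snd G}"
proof -
  assume v: "v \<in> fst G"
  have "finite {e \<in> snd G. v \<in> e}" using lf v unfolding locally_finite_def by blast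
  then have "finite (\<Union>{e \<in> snd G. v \<in> e})"
    using simple unfolding simple_graph_def by (intro finite_Union) auto
  then show ?thesis by (rule rev_finite_subset) auto
qed

lemma finite_neighbourhood:
  assumes "finite S" "S \<subseteq> fst G"
  shows "finite (S \<union> {u. \<exists>s\<in>S. {s, u} \<in> snd G})" "S \<union> {u. \<exists>s\<in>S. {s, u} \<in> snd G} \<subseteq> fst G"
proof -
  have "{u. \<exists>s\<in>S. {s, u} \<in> snd G} = (\<Union>s\<in>S. {u. {s, u} \<in> snd G})" by auto
  then show "finite (S \<union> {u. \<exists>s\<in>S. {s, u} \<in> snd G})"
    using assms finite_neighbours by auto
  show "S \<union> {u. \<exists>s\<in>S. {s, u} \<in> snd G} \<subseteq> fst G" using assms edge_vertices by auto
qed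

lemma reach_sym: "reach G W x y \<Longrightarrow> reach G W y x"
proof -
  assume r: "reach G W x y"
  have "symp (\<lambda>x y. {x, y} \<in> snd G \<and> x \<in> W \<and> y \<in> W)"
    by (rule sympI) (metis insert_commute)
  then show ?thesis using r unfolding reach_def by (rule sympD[OF symp_rtranclp])
qed

lemma reach_trans: "reach G W x y \<Longrightarrow> reach G W y z \<Longrightarrow> reach G W x z"
  unfolding reach_def by auto

lemma reach_mono: "reach G W x y \<Longrightarrow> W \<subseteq> W' \<Longrightarrow> reach G W' x y"
  unfolding reach_def by (erule rtranclp_mono[THEN predicate2D, rotated]) auto

lemma reach_in: "reach G W x y \<Longrightarrow> x \<in> W \<Longrightarrow> y \<in> W"
  unfolding reach_def by (induction rule: rtranclp_induct) auto

lemma reach_edge: "{x, y} \<in> snd G \<Longrightarrow> x \<in> W \<Longrightarrow> y \<in> W \<Longrightarrow> reach G W x y"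
  unfolding reach_def by auto

lemma comp_subset: "C \<in> comps G S \<Longrightarrow> C \<subseteq> fst G - S"
  unfolding comps_def using reach_in by blast

lemma comp_reach: "C \<in> comps G S \<Longrightarrow> x \<in> C \<Longrightarrow> y \<in> C \<Longrightarrow> reach G (fst G - S) x y"
  unfolding comps_def using reach_sym reach_trans by blast

lemma comp_reach_in: "C \<in> comps G S \<Longrightarrow> x \<in> C \<Longrightarrow> reach G (fst G - S) x y \<Longrightarrow> y \<in> C"
  unfolding comps_def using reach_trans by blast

lemma comp_edge: "C \<in> comps G S \<Longrightarrow> x \<in> C \<Longrightarrow> {x, y} \<in> snd G \<Longrightarrow> y \<notin> S \<Longrightarrow> y \<in> C"
  using comp_reach_in[of C S x y] reach_edge[of x y "fst G - S"] comp_subset edge_vertices by blast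

lemma comp_mono:
  assumes "C \<in> comps G S" "C' \<in> comps G S'" "S \<subseteq> S'" "x \<in> C" "x \<in> C'"
  shows "C' \<subseteq> C"
proof
  fix y assume "y \<in> C'"
  then have "reach G (fst G - S') x y" using comp_reach assms by blast
  then have "reach G (fst G - S) x y" using reach_mono[of "fst G - S'" x y "fst G - S"] assms by blast
  then show "y \<in> C" using comp_reach_in assms by blast
qed

lemma comp_eq: "C \<in> comps G S \<Longrightarrow> C' \<in> comps G S \<Longrightarrow> x \<in> C \<Longrightarrow> x \<in> C' \<Longrightarrow> C = C'"
  using comp_mono by (metis subset_antisym order_refl)

lemma tail_in_same: "tail_in r C \<Longrightarrow> tail_in r C' \<Longrightarrow> \<exists>x. x \<in> C \<and> x \<in> C'"
  unfolding tail_in_def by (metis linear)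

lemma tail_in_mono: "tail_in r C \<Longrightarrow> C \<subseteq> C' \<Longrightarrow> tail_in r C'"
  unfolding tail_in_def by blast

lemma ray_vertex: "is_ray G r \<Longrightarrow> r n \<in> fst G"
  unfolding is_ray_def using edge_vertices by blast

lemma ray_avoids:
  assumes "is_ray G r" "finite S"
  shows "\<exists>n. \<forall>m\<ge>n. r m \<notin> S"
proof -
  have "finite (r -` S)" using assms unfolding is_ray_def by (intro finite_vimageI) auto
  then obtain n where "\<forall>m\<in>r -` S. m < n" using finite_nat_set_iff_bounded by blast
  then show ?thesis by (meson linorder_not_le vimageI)
qed

text \<open>After its last visit to \<open>S\<close> the ray stays in the component of its current
  vertex, since each further step is an edge avoiding \<open>S\<close>.\<close>

lemma ray_comp:
  assumes r: "is_ray G r" and S: "finite S"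
  shows "\<exists>C\<in>comps G S. tail_in r C"
proof -
  obtain n where n: "\<forall>m\<ge>n. r m \<notin> S" using ray_avoids[OF r S] by blast
  let ?C = "{u. reach G (fst G - S) (r n) u}"
  have C: "?C \<in> comps G S" unfolding comps_def using n ray_vertex[OF r] by blast
  have "r m \<in> ?C" if "m \<ge> n" for m using that
  proof (induction m rule: dec_induct)
    case base show ?case by (simp add: reach_def)
  next
    case (step m)
    then show ?case using comp_edge[OF C, of "r m" "r (Suc m)"] r n unfolding is_ray_def by auto
  qed
  then show ?thesis using C unfolding tail_in_def by blast
qed

lemma ray_equiv_refl: "is_ray G r \<Longrightarrow> ray_equiv G r r"
  unfolding ray_equiv_def using ray_comp by blast

lemma ray_equiv_sym: "ray_equiv G r s \<Longrightarrow> ray_equiv G s r"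
  unfolding ray_equiv_def by blast

text \<open>\<open>ray_equiv\<close> only provides some component for both tails. Components sharing
  a tail coincide, so the given \<open>C\<close> must be that component.\<close>

lemma ray_equiv_tail:
  assumes "ray_equiv G r s" "finite S" "S \<subseteq> fst G" "C \<in> comps G S" "tail_in r C"
  shows "tail_in s C"
proof -
  obtain C' where C': "C' \<in> comps G S" "tail_in r C'" "tail_in s C'"
    using assms unfolding ray_equiv_def by blast
  then show ?thesis using comp_eq tail_in_same assms by metis
qed

lemma ray_equiv_trans: "ray_equiv G r s \<Longrightarrow> ray_equiv G s t \<Longrightarrow> ray_equiv G r t"
proof -
  assume rs: "ray_equiv G r s" and st: "ray_equiv G s t"
  show ?thesis unfolding ray_equiv_def
  proof (intro allI impI)
    fix S assume S: "finite S \<and> S \<subseteq> fst G"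
    then obtain C where "C \<in> comps G S" "tail_in r C" "tail_in s C" using rs unfolding ray_equiv_def by blast
    then show "\<exists>C\<in>comps G S. tail_in r C \<and> tail_in t C" using ray_equiv_tail[OF st] S by blast
  qed
qed

lemma end_eq:
  assumes "\<omega> \<in> ends G" "r \<in> \<omega>"
  shows "\<omega> = {s. is_ray G s \<and> ray_equiv G r s}"
  using assms ray_equiv_trans ray_equiv_sym unfolding ends_def by blast

lemma end_ray: "\<omega> \<in> ends G \<Longrightarrow> r \<in> \<omega> \<Longrightarrow> is_ray G r"
  unfolding ends_def by blast

lemma end_nonempty: "\<omega> \<in> ends G \<Longrightarrow> \<exists>r. r \<in> \<omega>"
  unfolding ends_def using ray_equiv_refl by blast

text \<open>Basic neighbourhoods of an end quantify over all its rays; this allows a single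
  representative to decide.\<close>

lemma end_tail:
  assumes "\<omega> \<in> ends G" "r \<in> \<omega>" "finite S" "S \<subseteq> fst G" "C \<in> comps G S" "tail_in r C"
  shows "\<forall>s\<in>\<omega>. tail_in s C"
  using end_eq[OF assms(1,2)] ray_equiv_tail[OF _ assms(3-6)] by blast

lemma end_comp:
  assumes "\<omega> \<in> ends G" "finite S" "S \<subseteq> fst G"
  shows "\<exists>C\<in>comps G S. \<forall>s\<in>\<omega>. tail_in s C"
proof -
  obtain r where r: "r \<in> \<omega>" using end_nonempty assms by blast
  then obtain C where "C \<in> comps G S" "tail_in r C" using ray_comp[OF end_ray] assms by blast
  then show ?thesis using end_tail assms r by blast
qed

lemma ends_distinct:
  assumes "\<omega> \<in> ends G" "\<omega>' \<in> ends G" "\<omega> \<noteq> \<omega>'"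
  shows "\<exists>S C C'. finite S \<and> S \<subseteq> fst G \<and> C \<in> comps G S \<and> C' \<in> comps G S \<and> C \<inter> C' = {} \<and>
    (\<forall>r\<in>\<omega>. tail_in r C) \<and> (\<forall>r\<in>\<omega>'. tail_in r C')"
proof -
  obtain r r' where r: "r \<in> \<omega>" "r' \<in> \<omega>'" using end_nonempty assms by blast
  have "\<not> ray_equiv G r r'"
  proof
    assume "ray_equiv G r r'"
    then have "r' \<in> \<omega>" using end_eq[OF assms(1) r(1)] end_ray[OF assms(2) r(2)] by blast
    then show False using end_eq[OF assms(1)] end_eq[OF assms(2) r(2)] assms(3) by blast
  qed
  then obtain S where S: "finite S" "S \<subseteq> fst G"
    and n: "\<not> (\<exists>C\<in>comps G S. tail_in r C \<and> tail_in r' C)" unfolding ray_equiv_def by blast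
  obtain C where C: "C \<in> comps G S" "\<forall>s\<in>\<omega>. tail_in s C" using end_comp assms S by blast
  obtain C' where C': "C' \<in> comps G S" "\<forall>s\<in>\<omega>'. tail_in s C'" using end_comp assms S by blast
  have "C \<inter> C' = {}" using comp_eq[OF C(1) C'(1)] n C C' r by blast
  then show ?thesis using S C C'
    by (intro exI[of _ S] exI[of _ C] exI[of _ C']) simp
qed

subsection \<open>The Freudenthal topology\<close>

lemma gpt_support:
  assumes "is_gpt G p"
  shows "(\<exists>v\<in>fst G. {w. p w \<noteq> 0} = {v} \<and> p = vertex_pt v) \<or>
    (\<exists>u v. {u, v} \<in> snd G \<and> u \<noteq> v \<and> {w. p w \<noteq> 0} = {u, v} \<and> p u + p v = 1 \<and> p u > 0 \<and> p v > 0)"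
  using assms unfolding is_gpt_def
proof (elim disjE exE conjE bexE)
  fix v assume "v \<in> fst G" "p = vertex_pt v"
  then show ?thesis by (intro disjI1 bexI[of _ v]) (auto simp: vertex_pt_def)
next
  fix u v assume "{u, v} \<in> snd G" "u \<noteq> v" "0 < p u" "0 < p v" "p u + p v = 1" 
    "\<forall>w. w \<noteq> u \<and> w \<noteq> v \<longrightarrow> p w = 0"
  then show ?thesis by (intro disjI2 exI[of _ u] exI[of _ v]) force
qed

lemma gpt_range: "is_gpt G p \<Longrightarrow> 0 \<le> p w \<and> p w \<le> 1"
  unfolding is_gpt_def vertex_pt_def
proof (elim disjE exE conjE bexE)
  fix u v assume *: "0 < p u" "0 < p v" "p u + p v = 1" "\<forall>w. w \<noteq> u \<and> w \<noteq> v \<longrightarrow> p w = 0"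
  show ?thesis by (cases "w = u \<or> w = v") (use * in auto)
qed auto

lemma gpt_support_vertex: "is_gpt G p \<Longrightarrow> p w \<noteq> 0 \<Longrightarrow> w \<in> fst G"
proof (drule gpt_support, elim disjE exE conjE bexE)
  fix u v assume "p w \<noteq> 0" "{u, v} \<in> snd G" "{w. p w \<noteq> 0} = {u, v}"
  moreover then have "w = u \<or> w = v" by auto
  ultimately show ?thesis using edge_vertices by blast
next
  fix v assume "p w \<noteq> 0" "v \<in> fst G" "{w. p w \<noteq> 0} = {v}"
  moreover then have "w = v" by auto
  ultimately show ?thesis by blast
qed

lemma vertex_gpt: "v \<in> fst G \<Longrightarrow> is_gpt G (vertex_pt v)"
  unfolding is_gpt_def by blast

text \<open>The delicate points are those on edges leaving \<open>C'\<close>: the other vertex is in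
  \<open>S\<close> or, by \<open>comp_edge\<close>, already in \<open>C\<close>, so they do not drop
  out of the larger neighbourhood.\<close>

lemma end_nbhd_mono:
  assumes "C \<in> comps G S" "C' \<in> comps G S'" "S \<subseteq> S'" "x \<in> C" "x \<in> C'"
  shows "end_nbhd G S' C' \<subseteq> end_nbhd G S C"
proof -
  have sub: "C' \<subseteq> C" using comp_mono assms by blast
  have "{w. q w \<noteq> 0} \<subseteq> C \<union> S \<and> {w. q w \<noteq> 0} \<inter> C \<noteq> {}"
    if q: "is_gpt G q" "{w. q w \<noteq> 0} \<subseteq> C' \<union> S'" "{w. q w \<noteq> 0} \<inter> C' \<noteq> {}" for q
    using gpt_support[OF q(1)]
  proof (elim disjE exE conjE bexE)
    fix v assume "{w. q w \<noteq> 0} = {v}" then show ?thesis using q sub by auto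
  next
    fix u v assume e: "{u, v} \<in> snd G" "{w. q w \<noteq> 0} = {u, v}"
    then have "u \<in> C' \<or> v \<in> C'" using q by auto
    then show ?thesis using e comp_edge[OF assms(1), of u v] comp_edge[OF assms(1), of v u] sub
      by (auto simp: insert_commute)
  qed
  moreover have "\<forall>r\<in>\<omega>. tail_in r C" if "\<forall>r\<in>\<omega>. tail_in r C'" for \<omega>
    using that tail_in_mono sub by blast
  ultimately show ?thesis unfolding end_nbhd_def
    by (intro Un_mono image_mono Collect_mono impI conjI; elim conjE; (assumption | blast))
qed

lemma basic_nbhd_Gp: "is_gpt G p \<Longrightarrow> \<epsilon> > 0 \<Longrightarrow> basic_nbhd G (Gp p) (vball G p \<epsilon>)"
  unfolding basic_nbhd_def by blast

lemma basic_nbhd_Ep: "\<omega> \<in> ends G \<Longrightarrow> finite S \<Longrightarrow> S \<subseteq> fst G \<Longrightarrow> C \<in> comps G S \<Longrightarrow>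
    \<forall>r\<in>\<omega>. tail_in r C \<Longrightarrow> basic_nbhd G (Ep \<omega>) (end_nbhd G S C)"
  unfolding basic_nbhd_def by blast

text \<open>The intersection axiom of the topology. For ends it results from separating by
  \<open>S \<union> S'\<close>.\<close>

lemma basic_nbhd_Int:
  assumes "basic_nbhd G x N" "basic_nbhd G x N'"
  shows "\<exists>N''. basic_nbhd G x N'' \<and> N'' \<subseteq> N \<inter> N'"
proof (cases x)
  case (Gp p)
  then obtain a b where "is_gpt G p" "a > 0" "b > 0" "N = vball G p a" "N' = vball G p b"
    using assms unfolding basic_nbhd_def by auto
  then show ?thesis using Gp basic_nbhd_Gp[of p "min a b"]
    by (intro exI[of _ "vball G p (min a b)"]) (auto simp: vball_def)
next
  case (Ep \<omega>)
  then obtain S C S' C' where w: "\<omega> \<in> ends G" and S: "finite S" "S \<subseteq> fst G" "C \<in> comps G S"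
    "\<forall>r\<in>\<omega>. tail_in r C" "N = end_nbhd G S C" and S': "finite S'" "S' \<subseteq> fst G" "C' \<in> comps G S'"
    "\<forall>r\<in>\<omega>. tail_in r C'" "N' = end_nbhd G S' C'"
    using assms unfolding basic_nbhd_def by auto
  obtain D where D: "D \<in> comps G (S \<union> S')" "\<forall>r\<in>\<omega>. tail_in r D"
    using end_comp[OF w, of "S \<union> S'"] S S' by auto
  obtain r where r: "r \<in> \<omega>" using end_nonempty w by blast
  have "\<exists>x. x \<in> C \<and> x \<in> D" "\<exists>x. x \<in> C' \<and> x \<in> D" 
    using tail_in_same r D S S' by blast+
  then have "end_nbhd G (S \<union> S') D \<subseteq> N \<inter> N'"
    using end_nbhd_mono[OF S(3) D(1)] end_nbhd_mono[OF S'(3) D(1)] S S' by auto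
  moreover have "basic_nbhd G x (end_nbhd G (S \<union> S') D)"
    unfolding Ep using basic_nbhd_Ep w S S' D by auto
  ultimately show ?thesis by blast
qed

lemma fpoints_nbhd: "x \<in> fpoints G \<Longrightarrow> \<exists>N. basic_nbhd G x N \<and> N \<subseteq> fpoints G"
proof (cases x)
  case (Gp p)
  assume "x \<in> fpoints G"
  then have "is_gpt G p" using Gp unfolding fpoints_def by auto
  then show ?thesis using Gp basic_nbhd_Gp[of p 1]
    by (intro exI[of _ "vball G p 1"]) (auto simp: vball_def fpoints_def)
next
  case (Ep \<omega>)
  assume "x \<in> fpoints G"
  then have w: "\<omega> \<in> ends G" using Ep unfolding fpoints_def by auto
  obtain C where C: "C \<in> comps G {}" "\<forall>s\<in>\<omega>. tail_in s C" using end_comp[OF w, of "{}"] by auto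
  then show ?thesis using Ep basic_nbhd_Ep[OF w, of "{}"]
    by (intro exI[of _ "end_nbhd G {} C"]) (auto simp: end_nbhd_def fpoints_def)
qed

text \<open>\<open>topology\<close> has the intended open sets only for families satisfying
  \<open>istopology\<close>, so this has to be verified before \<open>freudenthal\<close> can be
  used.\<close>

lemma openin_FT: "openin FT U \<longleftrightarrow> U \<subseteq> fpoints G \<and> (\<forall>x\<in>U. \<exists>N. basic_nbhd G x N \<and> N \<subseteq> U)"
proof -
  have "istopology (\<lambda>U. U \<subseteq> fpoints G \<and> (\<forall>x\<in>U. \<exists>N. basic_nbhd G x N \<and> N \<subseteq> U))"
    unfolding istopology_def
  proof (intro conjI allI impI)
    fix S T assume S: "S \<subseteq> fpoints G \<and> (\<forall>x\<in>S. \<exists>N. basic_nbhd G x N \<and> N \<subseteq> S)"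
      and T: "T \<subseteq> fpoints G \<and> (\<forall>x\<in>T. \<exists>N. basic_nbhd G x N \<and> N \<subseteq> T)"
    show "S \<inter> T \<subseteq> fpoints G" using S by blast
    show "\<forall>x\<in>S \<inter> T. \<exists>N. basic_nbhd G x N \<and> N \<subseteq> S \<inter> T"
    proof
      fix x assume x: "x \<in> S \<inter> T"
      obtain N where N: "basic_nbhd G x N" "N \<subseteq> S" using S x by blast
      obtain N' where N': "basic_nbhd G x N'" "N' \<subseteq> T" using T x by blast
      show "\<exists>N. basic_nbhd G x N \<and> N \<subseteq> S \<inter> T" using basic_nbhd_Int[OF N(1) N'(1)] N(2) N'(2) by blast
    qed
  next
    fix K assume K: "\<forall>S\<in>K. S \<subseteq> fpoints G \<and> (\<forall>x\<in>S. \<exists>N. basic_nbhd G x N \<and> N \<subseteq> S)"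
    then show "\<Union>K \<subseteq> fpoints G" by blast
    show "\<forall>x\<in>\<Union>K. \<exists>N. basic_nbhd G x N \<and> N \<subseteq> \<Union>K"
    proof
      fix x assume "x \<in> \<Union>K"
      then obtain S where "S \<in> K" "x \<in> S" by blast
      moreover then obtain N where "basic_nbhd G x N" "N \<subseteq> S" using K by blast
      ultimately show "\<exists>N. basic_nbhd G x N \<and> N \<subseteq> \<Union>K" by blast
    qed
  qed
  then show ?thesis unfolding freudenthal_def by (simp add: topology_inverse')
qed

lemma topspace_FT [simp]: "topspace FT = fpoints G"
  unfolding topspace_def openin_FT using fpoints_nbhd by (auto simp: openin_FT)

lemma open_end_nbhd:
  assumes S: "finite S" "S \<subseteq> fst G" and C: "C \<in> comps G S"
  shows "openin FT (end_nbhd G S C)"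
  unfolding openin_FT
proof (intro conjI ballI)
  show "end_nbhd G S C \<subseteq> fpoints G" unfolding end_nbhd_def fpoints_def by auto
  fix x assume x: "x \<in> end_nbhd G S C"
  show "\<exists>N. basic_nbhd G x N \<and> N \<subseteq> end_nbhd G S C"
  proof (cases x)
    case (Ep \<omega>)
    then have "\<omega> \<in> ends G" "\<forall>r\<in>\<omega>. tail_in r C" using x unfolding end_nbhd_def by auto
    then show ?thesis using basic_nbhd_Ep S C Ep by blast
  next
    case (Gp p)
    then have p: "is_gpt G p" "{w. p w \<noteq> 0} \<inter> C \<noteq> {}" using x unfolding end_nbhd_def by auto
    then obtain c where c: "p c \<noteq> 0" "c \<in> C" by auto
    have cp: "p c > 0" using c gpt_range[OF p(1), of c] by auto
    \<comment> \<open>Within distance \<open>p c\<close> the coordinate at \<open>c\<close> stays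
      nonzero, so the vertex or edge carrying the point contains \<open>c\<close> and is confined to
      \<open>C \<union> S\<close>.\<close>
    have "vball G p (p c) \<subseteq> end_nbhd G S C"
    proof
      fix y assume "y \<in> vball G p (p c)"
      then obtain q where q: "y = Gp q" "is_gpt G q" "\<bar>q c - p c\<bar> < p c" unfolding vball_def by auto
      have qc: "q c \<noteq> 0" using q cp by auto
      have "{w. q w \<noteq> 0} \<subseteq> C \<union> S" using gpt_support[OF q(2)]
      proof (elim disjE exE conjE bexE)
        fix u v assume "{u, v} \<in> snd G" "{w. q w \<noteq> 0} = {u, v}"
        moreover then have "c = u \<or> c = v" using qc by auto
        ultimately show ?thesis using c comp_edge[OF C, of u v] comp_edge[OF C, of v u]
          by (auto simp: insert_commute)
      next
        fix v assume "{w. q w \<noteq> 0} = {v}"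
        moreover then have "c = v" using qc by auto
        ultimately show ?thesis using c by auto
      qed
      then show "y \<in> end_nbhd G S C" using q qc c unfolding end_nbhd_def by auto
    qed
    then show ?thesis using Gp p cp basic_nbhd_Gp by blast
  qed
qed

section \<open>Coordinate functions and the Hausdorff property\<close>

definition coord :: "'v \<Rightarrow> 'v fpoint \<Rightarrow> real" where
  "coord w x = (case x of Gp p \<Rightarrow> p w | Ep _ \<Rightarrow> 0)"

text \<open>The value 0 is the right one at an end: once \<open>w\<close> and all its neighbours are
  separated from the end, no point near it lies on an edge at \<open>w\<close>.\<close>

lemma continuous_coord:
  assumes w: "w \<in> fst G"
  shows "continuous_map FT euclideanreal (coord w)"
  unfolding continuous_map_def
proof (intro conjI allI impI)
  fix U :: "real set" assume U: "openin euclideanreal U"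
  show "openin FT {x \<in> topspace FT. coord w x \<in> U}"
    unfolding openin_FT topspace_FT
  proof (intro conjI ballI)
    fix x assume x: "x \<in> {x \<in> fpoints G. coord w x \<in> U}"
    then obtain \<epsilon> where e: "\<epsilon> > 0" "\<And>y. \<bar>y - coord w x\<bar> < \<epsilon> \<Longrightarrow> y \<in> U"
      using U unfolding open_openin[symmetric] open_dist dist_real_def by fast
    show "\<exists>N. basic_nbhd G x N \<and> N \<subseteq> {x \<in> fpoints G. coord w x \<in> U}"
    proof (cases x)
      case (Gp p)
      then have "is_gpt G p" using x unfolding fpoints_def by auto
      then show ?thesis using Gp e basic_nbhd_Gp[of p \<epsilon>]
        by (intro exI[of _ "vball G p \<epsilon>"]) (auto simp: vball_def fpoints_def coord_def)
    next
      case (Ep \<omega>)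
      then have o: "\<omega> \<in> ends G" using x unfolding fpoints_def by auto
      define S where "S = {w} \<union> {u. \<exists>s\<in>{w}. {s, u} \<in> snd G}"
      have S: "finite S" "S \<subseteq> fst G" unfolding S_def using finite_neighbourhood[of "{w}"] w by auto
      obtain C where C: "C \<in> comps G S" "\<forall>s\<in>\<omega>. tail_in s C" using end_comp[OF o S] by blast
      have "q w = 0" if q: "is_gpt G q" "{v. q v \<noteq> 0} \<inter> C \<noteq> {}" for q
      proof (rule ccontr)
        assume qw: "q w \<noteq> 0"
        have cs: "C \<inter> S = {}" using comp_subset[OF C(1)] by auto
        have ws: "w \<in> S" "\<And>u. {w, u} \<in> snd G \<Longrightarrow> u \<in> S" unfolding S_def by auto
        show False using gpt_support[OF q(1)]
        proof (elim disjE exE conjE bexE)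
          fix v assume v: "{w. q w \<noteq> 0} = {v}"
          then have "w = v" using qw by auto
          then show False using v q cs ws by auto
        next
          fix u v assume e: "{u, v} \<in> snd G" "{w. q w \<noteq> 0} = {u, v}"
          then have "w = u \<or> w = v" using qw by auto
          then have "u \<in> S \<and> v \<in> S" using ws e(1) by (auto simp: insert_commute)
          then show False using e q cs by auto
        qed
      qed
      then have "end_nbhd G S C \<subseteq> {x \<in> fpoints G. coord w x \<in> U}"
        using e(2)[of 0] e(1) Ep unfolding end_nbhd_def fpoints_def coord_def by force
      then show ?thesis using Ep basic_nbhd_Ep[OF o S C] by blast
    qed
  qed auto
qed auto

text \<open>This coordinate sum is 1 at \<open>Gp p\<close>, but 0 at every end and at every vertex
  outside \<open>S\<close>. It separates points of the complex from ends and later isolates spine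
  vertices.\<close>

lemma Gp_support_sum:
  assumes "is_gpt G p"
  shows "\<exists>S. finite S \<and> S \<subseteq> fst G \<and> (\<Sum>w\<in>S. coord w (Gp p)) = 1 \<and> S = {w. p w \<noteq> 0}"
  using gpt_support[OF assms]
proof (elim disjE exE conjE bexE)
  fix v assume "v \<in> fst G" "{w. p w \<noteq> 0} = {v}" "p = vertex_pt v"
  then show ?thesis by (intro exI[of _ "{v}"]) (auto simp: vertex_pt_def coord_def)
next
  fix u v assume "{u, v} \<in> snd G" "u \<noteq> v" "{w. p w \<noteq> 0} = {u, v}" "p u + p v = 1"
  then show ?thesis using edge_vertices[of u v] by (intro exI[of _ "{u, v}"]) (auto simp: coord_def)
qed

text \<open>Every pair involving a point of the complex is told apart by a continuous real function;
  only two ends need a finite separator.\<close>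

lemma Hausdorff_FT: "Hausdorff_space FT"
proof -
  have sep: "\<exists>U V. openin FT U \<and> openin FT V \<and> x \<in> U \<and> y \<in> V \<and> disjnt U V"
    if xy: "x \<in> fpoints G" "y \<in> fpoints G" and f: "continuous_map FT euclideanreal f" "f x \<noteq> f y" for f x y
  proof -
    obtain U V :: "real set" where U: "open U" "open V" "f x \<in> U" "f y \<in> V" "U \<inter> V = {}"
      using hausdorff[OF f(2)] by blast
    show ?thesis
      by (rule exI[of _ "{z \<in> topspace FT. f z \<in> U}"], rule exI[of _ "{z \<in> topspace FT. f z \<in> V}"])
        (use U xy openin_continuous_map_preimage[OF f(1)] in \<open>auto simp: disjnt_def\<close>)
  qed
  have GE: "\<exists>U V. openin FT U \<and> openin FT V \<and> Gp p \<in> U \<and> Ep \<omega> \<in> V \<and> disjnt U V"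
    if "Gp p \<in> fpoints G" "Ep \<omega> \<in> fpoints G" for p \<omega>
  proof -
    have "is_gpt G p" using that unfolding fpoints_def by auto
    then obtain S where S: "finite S" "S \<subseteq> fst G" "(\<Sum>w\<in>S. coord w (Gp p)) = 1"
      using Gp_support_sum by blast
    have "(\<Sum>w\<in>S. coord w (Ep \<omega>)) = 0" by (simp add: coord_def)
    moreover have "continuous_map FT euclideanreal (\<lambda>x. \<Sum>w\<in>S. coord w x)"
      using S continuous_coord by (intro continuous_map_sum) auto
    ultimately show ?thesis using sep[OF that, of "\<lambda>x. \<Sum>w\<in>S. coord w x"] S by auto
  qed
  show ?thesis unfolding Hausdorff_space_def topspace_FT
  proof (intro allI impI)
    fix x y assume xy: "x \<in> fpoints G \<and> y \<in> fpoints G \<and> x \<noteq> y"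
    show "\<exists>U V. openin FT U \<and> openin FT V \<and> x \<in> U \<and> y \<in> V \<and> disjnt U V"
    proof (cases x; cases y)
      fix p q assume pq: "x = Gp p" "y = Gp q"
      then obtain w where w: "p w \<noteq> q w" using xy by auto
      have g: "is_gpt G p" "is_gpt G q" using pq xy unfolding fpoints_def by auto
      have "w \<in> fst G" using w gpt_support_vertex g by metis
      then show ?thesis using sep[OF _ _ continuous_coord, of x y w] xy pq w by (auto simp: coord_def)
    next
      fix p \<omega> assume "x = Gp p" "y = Ep \<omega>" then show ?thesis using GE xy by blast
    next
      fix p \<omega> assume "x = Ep \<omega>" "y = Gp p" then show ?thesis using GE[of p \<omega>] xy
        by (metis disjnt_sym)
    next
      fix \<omega> \<omega>' assume e: "x = Ep \<omega>" "y = Ep \<omega>'"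
      then have o: "\<omega> \<in> ends G" "\<omega>' \<in> ends G" "\<omega> \<noteq> \<omega>'" using xy unfolding fpoints_def by auto
      obtain S C C' where S: "finite S" "S \<subseteq> fst G" and C: "C \<in> comps G S" "C' \<in> comps G S" "C \<inter> C' = {}"
        "\<forall>r\<in>\<omega>. tail_in r C" "\<forall>r\<in>\<omega>'. tail_in r C'" using ends_distinct[OF o] by blast
      have d: "C' \<inter> S = {}" using comp_subset C by blast
      have "disjnt (end_nbhd G S C) (end_nbhd G S C')"
        unfolding disjnt_def end_nbhd_def using C(3) d end_nonempty
      proof (safe, goal_cases)
        case (2 w w')
        then show ?case by (metis tail_in_same disjoint_iff)
      qed blast+
      moreover have "x \<in> end_nbhd G S C" "y \<in> end_nbhd G S C'" unfolding end_nbhd_def using e o C by auto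
      ultimately show ?thesis using open_end_nbhd S C by blast
    qed
  qed
qed

lemma continuous_into_FT:
  assumes f: "\<And>t. t \<in> D \<Longrightarrow> f t \<in> fpoints G"
    and nb: "\<And>t N. t \<in> D \<Longrightarrow> basic_nbhd G (f t) N \<Longrightarrow> \<exists>\<delta>>0. \<forall>t'\<in>D. \<bar>t' - t\<bar> < \<delta> \<longrightarrow> f t' \<in> N"
  shows "continuous_map (top_of_set (D :: real set)) FT f"
  unfolding continuous_map_def
proof (intro conjI allI impI)
  show "f \<in> topspace (top_of_set D) \<rightarrow> topspace FT" using f by auto
  fix U assume U: "openin FT U"
  show "openin (top_of_set D) {x \<in> topspace (top_of_set D). f x \<in> U}"
    unfolding openin_euclidean_subtopology_iff
  proof (intro conjI ballI)
    fix t assume "t \<in> {x \<in> topspace (top_of_set D). f x \<in> U}"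
    then have t: "t \<in> D" "f t \<in> U" by auto
    then obtain N where "basic_nbhd G (f t) N" "N \<subseteq> U" using U unfolding openin_FT by blast
    then obtain \<delta> where "\<delta> > 0" "\<forall>t'\<in>D. \<bar>t' - t\<bar> < \<delta> \<longrightarrow> f t' \<in> N" using nb t by blast
    then show "\<exists>e>0. \<forall>x'\<in>D. dist x' t < e \<longrightarrow> x' \<in> {x \<in> topspace (top_of_set D). f x \<in> U}"
      using \<open>N \<subseteq> U\<close> by (intro exI[of _ \<delta>]) (auto simp: dist_real_def)
  qed auto
qed

section \<open>Edges as affine segments\<close>

definition mix :: "'v \<Rightarrow> 'v \<Rightarrow> real \<Rightarrow> 'v \<Rightarrow> real" where
  "mix u v c w = (1 - c) * vertex_pt u w + c * vertex_pt v w"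

lemma mix_0 [simp]: "mix u v 0 = vertex_pt u" and mix_1 [simp]: "mix u v 1 = vertex_pt v"
  by (auto simp: mix_def)

lemma mix_gpt: "{u, v} \<in> snd G \<Longrightarrow> 0 \<le> c \<Longrightarrow> c \<le> 1 \<Longrightarrow> is_gpt G (mix u v c)"
proof -
  assume e: "{u, v} \<in> snd G" "0 \<le> c" "c \<le> 1"
  consider "c = 0" | "c = 1" | "0 < c" "c < 1" using e by linarith
  then show ?thesis
  proof cases
    case 3 then show ?thesis using e edge_vertices[OF e(1)] unfolding is_gpt_def
      by (intro disjI2 exI[of _ u] exI[of _ v]) (auto simp: mix_def vertex_pt_def)
  qed (use e edge_vertices vertex_gpt in auto)
qed

lemma mix_support: "u \<noteq> v \<Longrightarrow> 0 < c \<Longrightarrow> c < 1 \<Longrightarrow> {w. mix u v c w \<noteq> 0} = {u, v}"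
  by (auto simp: mix_def vertex_pt_def)

lemma mix_diff: "\<bar>mix u v c w - mix u v d w\<bar> \<le> \<bar>c - d\<bar>"
proof -
  have "mix u v c w - mix u v d w = (c - d) * (vertex_pt v w - vertex_pt u w)"
    by (simp add: mix_def algebra_simps)
  moreover have "\<bar>vertex_pt v w - vertex_pt u w\<bar> \<le> 1" by (auto simp: vertex_pt_def)
  ultimately show ?thesis by (simp add: abs_mult mult_left_le)
qed

lemma gpt_inner_mix:
  assumes "is_gpt G p" "{w. p w \<noteq> 0} = {u, v}" "u \<noteq> v"
  shows "p = mix u v (p v) \<and> 0 < p v \<and> p v < 1"
proof -
  have "p u + p v = 1 \<and> p u > 0 \<and> p v > 0"
    using gpt_support[OF assms(1)] assms(2,3)
    by (elim disjE exE conjE bexE) (auto simp: doubleton_eq_iff)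
  moreover have "p w = 0" if "w \<noteq> u" "w \<noteq> v" for w using assms that by auto
  ultimately show ?thesis using assms(3) by (auto simp: mix_def vertex_pt_def fun_eq_iff)
qed

end

lemma vertex_pt_inj [simp]: "vertex_pt u = vertex_pt v \<longleftrightarrow> u = v"
  by (metis vertex_pt_def zero_neq_one)

section \<open>From a labelled compact set of reals to a Hamilton circle\<close>

lemma adjacent_points_around:
  fixes Z :: "real set"
  assumes Z: "compact Z" "a \<in> Z" "b \<in> Z" and t: "a \<le> t" "t \<le> b" "t \<notin> Z"
  shows "\<exists>s\<in>Z. \<exists>u\<in>Z. s < t \<and> t < u \<and> {s<..<u} \<inter> Z = {}"
proof -
  have "compact (Z \<inter> {..t})" "compact (Z \<inter> {t..})" using Z compact_Int_closed by blast+
  moreover have "a \<in> Z \<inter> {..t}" "b \<in> Z \<inter> {t..}" using Z t by auto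
  ultimately obtain s u where s: "s \<in> Z \<inter> {..t}" "\<forall>z\<in>Z \<inter> {..t}. z \<le> s"
    and u: "u \<in> Z \<inter> {t..}" "\<forall>z\<in>Z \<inter> {t..}. u \<le> z"
    using compact_attains_sup[of "Z \<inter> {..t}"] compact_attains_inf[of "Z \<inter> {t..}"] by blast
  have "s \<noteq> t" "u \<noteq> t" using s u t by auto
  moreover have "{s<..<u} \<inter> Z = {}"
  proof (rule ccontr)
    assume "{s<..<u} \<inter> Z \<noteq> {}"
    then obtain z where z: "z \<in> Z" "s < z" "z < u" by auto
    then show False using bspec[OF s(2), of z] bspec[OF u(2), of z] by (cases "z \<le> t") auto
  qed
  ultimately show ?thesis using s u by (intro bexI[of _ s] bexI[of _ u]) auto
qed

text \<open>The map \<open>e\<close> is a quotient map of the interval onto the unit circle that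
  identifies only the two end points, so \<open>f\<close> descends to a continuous injection
  \<open>F\<close>. As the circle is compact and \<open>X\<close> is Hausdorff, \<open>F\<close> is
  a homeomorphism onto its image.\<close>

lemma circle_of_closed_curve:
  fixes f :: "real \<Rightarrow> 'a" and a b :: real
  assumes ab: "a < b" and X: "Hausdorff_space X" and f: "continuous_map (top_of_set {a..b}) X f"
    and inj: "inj_on f {a..<b}" and fab: "f a = f b"
  shows "is_circle X (f ` {a..b})"
proof -
  define e where "e t = cis (2 * pi * ((t - a) / (b - a)))" for t
  let ?S = "sphere (0::complex) 1"
  have e_eq: "e t = e t' \<Longrightarrow> t = t' \<or> t \<in> {a, b} \<and> t' \<in> {a, b}" if t: "t \<in> {a..b}" "t' \<in> {a..b}" for t t'
  proof -
    assume "e t = e t'"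
    then obtain n :: int where "2 * pi * ((t - a) / (b - a)) = 2 * pi * ((t' - a) / (b - a)) + 2 * pi * n"
      unfolding e_def by (metis cis.sel sin_cos_eq_iff)
    then have "2 * pi * ((t - a) / (b - a)) = 2 * pi * ((t' - a) / (b - a) + n)"
      unfolding distrib_left by simp
    then have n: "(t - a) / (b - a) = (t' - a) / (b - a) + n"
      by (subst (asm) mult_cancel_left) simp
    have r: "0 \<le> (t - a) / (b - a)" "(t - a) / (b - a) \<le> 1" "0 \<le> (t' - a) / (b - a)" "(t' - a) / (b - a) \<le> 1"
      using t ab by (auto simp: field_simps)
    \<comment> \<open>The normalised parameters lie in [0,1] and differ by the integer
      \<open>n\<close>, so \<open>n\<close> is -1, 0 or 1; a nonzero value forces the two end
      points.\<close>
    have "-1 \<le> real_of_int n" "real_of_int n \<le> 1" using n r by linarith+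
    then have "n = -1 \<or> n = 0 \<or> n = 1" by linarith
    then show ?thesis
    proof (elim disjE)
      assume "n = 0" then show ?thesis using n ab by (simp add: field_simps)
    next
      assume "n = 1"
      then have "(t - a) / (b - a) = 1" "(t' - a) / (b - a) = 0" using n r by linarith+
      then show ?thesis using ab by (simp add: field_simps)
    next
      assume "n = -1"
      then have "(t - a) / (b - a) = 0" "(t' - a) / (b - a) = 1" using n r by linarith+
      then show ?thesis using ab by (simp add: field_simps)
    qed
  qed
  have e_surj: "\<exists>t\<in>{a..<b}. e t = z" if "z \<in> ?S" for z
  proof -
    have "(Re z)\<^sup>2 + (Im z)\<^sup>2 = 1" using that by (simp add: cmod_def)
    then obtain x where x: "0 \<le> x" "x < 2 * pi" "Re z = cos x" "Im z = sin x"
      using sincos_total_2pi by metis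
    let ?t = "a + (b - a) * (x / (2 * pi))"
    have "(b - a) * (x / (2 * pi)) < (b - a) * 1" using x ab by (intro mult_strict_left_mono) (auto simp: field_simps)
    moreover have "0 \<le> (b - a) * (x / (2 * pi))" using x ab by simp
    ultimately have "?t \<in> {a..<b}" by auto
    moreover have "e ?t = z" unfolding e_def using ab x by (auto simp: complex_eq_iff)
    ultimately show ?thesis by blast
  qed
  have e_in: "e t \<in> ?S" for t unfolding e_def by simp
  have "continuous_on {a..b} e" unfolding e_def using ab by (intro continuous_intros) auto
  then have ce: "continuous_map (top_of_set {a..b}) (top_of_set ?S) e"
    using e_in by (auto simp: continuous_map_in_subtopology)
  have "closed_map (top_of_set {a..b}) (top_of_set ?S) e"
    by (rule continuous_imp_closed_map_gen[OF _ _ ce])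
      (auto simp: compact_space_subtopology Hausdorff_space_subtopology Hausdorff_imp_kc_space)
  moreover have "e ` {a..b} = ?S" using e_surj e_in by fastforce
  ultimately have q: "quotient_map (top_of_set {a..b}) (top_of_set ?S) e"
    using continuous_closed_imp_quotient_map[OF ce] by auto
  define F where "F z = f (SOME t. t \<in> {a..<b} \<and> e t = z)" for z
  have Fsome: "\<exists>t\<in>{a..<b}. e t = z \<and> F z = f t" if "z \<in> ?S" for z
    unfolding F_def using someI_ex[of "\<lambda>t. t \<in> {a..<b} \<and> e t = z"] e_surj[OF that] by blast
  have Fe: "F (e t) = f t" if t: "t \<in> {a..b}" for t
  proof -
    obtain t' where t': "t' \<in> {a..<b}" "e t' = e t" "F (e t) = f t'" using Fsome[OF e_in] by blast
    then show ?thesis using e_eq[of t' t] t fab by auto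
  qed
  have cF: "continuous_map (top_of_set ?S) X F"
  proof (rule continuous_compose_quotient_map[OF q])
    show "continuous_map (top_of_set {a..b}) X (F \<circ> e)"
      by (rule continuous_map_eq[OF f]) (simp add: Fe)
  qed
  have im: "F ` ?S = f ` {a..b}"
  proof (intro subset_antisym subsetI)
    fix y assume "y \<in> F ` ?S"
    then obtain t where "t \<in> {a..<b}" "y = f t" using Fsome by blast
    then show "y \<in> f ` {a..b}" by auto
  next
    fix y assume "y \<in> f ` {a..b}"
    then obtain t where "t \<in> {a..b}" "y = F (e t)" using Fe by force
    then show "y \<in> F ` ?S" using e_in by blast
  qed
  have injF: "inj_on F ?S"
  proof (rule inj_onI)
    fix z z' assume z: "z \<in> ?S" "z' \<in> ?S" "F z = F z'"
    obtain t t' where "t \<in> {a..<b}" "t' \<in> {a..<b}" "e t = z" "e t' = z'" "f t = f t'"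
      using Fsome[OF z(1)] Fsome[OF z(2)] z(3) by metis
    then show "z = z'" using inj by (metis inj_onD)
  qed
  have sub: "f ` {a..b} \<subseteq> topspace X" using continuous_map_image_subset_topspace[OF f] by auto
  have "homeomorphic_map (top_of_set ?S) (subtopology X (f ` {a..b})) F"
  proof (rule bijective_closed_imp_homeomorphic_map)
    show cF': "continuous_map (top_of_set ?S) (subtopology X (f ` {a..b})) F"
      using cF im by (auto simp: continuous_map_in_subtopology)
    have "kc_space (subtopology X (f ` {a..b}))"
      using X by (intro Hausdorff_imp_kc_space Hausdorff_space_subtopology)
    then show "closed_map (top_of_set ?S) (subtopology X (f ` {a..b})) F"
      by (intro continuous_imp_closed_map_gen cF') (simp_all add: compact_space_subtopology)
    show "F ` topspace (top_of_set ?S) = topspace (subtopology X (f ` {a..b}))"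
      using im sub by (simp add: Int_absorb1)
  qed (use injF in simp)
  then show ?thesis unfolding is_circle_def using sub by blast
qed

context lf_graph
begin

lemma vertex_in_end_nbhd: "Gp (vertex_pt v) \<in> end_nbhd G S C \<Longrightarrow> v \<in> C"
  unfolding end_nbhd_def by (auto simp: vertex_pt_def split: if_splits)

text \<open>The complementary intervals of \<open>Z\<close> are filled with the edges between the labels of their end points.\<close>

lemma hamiltonian_from_labels:
  fixes Z :: "real set" and lab :: "real \<Rightarrow> 'v fpoint"
  assumes Z: "compact Z" "a \<in> Z" "b \<in> Z" "a < b" "Z \<subseteq> {a..b}"
    and lab: "\<And>z. z \<in> Z \<Longrightarrow> (\<exists>v\<in>fst G. lab z = Gp (vertex_pt v)) \<or> (\<exists>\<omega>\<in>ends G. lab z = Ep \<omega>)"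
    and inj: "inj_on lab (Z - {b})" and lab_ab: "lab a = lab b"
    and consec: "\<And>s t. s \<in> Z \<Longrightarrow> t \<in> Z \<Longrightarrow> s < t \<Longrightarrow> {s<..<t} \<inter> Z = {} \<Longrightarrow>
      \<exists>u v. lab s = Gp (vertex_pt u) \<and> lab t = Gp (vertex_pt v) \<and> {u, v} \<in> snd G"
    and iso: "\<And>z v. z \<in> Z \<Longrightarrow> lab z = Gp (vertex_pt v) \<Longrightarrow> \<exists>\<delta>>0. \<forall>z'\<in>Z. \<bar>z' - z\<bar> < \<delta> \<longrightarrow> z' = z"
    and endc: "\<And>z \<omega> S C. z \<in> Z \<Longrightarrow> lab z = Ep \<omega> \<Longrightarrow> finite S \<Longrightarrow> S \<subseteq> fst G \<Longrightarrow> C \<in> comps G S \<Longrightarrow>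
      \<forall>r\<in>\<omega>. tail_in r C \<Longrightarrow> \<exists>\<delta>>0. \<forall>z'\<in>Z. \<bar>z' - z\<bar> < \<delta> \<longrightarrow> lab z' \<in> end_nbhd G S C"
    and big: "c \<in> Z" "d \<in> Z" "a < c" "c < d" "d < b"
    and all: "\<And>v. v \<in> fst G \<Longrightarrow> \<exists>z\<in>Z. lab z = Gp (vertex_pt v)"
  shows "hamiltonian G"
proof -
  define con where "con s u \<longleftrightarrow> s \<in> Z \<and> u \<in> Z \<and> s < u \<and> {s<..<u} \<inter> Z = {}" for s u
  have con_no: "False" if "con s u" "z \<in> Z" "s < z" "z < u" for s u z
    using that unfolding con_def disjoint_iff greaterThanLessThan_iff by blast
  have conD: "s \<in> Z" "u \<in> Z" "s < u" if "con s u" for s u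
    using that unfolding con_def by auto
  have con_uniq: "s = s' \<and> u = u'" if "con s u" "con s' u'" "s < t" "t < u" "s' < t" "t < u'" for s u s' u' t
  proof -
    have "\<not> s < s'" using con_no[OF that(1), of s'] conD[OF that(2)] that(3-6) by auto
    moreover have "\<not> s' < s" using con_no[OF that(2), of s] conD[OF that(1)] that(3-6) by auto
    moreover have "\<not> u < u'" using con_no[OF that(2), of u] conD[OF that(1)] that(3-6) by auto
    moreover have "\<not> u' < u" using con_no[OF that(1), of u'] conD[OF that(2)] that(3-6) by auto
    ultimately show ?thesis by auto
  qed
  have "\<forall>t\<in>{a..b} - Z. \<exists>p. con (fst p) (snd p) \<and> fst p < t \<and> t < snd p"
    using adjacent_points_around[OF Z(1-3)] unfolding con_def by fastforce
  then obtain pr where pr: "\<And>t. t \<in> {a..b} - Z \<Longrightarrow> con (fst (pr t)) (snd (pr t)) \<and> fst (pr t) < t \<and> t < snd (pr t)"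
    by metis
  define vt where "vt z = (SOME v. lab z = Gp (vertex_pt v))" for z
  have vt: "vt z = v" if "lab z = Gp (vertex_pt v)" for z v
    unfolding vt_def by (rule some_equality) (use that in auto)
  have con_edge: "lab s = Gp (vertex_pt (vt s)) \<and> lab u = Gp (vertex_pt (vt u)) \<and> {vt s, vt u} \<in> snd G" if "con s u" for s u
    using consec[of s u] that vt unfolding con_def by metis
  define f where "f t = (if t \<in> Z then lab t else
     (let s = fst (pr t); u = snd (pr t) in Gp (mix (vt s) (vt u) ((t - s) / (u - s)))))" for t
  have fZ: "f t = lab t" if "t \<in> Z" for t using that by (simp add: f_def)
  have fcon: "f t = Gp (mix (vt s) (vt u) ((t - s) / (u - s)))" if c: "con s u" and t: "s \<le> t" "t \<le> u" for s u t
  proof (cases "t = s \<or> t = u")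
    case True
    then show ?thesis using c con_edge[OF c] fZ unfolding con_def by auto
  next
    case False
    then have st: "s < t" "t < u" using t by auto
    then have "t \<notin> Z" "t \<in> {a..b}" using c Z(5) unfolding con_def by fastforce+
    then have "fst (pr t) = s \<and> snd (pr t) = u" using con_uniq[OF _ c] pr[of t] st by blast
    then show ?thesis using \<open>t \<notin> Z\<close> by (simp add: f_def)
  qed
  have frac: "0 \<le> (t - s) / (u - s) \<and> (t - s) / (u - s) \<le> 1" if "con s u" "s \<le> t" "t \<le> u" for s u t
    using that unfolding con_def by (auto simp: field_simps)
  have fgpt: "is_gpt G (mix (vt s) (vt u) ((t - s) / (u - s)))" if "con s u" "s \<le> t" "t \<le> u" for s u t
    using mix_gpt con_edge[OF that(1)] frac[OF that] by blast
  have nonZ: "\<exists>s u. con s u \<and> s < t \<and> t < u" if "t \<in> {a..b}" "t \<notin> Z" for t using pr that by blast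
  have fin: "f t \<in> fpoints G" if t: "t \<in> {a..b}" for t
  proof (cases "t \<in> Z")
    case True
    then show ?thesis using lab[OF True] fZ[OF True] vertex_gpt unfolding fpoints_def by auto
  next
    case False
    then obtain s u where "con s u" "s < t" "t < u" using nonZ t by blast
    then show ?thesis using fcon[of s u t] fgpt[of s u t] unfolding fpoints_def by auto
  qed
  have loc: "\<exists>\<delta>>0. \<forall>t'. s \<le> t' \<and> t' \<le> u \<and> \<bar>t' - t\<bar> < \<delta> \<longrightarrow> f t' \<in> vball G p \<epsilon>"
    if c: "con s u" "s \<le> t" "t \<le> u" "f t = Gp p" "\<epsilon> > 0" for s u t p \<epsilon>
  proof (intro exI[of _ "\<epsilon> * (u - s)"] conjI allI impI)
    have su: "s < u" using c unfolding con_def by auto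
    show "0 < \<epsilon> * (u - s)" using su c by simp
    fix t' assume t': "s \<le> t' \<and> t' \<le> u \<and> \<bar>t' - t\<bar> < \<epsilon> * (u - s)"
    have p: "p = mix (vt s) (vt u) ((t - s) / (u - s))" using fcon c by auto
    have "\<bar>mix (vt s) (vt u) ((t' - s) / (u - s)) w - p w\<bar> < \<epsilon>" for w
    proof -
      have "\<bar>mix (vt s) (vt u) ((t' - s) / (u - s)) w - p w\<bar> \<le> \<bar>(t' - s) / (u - s) - (t - s) / (u - s)\<bar>"
        unfolding p by (rule mix_diff)
      also have "\<dots> = \<bar>t' - t\<bar> / (u - s)" using su by (simp flip: diff_divide_distrib)
      also have "\<dots> < \<epsilon>" using t' su by (simp add: field_simps)
      finally show ?thesis .
    qed
    then show "f t' \<in> vball G p \<epsilon>" using fcon[of s u t'] fgpt[of s u t'] c t' unfolding vball_def by auto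
  qed
  \<comment> \<open>Either a complementary interval starts at \<open>t\<close>, or points of
    \<open>Z\<close> come arbitrarily close from the right. At a vertex \<open>iso\<close> leaves
    only the first alternative, at an end \<open>con_edge\<close> leaves only the second.\<close>
  have nearR: "\<exists>z\<in>Z. t < z \<and> (z < t + \<delta> \<or> con t z)" if "t \<in> Z" "t < b" "\<delta> > 0" for t \<delta>
  proof -
    define t' where "t' = min (t + \<delta> / 2) ((t + b) / 2)"
    have t': "t < t'" "t' < t + \<delta>" "t' < b" unfolding t'_def min_def using that by auto
    have ta: "a \<le> t" using that Z by auto
    show ?thesis
    proof (cases "t' \<in> Z")
      case False
      then obtain s u where c: "con s u" "s < t'" "t' < u" using nonZ[of t'] t' ta by auto
      have "\<not> s < t" using con_no[OF c(1), of t] that t' c(3) by auto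
      then have "s = t \<or> t < s" by auto
      then show ?thesis
      proof
        assume "s = t" then show ?thesis using c t' conD[OF c(1)] by (intro bexI[of _ u]) auto
      next
        assume "t < s" then show ?thesis using c t' conD[OF c(1)] by (intro bexI[of _ s]) auto
      qed
    qed (use t' in blast)
  qed
  have nearL: "\<exists>z\<in>Z. z < t \<and> (t - \<delta> < z \<or> con z t)" if "t \<in> Z" "a < t" "\<delta> > 0" for t \<delta>
  proof -
    define t' where "t' = max (t - \<delta> / 2) ((t + a) / 2)"
    have t': "t' < t" "t - \<delta> < t'" "a < t'" unfolding t'_def max_def using that by auto
    have ta: "t \<le> b" using that Z by auto
    show ?thesis
    proof (cases "t' \<in> Z")
      case False
      then obtain s u where c: "con s u" "s < t'" "t' < u" using nonZ[of t'] t' ta by auto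
      have "\<not> t < u" using con_no[OF c(1), of t] that t' c(2) by auto
      then have "u = t \<or> u < t" by auto
      then show ?thesis
      proof
        assume "u = t" then show ?thesis using c t' conD[OF c(1)] by (intro bexI[of _ s]) auto
      next
        assume "u < t" then show ?thesis using c t' conD[OF c(1)] by (intro bexI[of _ u]) auto
      qed
    qed (use t' in blast)
  qed
  have cont: "continuous_map (top_of_set {a..b}) FT f"
  proof (rule continuous_into_FT)
    fix t N assume t: "t \<in> {a..b}" and N: "basic_nbhd G (f t) N"
    show "\<exists>\<delta>>0. \<forall>t'\<in>{a..b}. \<bar>t' - t\<bar> < \<delta> \<longrightarrow> f t' \<in> N"
    proof (cases "t \<in> Z")
      case False
      then obtain s u where c: "con s u" "s < t" "t < u" using nonZ t by blast
      then obtain p where p: "f t = Gp p" using fcon by force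
      then obtain \<epsilon> where e: "\<epsilon> > 0" "N = vball G p \<epsilon>" using N unfolding basic_nbhd_def by auto
      obtain \<delta> where d: "\<delta> > 0" "\<forall>t'. s \<le> t' \<and> t' \<le> u \<and> \<bar>t' - t\<bar> < \<delta> \<longrightarrow> f t' \<in> vball G p \<epsilon>"
        using loc[OF c(1), of t p \<epsilon>] c p e by auto
      show ?thesis
      proof (intro exI[of _ "min \<delta> (min (t - s) (u - t))"] conjI ballI impI)
        fix t' assume "\<bar>t' - t\<bar> < min \<delta> (min (t - s) (u - t))"
        then have "s \<le> t'" "t' \<le> u" "\<bar>t' - t\<bar> < \<delta>" by auto
        then show "f t' \<in> N" using d e by blast
      qed (use c d in auto)
    next
      case tZ: True
      show ?thesis using lab[OF tZ]
      proof (elim disjE bexE)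
        fix v assume v: "lab t = Gp (vertex_pt v)"
        then obtain \<epsilon> where e: "\<epsilon> > 0" "N = vball G (vertex_pt v) \<epsilon>" using N fZ[OF tZ] unfolding basic_nbhd_def by auto
        have ft: "f t = Gp (vertex_pt v)" using v fZ[OF tZ] by simp
        obtain \<delta>0 where d0: "\<delta>0 > 0" "\<forall>z'\<in>Z. \<bar>z' - t\<bar> < \<delta>0 \<longrightarrow> z' = t" using iso[OF tZ v] by blast
        have R: "\<exists>\<delta>>0. \<forall>t'\<in>{a..b}. t \<le> t' \<and> t' - t < \<delta> \<longrightarrow> f t' \<in> N"
        proof (cases "t < b")
          case True
          then obtain z where z: "z \<in> Z" "t < z" "z < t + \<delta>0 \<or> con t z" using nearR[OF tZ True d0(1)] by blast
          have "\<not> z < t + \<delta>0"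
          proof
            assume "z < t + \<delta>0" then have "\<bar>z - t\<bar> < \<delta>0" using z by auto
            then show False using d0 z by auto
          qed
          then have c: "con t z" using z by blast
          obtain \<delta> where "\<delta> > 0" "\<forall>t'. t \<le> t' \<and> t' \<le> z \<and> \<bar>t' - t\<bar> < \<delta> \<longrightarrow> f t' \<in> N"
            using loc[OF c _ _ ft e(1)] z e by auto
          then show ?thesis using z by (intro exI[of _ "min \<delta> (z - t)"]) auto
        next
          case False
          have "f t \<in> N" unfolding ft e vball_def using e vertex_gpt lab[OF tZ] v by auto
          then show ?thesis using False t by (intro exI[of _ 1]) (auto simp: antisym)
        qed
        have L: "\<exists>\<delta>>0. \<forall>t'\<in>{a..b}. t' \<le> t \<and> t - t' < \<delta> \<longrightarrow> f t' \<in> N"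
        proof (cases "a < t")
          case True
          then obtain z where z: "z \<in> Z" "z < t" "t - \<delta>0 < z \<or> con z t" using nearL[OF tZ True d0(1)] by blast
          have "\<not> t - \<delta>0 < z"
          proof
            assume "t - \<delta>0 < z" then have "\<bar>z - t\<bar> < \<delta>0" using z by auto
            then show False using d0 z by auto
          qed
          then have c: "con z t" using z by blast
          obtain \<delta> where "\<delta> > 0" "\<forall>t'. z \<le> t' \<and> t' \<le> t \<and> \<bar>t' - t\<bar> < \<delta> \<longrightarrow> f t' \<in> N"
            using loc[OF c _ _ ft e(1)] z e by auto
          then show ?thesis using z by (intro exI[of _ "min \<delta> (t - z)"]) auto
        next
          case False
          have "f t \<in> N" unfolding ft e vball_def using e vertex_gpt lab[OF tZ] v by auto
          then show ?thesis using False t by (intro exI[of _ 1]) (auto simp: antisym)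
        qed
        obtain \<delta>1 where d1: "\<delta>1 > 0" "\<forall>t'\<in>{a..b}. t \<le> t' \<and> t' - t < \<delta>1 \<longrightarrow> f t' \<in> N" using R by blast
        obtain \<delta>2 where d2: "\<delta>2 > 0" "\<forall>t'\<in>{a..b}. t' \<le> t \<and> t - t' < \<delta>2 \<longrightarrow> f t' \<in> N" using L by blast
        show ?thesis
        proof (intro exI[of _ "min \<delta>1 \<delta>2"] conjI ballI impI)
          fix t' assume "t' \<in> {a..b}" "\<bar>t' - t\<bar> < min \<delta>1 \<delta>2"
          then show "f t' \<in> N" using d1 d2 by (cases "t \<le> t'") auto
        qed (use d1 d2 in auto)
      next
        fix \<omega> assume o: "\<omega> \<in> ends G" "lab t = Ep \<omega>"
        then obtain S C where S: "finite S" "S \<subseteq> fst G" "C \<in> comps G S" "\<forall>r\<in>\<omega>. tail_in r C" "N = end_nbhd G S C"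
          using N fZ[OF tZ] unfolding basic_nbhd_def by auto
        obtain \<delta> where d: "\<delta> > 0" "\<forall>z'\<in>Z. \<bar>z' - t\<bar> < \<delta> \<longrightarrow> lab z' \<in> N"
          using endc[OF tZ o(2) S(1-4)] S(5) by blast
        \<comment> \<open>An edge with both end vertices in \<open>C\<close> lies in the
          neighbourhood entirely, so it suffices to control the labels of the points of
          \<open>Z\<close>.\<close>
        have seg: "f t' \<in> N" if z: "z1 \<in> Z" "z2 \<in> Z" "z1 \<le> t'" "t' \<le> z2" "t - \<delta> < z1" "z2 < t + \<delta>" for z1 z2 t'
        proof (cases "t' \<in> Z")
          case True then show ?thesis using d fZ z by (simp add: abs_less_iff)
        next
          case False
          then obtain s u where c: "con s u" "s < t'" "t' < u" using nonZ[of t'] z Z(5) by (meson atLeastAtMost_iff order_trans subsetD)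
          have "\<not> s < z1" "\<not> z2 < u"
            using con_no[OF c(1), of z1] con_no[OF c(1), of z2] c z False by (auto simp: order_le_less)
          then have "\<bar>s - t\<bar> < \<delta>" "\<bar>u - t\<bar> < \<delta>" using z c by auto
          then have "lab s \<in> N" "lab u \<in> N" using d c unfolding con_def by auto
          then have vC: "vt s \<in> C" "vt u \<in> C" using con_edge[OF c(1)] vertex_in_end_nbhd[of "vt s" S C] vertex_in_end_nbhd[of "vt u" S C] unfolding S(5) by auto
          have fr: "0 < (t' - s) / (u - s)" "(t' - s) / (u - s) < 1" using c by (auto simp: field_simps)
          have "vt s \<noteq> vt u" using con_edge[OF c(1)] edge_vertices by blast
          then have "{w. mix (vt s) (vt u) ((t' - s) / (u - s)) w \<noteq> 0} = {vt s, vt u}" using mix_support fr by blast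
          then show ?thesis using fcon[of s u t'] fgpt[of s u t'] c vC unfolding S(5) end_nbhd_def by auto
        qed
        have R: "\<exists>\<delta>1>0. \<forall>t'\<in>{a..b}. t \<le> t' \<and> t' - t < \<delta>1 \<longrightarrow> f t' \<in> N"
        proof (cases "t < b")
          case True
          then obtain z where z: "z \<in> Z" "t < z" "z < t + \<delta> \<or> con t z" using nearR[OF tZ True d(1)] by blast
          then have "z < t + \<delta>" using con_edge[of t z] o by auto
          then show ?thesis using z seg[of t z] tZ d by (intro exI[of _ "z - t"]) auto
        next
          case False
          then show ?thesis using t seg[of t t] tZ d by (intro exI[of _ 1]) (auto simp: antisym)
        qed
        have L: "\<exists>\<delta>2>0. \<forall>t'\<in>{a..b}. t' \<le> t \<and> t - t' < \<delta>2 \<longrightarrow> f t' \<in> N"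
        proof (cases "a < t")
          case True
          then obtain z where z: "z \<in> Z" "z < t" "t - \<delta> < z \<or> con z t" using nearL[OF tZ True d(1)] by blast
          then have "t - \<delta> < z" using con_edge[of z t] o by auto
          then show ?thesis using z seg[of z t] tZ d by (intro exI[of _ "t - z"]) auto
        next
          case False
          then show ?thesis using t seg[of t t] tZ d by (intro exI[of _ 1]) (auto simp: antisym)
        qed
        obtain \<delta>1 where d1: "\<delta>1 > 0" "\<forall>t'\<in>{a..b}. t \<le> t' \<and> t' - t < \<delta>1 \<longrightarrow> f t' \<in> N" using R by blast
        obtain \<delta>2 where d2: "\<delta>2 > 0" "\<forall>t'\<in>{a..b}. t' \<le> t \<and> t - t' < \<delta>2 \<longrightarrow> f t' \<in> N" using L by blast
        show ?thesis
        proof (intro exI[of _ "min \<delta>1 \<delta>2"] conjI ballI impI)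
          fix t' assume "t' \<in> {a..b}" "\<bar>t' - t\<bar> < min \<delta>1 \<delta>2"
          then show "f t' \<in> N" using d1 d2 by (cases "t \<le> t'") auto
        qed (use d1 d2 in auto)
      qed
    qed
  qed (use fin in blast)
  have inner: "\<exists>p. f t = Gp p \<and> {w. p w \<noteq> 0} = {vt s, vt u} \<and> vt s \<noteq> vt u \<and> p (vt u) = (t - s) / (u - s)"
    if c: "con s u" "s < t" "t < u" for s u t
  proof -
    have fr: "0 < (t - s) / (u - s)" "(t - s) / (u - s) < 1" using c by (auto simp: field_simps)
    have ne: "vt s \<noteq> vt u" using con_edge[OF c(1)] edge_vertices by blast
    show ?thesis using fcon[of s u t] c mix_support[OF ne fr] ne by (auto simp: mix_def vertex_pt_def)
  qed
  have mixed: "f t \<noteq> f t'" if m: "t \<in> Z" "t' \<in> {a..b}" "t' \<notin> Z" for t t'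
  proof
    assume eq: "f t = f t'"
    obtain s u where c: "con s u" "s < t'" "t' < u" using nonZ m by blast
    then obtain p where p: "f t' = Gp p" "{w. p w \<noteq> 0} = {vt s, vt u}" "vt s \<noteq> vt u" using inner by blast
    then obtain v where "p = vertex_pt v" using lab[OF m(1)] eq fZ[OF m(1)] by auto
    then have "{w. p w \<noteq> 0} = {v}" by (auto simp: vertex_pt_def)
    then show False using p by auto
  qed
  have injf: "inj_on f {a..<b}"
  proof (rule inj_onI)
    fix t t' assume tt: "t \<in> {a..<b}" "t' \<in> {a..<b}" "f t = f t'"
    consider "t \<in> Z" "t' \<in> Z" | "t \<in> Z" "t' \<notin> Z" | "t \<notin> Z" "t' \<in> Z" | "t \<notin> Z" "t' \<notin> Z" by blast
    then show "t = t'"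
    proof cases
      case 1 then show ?thesis using tt fZ inj by (auto simp: inj_on_def)
    next
      case 2 then show ?thesis using mixed[of t t'] tt by auto
    next
      case 3 then show ?thesis using mixed[of t' t] tt by auto
    next
      case 4
      obtain s u where c: "con s u" "s < t" "t < u" using nonZ[of t] 4 tt by auto
      obtain s' u' where c': "con s' u'" "s' < t'" "t' < u'" using nonZ[of t'] 4 tt by auto
      obtain p where p: "f t = Gp p" "{w. p w \<noteq> 0} = {vt s, vt u}" "vt s \<noteq> vt u" "p (vt u) = (t - s) / (u - s)" 
        using inner[OF c] by blast
      obtain p' where p': "f t' = Gp p'" "{w. p' w \<noteq> 0} = {vt s', vt u'}" "p' (vt u') = (t' - s') / (u' - s')" 
        using inner[OF c'] by blast
      have pp: "p = p'" using p p' tt by simp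
      have lb: "s \<in> Z" "u \<in> Z" "s' \<in> Z" "u' \<in> Z" "s < u" "s' < u'" "u \<le> b" "u' \<le> b" "a \<le> s" "a \<le> s'"
        using c c' Z(5) unfolding con_def by auto
      have linj: "x = y" if "x \<in> Z" "y \<in> Z" "x \<noteq> b" "y \<noteq> b" "lab x = lab y" for x y
        using inj that unfolding inj_on_def by blast
      have "{vt s, vt u} = {vt s', vt u'}" using p p' pp by simp
      then consider "vt s = vt s'" "vt u = vt u'" | "vt s = vt u'" "vt u = vt s'" by (metis doubleton_eq_iff)
      then show ?thesis
      proof cases
        case 1
        then have "lab s = lab s'" using con_edge[OF c(1)] con_edge[OF c'(1)] by simp
        then have ss: "s = s'" using linj lb by auto
        have "\<not> u < u'" using con_no[OF c'(1), of u] lb ss by auto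
        moreover have "\<not> u' < u" using con_no[OF c(1), of u'] lb ss by auto
        ultimately have uu: "u = u'" by auto
        show ?thesis using p p' pp 1 ss uu lb by (simp add: field_simps)
      next
        case 2
        then have l: "lab s = lab u'" "lab u = lab s'" using con_edge[OF c(1)] con_edge[OF c'(1)] by simp_all
        \<comment> \<open>Two intervals can carry the same edge in opposite directions only if the
          closed curve consists of at most two intervals, which \<open>c\<close> and
          \<open>d\<close> exclude.\<close>
        have no: "\<not> (con a x \<and> con x b)" "\<not> con a b" for x
        proof -
          show "\<not> con a b" using con_no[of a b c] big by auto
          show "\<not> (con a x \<and> con x b)"
          proof
            assume "con a x \<and> con x b"
            then have cx: "con a x" "con x b" by auto
            have "x \<le> c" using con_no[OF cx(1) big(1)] big by force
            then show False using con_no[OF cx(2) big(2)] big by force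
          qed
        qed
        have 1: "u' = s \<or> u' = b \<and> s = a" using l lb linj[of s u'] linj[of s a] lab_ab Z by (cases "u' = b") auto
        have 2: "s' = u \<or> u = b \<and> s' = a" using l lb linj[of u s'] linj[of s' a] lab_ab Z by (cases "u = b") auto
        show ?thesis using 1 2 no c(1) c'(1) lb by auto
      qed
    qed
  qed
  have "is_circle FT (f ` {a..b})"
    by (rule circle_of_closed_curve[OF Z(4) Hausdorff_FT cont injf]) (use fZ Z lab_ab in simp)
  moreover have "\<forall>v\<in>fst G. Gp (vertex_pt v) \<in> f ` {a..b}"
    using all fZ Z(5) by (metis imageI subsetD)
  ultimately show ?thesis unfolding hamiltonian_def by blast
qed

end

subsection \<open>Loop erasure\<close>

lemma finite_arg_min:
  fixes g :: "'a \<Rightarrow> 'b::linorder"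
  assumes "finite A" "A \<noteq> {}" shows "\<exists>u\<in>A. \<forall>w\<in>A. g u \<le> g w"
proof -
  have "Min (g ` A) \<in> g ` A" using assms by (intro Min_in) auto
  then obtain u where "u \<in> A" "g u = Min (g ` A)" by force
  then show ?thesis using assms by (intro bexI[of _ u]) auto
qed

lemma finite_arg_max:
  fixes g :: "'a \<Rightarrow> 'b::linorder"
  assumes "finite A" "A \<noteq> {}" shows "\<exists>u\<in>A. \<forall>w\<in>A. g w \<le> g u"
proof -
  have "Max (g ` A) \<in> g ` A" using assms by (intro Max_in) auto
  then obtain u where "u \<in> A" "g u = Max (g ` A)" by force
  then show ?thesis using assms by (intro bexI[of _ u]) auto
qed

text \<open>From a time \<open>t\<close> one jumps to the step after the last visit to the class of
  \<open>f t\<close>; the times reached this way form \<open>J\<close>. Recording times instead of a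
  new sequence covers both outcomes: the erasure stops at a class that is visited infinitely often,
  and otherwise goes on forever.\<close>

lemma loop_erasure:
  fixes f :: "nat \<Rightarrow> 'v" and \<kappa> :: "'v \<Rightarrow> 'c"
  defines "fin \<equiv> \<lambda>t. finite {m. \<kappa> (f m) = \<kappa> (f t)}"
  obtains J lst where "0 \<in> J" "\<And>t. t \<in> J \<Longrightarrow> fin t \<Longrightarrow> Suc (lst t) \<in> J"
    "\<And>t. fin t \<Longrightarrow> t \<le> lst t" "\<And>t. fin t \<Longrightarrow> \<kappa> (f (lst t)) = \<kappa> (f t)"
    "\<And>t m. fin t \<Longrightarrow> lst t < m \<Longrightarrow> \<kappa> (f m) \<noteq> \<kappa> (f t)"
    "\<And>t t'. t \<in> J \<Longrightarrow> t' \<in> J \<Longrightarrow> t < t' \<Longrightarrow> fin t \<and> lst t < t'"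
proof -
  define lst where "lst t = Max {m. \<kappa> (f m) = \<kappa> (f t)}" for t
  define a where "a = rec_nat 0 (\<lambda>_ t. Suc (lst t))"
  have a: "a 0 = 0" "a (Suc k) = Suc (lst (a k))" for k by (simp_all add: a_def)
  \<comment> \<open>\<open>Max\<close> is meaningless for an infinite class, so an iterate counts
    only as long as all earlier classes were finite.\<close>
  define J where "J = {a k |k. \<forall>j<k. fin (a j)}"
  have l1: "t \<le> lst t" if "fin t" for t using that unfolding lst_def fin_def by (intro Max_ge) auto
  have l2: "\<kappa> (f (lst t)) = \<kappa> (f t)" if "fin t" for t
    using Max_in[of "{m. \<kappa> (f m) = \<kappa> (f t)}"] that unfolding lst_def fin_def by auto
  have l3: "\<kappa> (f m) \<noteq> \<kappa> (f t)" if "fin t" "lst t < m" for t m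
  proof
    assume "\<kappa> (f m) = \<kappa> (f t)"
    then have "m \<le> lst t" using that(1) unfolding lst_def fin_def by (intro Max_ge) auto
    then show False using that(2) by simp
  qed
  have a_less: "lst (a k) < a k'" if "k < k'" "\<forall>j<k'. fin (a j)" for k k' using that
  proof (induction k')
    case (Suc k')
    then show ?case using a l1[of "a k'"] by (cases "k = k'") (auto simp: less_Suc_eq)
  qed simp
  show ?thesis
  proof (rule that[of J lst])
    show "0 \<in> J" unfolding J_def by (intro CollectI exI[of _ 0]) (simp add: a(1))
    show "Suc (lst t) \<in> J" if tJ: "t \<in> J" "fin t" for t
    proof -
      obtain k where k: "t = a k" "\<forall>j<k. fin (a j)" using tJ(1) unfolding J_def by blast
      have "\<forall>j<Suc k. fin (a j)" using k tJ(2) by (auto simp: less_Suc_eq)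
      then show ?thesis unfolding J_def by (intro CollectI exI[of _ "Suc k"]) (simp add: a(2) k(1))
    qed
    fix t t' assume t: "t \<in> J" "t' \<in> J" "t < t'"
    then obtain k k' where k: "t = a k" "t' = a k'" "\<forall>j<k. fin (a j)" "\<forall>j<k'. fin (a j)" unfolding J_def by blast
    have "k < k'"
    proof (rule ccontr)
      assume "\<not> k < k'"
      then have "a k' \<le> a k" using a_less[of k' k] l1[of "a k'"] k by (cases "k = k'") auto
      then show False using t k by simp
    qed
    then show "fin t \<and> lst t < t'" using a_less k by blast
  qed (use l1 l2 l3 in auto)
qed

subsection \<open>Caterpillar spines laid out along an interval\<close>

text \<open>The spine vertices sit at positions \<open>\<tau>\<close> in the unit interval, \<open>E\<close> is the set of
  positions occupied by ends, and \<open>sp\<close> sends a leaf to the spine vertex it hangs from.\<close>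

locale spine =
  fixes V SP :: "'v set" and adj :: "'v \<Rightarrow> 'v \<Rightarrow> bool" and sp :: "'v \<Rightarrow> 'v"
    and \<tau> :: "'v \<Rightarrow> real" and E :: "real set"
  assumes adj_sym: "adj u v \<Longrightarrow> adj v u"
    and adj_V: "adj u v \<Longrightarrow> u \<in> V \<and> v \<in> V \<and> u \<noteq> v"
    and conn: "u \<in> V \<Longrightarrow> v \<in> V \<Longrightarrow> adj\<^sup>*\<^sup>* u v"
    and SP_V: "SP \<subseteq> V"
    and sp_SP: "z \<in> V \<Longrightarrow> sp z \<in> SP" and sp_id: "s \<in> SP \<Longrightarrow> sp s = s"
    and sp_adj: "z \<in> V \<Longrightarrow> z \<notin> SP \<Longrightarrow> adj z (sp z)"
    and fin_block: "s \<in> SP \<Longrightarrow> finite {z \<in> V. sp z = s}"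
    and E_closed: "closed E" and E01: "E \<subseteq> {0..1}"
    and tau01: "s \<in> SP \<Longrightarrow> \<tau> s \<in> {0..1}" and tau_inj: "inj_on \<tau> SP"
    and tau_E: "s \<in> SP \<Longrightarrow> \<tau> s \<notin> E"
    and discr: "t \<in> {0..1} \<Longrightarrow> t \<notin> E \<Longrightarrow> \<exists>\<epsilon>>0. finite {s \<in> SP. \<bar>\<tau> s - t\<bar> < \<epsilon>}"
    and consec: "s \<in> SP \<Longrightarrow> s' \<in> SP \<Longrightarrow> \<tau> s < \<tau> s' \<Longrightarrow> \<forall>u\<in>SP. \<not> (\<tau> s < \<tau> u \<and> \<tau> u < \<tau> s') \<Longrightarrow>
      \<forall>e\<in>E. \<not> (\<tau> s < e \<and> e < \<tau> s') \<Longrightarrow> adj s s'"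
    and around: "t \<in> {0..1} \<Longrightarrow> t \<notin> E \<Longrightarrow>
      \<exists>s\<in>SP. \<exists>s'\<in>SP. \<tau> s \<le> t \<and> t \<le> \<tau> s' \<and> (\<forall>e\<in>E. \<not> (\<tau> s \<le> e \<and> e \<le> \<tau> s'))"
    and rays: "x \<in> E \<Longrightarrow> \<exists>r. (\<forall>n. adj (r n) (r (Suc n))) \<and> (\<lambda>n. \<tau> (sp (r n))) \<longlonglongrightarrow> x"
begin

definition pos :: "'v \<Rightarrow> real" where "pos z = \<tau> (sp z)"

text \<open>Two vertices lie in the same gap iff the same ends lie to the left of them.\<close>

definition cl :: "'v \<Rightarrow> real set" where "cl z = {e \<in> E. e < pos z}"

text \<open>Adjacency in the square of the graph given by \<open>adj\<close>.\<close>

definition adj2 :: "'v \<Rightarrow> 'v \<Rightarrow> bool" where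
  "adj2 u w \<longleftrightarrow> adj u w \<or> u \<noteq> w \<and> (\<exists>v. adj u v \<and> adj v w)"

lemma E_range: "e \<in> E \<Longrightarrow> 0 \<le> e \<and> e \<le> 1" using E01 by auto

lemma pos_SP: "s \<in> SP \<Longrightarrow> pos s = \<tau> s" by (simp add: pos_def sp_id)

lemma sp_sp: "z \<in> V \<Longrightarrow> sp (sp z) = sp z" using sp_id sp_SP by blast

lemma pos_sp: "z \<in> V \<Longrightarrow> pos (sp z) = pos z" by (simp add: pos_def sp_sp)

lemma cl_sp: "z \<in> V \<Longrightarrow> cl (sp z) = cl z" by (simp add: cl_def pos_sp)

lemma pos01: "z \<in> V \<Longrightarrow> 0 \<le> pos z \<and> pos z \<le> 1" using tau01 sp_SP unfolding pos_def by force

lemma pos_E: "z \<in> V \<Longrightarrow> pos z \<notin> E" using tau_E sp_SP unfolding pos_def by blast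

lemma adj2_sym: "adj2 u v \<Longrightarrow> adj2 v u" unfolding adj2_def using adj_sym by blast

lemma cl_eqD: "cl z = cl z' \<Longrightarrow> e \<in> E \<Longrightarrow> e < pos z \<longleftrightarrow> e < pos z'" unfolding cl_def by blast

lemma cl_between: 
  assumes "cl z = cl z'" "pos z \<le> pos w" "pos w \<le> pos z'"
  shows "cl w = cl z"
  using assms unfolding cl_def by (auto 0 3 simp: set_eq_iff intro: order_less_le_trans)

section \<open>Gaps: finiteness, successors, parity and room for leaves\<close>

lemma cl_no_E: "z' \<in> V \<Longrightarrow> z \<in> V \<Longrightarrow> cl z = cl z' \<Longrightarrow> {pos z..pos z'} \<inter> E = {}"
proof (rule ccontr)
  assume z: "z' \<in> V" "z \<in> V" and c: "cl z = cl z'" "{pos z..pos z'} \<inter> E \<noteq> {}"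
  then obtain e where e: "e \<in> E" "pos z \<le> e" "e \<le> pos z'" by auto
  then have "e \<noteq> pos z'" using pos_E z by blast
  then show False using cl_eqD[OF c(1) e(1)] e by auto
qed

lemma cl_eqI:
  assumes "\<And>e. e \<in> E \<Longrightarrow> \<not> (min (pos z) (pos z') \<le> e \<and> e < max (pos z) (pos z'))"
  shows "cl z = cl z'"
  using assms unfolding cl_def by (force simp: min_def max_def split: if_splits)

text \<open>By \<open>discr\<close> the part of \<open>K\<close> in the unit interval is covered by
  intervals with finitely many spine vertices each, and finitely many of them suffice.\<close>

lemma finite_compact:
  assumes K: "compact K" "K \<inter> E = {}" shows "finite {s \<in> SP. \<tau> s \<in> K}"
proof -
  have "compact (K \<inter> {0..1::real})" using K by (intro compact_Int compact_Icc)
  moreover have "\<forall>t\<in>K \<inter> {0..1}. \<exists>\<epsilon>>0. finite {s \<in> SP. \<bar>\<tau> s - t\<bar> < \<epsilon>}" using discr K by blast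
  then obtain \<epsilon> where e: "\<And>t. t \<in> K \<inter> {0..1} \<Longrightarrow> \<epsilon> t > 0 \<and> finite {s \<in> SP. \<bar>\<tau> s - t\<bar> < \<epsilon> t}" by metis
  moreover have "K \<inter> {0..1} \<subseteq> (\<Union>t\<in>K \<inter> {0..1}. ball t (\<epsilon> t))" using e by force
  ultimately obtain D where D: "D \<subseteq> K \<inter> {0..1}" "finite D" "K \<inter> {0..1} \<subseteq> (\<Union>t\<in>D. ball t (\<epsilon> t))"
    by (metis (no_types, lifting) compactE_image open_ball)
  have "{s \<in> SP. \<tau> s \<in> K} \<subseteq> (\<Union>t\<in>D. {s \<in> SP. \<bar>\<tau> s - t\<bar> < \<epsilon> t})"
  proof
    fix s assume "s \<in> {s \<in> SP. \<tau> s \<in> K}"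
    then have s: "s \<in> SP" "\<tau> s \<in> K \<inter> {0..1}" using tau01 by auto
    then obtain t where "t \<in> D" "\<tau> s \<in> ball t (\<epsilon> t)" using D by blast
    then show "s \<in> (\<Union>t\<in>D. {s \<in> SP. \<bar>\<tau> s - t\<bar> < \<epsilon> t})" using s by (auto simp: dist_real_def abs_minus_commute)
  qed
  then show ?thesis by (rule finite_subset) (use D e in blast)
qed

lemma finite_range: "{a..b} \<inter> E = {} \<Longrightarrow> finite {s \<in> SP. a \<le> \<tau> s \<and> \<tau> s \<le> b}"
  using finite_compact[of "{a..b}"] by simp

lemma finite_compact_V:
  assumes K: "compact K" "K \<inter> E = {}" shows "finite {z \<in> V. pos z \<in> K}"
proof -
  have "{z \<in> V. pos z \<in> K} \<subseteq> (\<Union>s\<in>{s \<in> SP. \<tau> s \<in> K}. {z \<in> V. sp z = s})"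
    using sp_SP by (auto simp: pos_def)
  then show ?thesis by (rule finite_subset) (use finite_compact[OF assms] fin_block in auto)
qed

lemma finite_range_V: "{a..b} \<inter> E = {} \<Longrightarrow> finite {z \<in> V. a \<le> pos z \<and> pos z \<le> b}"
  using finite_compact_V[of "{a..b}"] by simp

text \<open>Consecutive spine vertices; \<open>cl s = cl u\<close> keeps the pair within one gap,
  which makes \<open>consec\<close> applicable.\<close>

definition nxt :: "'v \<Rightarrow> 'v \<Rightarrow> bool" where
  "nxt s u \<longleftrightarrow> s \<in> SP \<and> u \<in> SP \<and> \<tau> s < \<tau> u \<and> cl s = cl u \<and> (\<forall>w\<in>SP. \<not> (\<tau> s < \<tau> w \<and> \<tau> w < \<tau> u))"

lemma nxtD: "nxt s u \<Longrightarrow> s \<in> SP \<and> u \<in> SP \<and> \<tau> s < \<tau> u \<and> cl s = cl u" unfolding nxt_def by blast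

lemma nxt_adj:
  assumes "nxt s u" shows "adj s u"
proof (rule consec)
  show "\<forall>e\<in>E. \<not> (\<tau> s < e \<and> e < \<tau> u)"
    using assms cl_eqD[of s u] unfolding nxt_def by (metis pos_SP less_asym')
qed (use assms in \<open>auto simp: nxt_def\<close>)

lemma nxt_after: "nxt s u \<Longrightarrow> w \<in> SP \<Longrightarrow> \<tau> s < \<tau> w \<Longrightarrow> \<tau> u \<le> \<tau> w"
  unfolding nxt_def by force

lemma nxt_before: "nxt s u \<Longrightarrow> w \<in> SP \<Longrightarrow> \<tau> w < \<tau> u \<Longrightarrow> \<tau> w \<le> \<tau> s"
  unfolding nxt_def by force

lemma SP_cl_no_E: "s \<in> SP \<Longrightarrow> s' \<in> SP \<Longrightarrow> cl s = cl s' \<Longrightarrow> {\<tau> s..\<tau> s'} \<inter> E = {}"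
  using cl_no_E SP_V pos_SP by (metis subsetD)

text \<open>Only finitely many spine vertices lie between two positions of one gap, so a nearest one
  exists.\<close>

lemma succ_ex:
  assumes s: "s \<in> SP" "s' \<in> SP" "cl s = cl s'" "\<tau> s < \<tau> s'"
  shows "\<exists>u. nxt s u \<and> \<tau> u \<le> \<tau> s'"
proof -
  let ?A = "{u \<in> SP. \<tau> s < \<tau> u \<and> \<tau> u \<le> \<tau> s'}"
  have fin: "finite ?A" by (rule finite_subset[OF _ finite_range[OF SP_cl_no_E[OF s(1-3)]]]) auto
  moreover have "s' \<in> ?A" using s by auto
  ultimately obtain u where u: "u \<in> ?A" "\<forall>w\<in>?A. \<tau> u \<le> \<tau> w"
    using finite_arg_min[of ?A \<tau>] by blast
  have "cl u = cl s" using cl_between[OF s(3), of u] u s pos_SP by auto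
  moreover have "\<not> (\<tau> s < \<tau> w \<and> \<tau> w < \<tau> u)" if "w \<in> SP" for w
    using bspec[OF u(2), of w] u(1) that by auto
  ultimately show ?thesis unfolding nxt_def using u s by (intro exI[of _ u]) auto
qed

lemma pred_ex:
  assumes s: "s \<in> SP" "s' \<in> SP" "cl s = cl s'" "\<tau> s < \<tau> s'"
  shows "\<exists>u. nxt u s' \<and> \<tau> s \<le> \<tau> u"
proof -
  let ?A = "{u \<in> SP. \<tau> s \<le> \<tau> u \<and> \<tau> u < \<tau> s'}"
  have fin: "finite ?A" by (rule finite_subset[OF _ finite_range[OF SP_cl_no_E[OF s(1-3)]]]) auto
  moreover have "s \<in> ?A" using s by auto
  ultimately obtain u where u: "u \<in> ?A" "\<forall>w\<in>?A. \<tau> w \<le> \<tau> u"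
    using finite_arg_max[of ?A \<tau>] by blast
  have "cl u = cl s" using cl_between[OF s(3), of u] u s pos_SP by auto
  moreover have "\<not> (\<tau> u < \<tau> w \<and> \<tau> w < \<tau> s')" if "w \<in> SP" for w
    using bspec[OF u(2), of w] u(1) that by auto
  ultimately show ?thesis unfolding nxt_def using u s by (intro exI[of _ u]) auto
qed

text \<open>Take the parity of the number of spine vertices between \<open>s\<close> and a fixed
  representative of its gap.\<close>

lemma parity_ex: "\<exists>par :: 'v \<Rightarrow> bool. \<forall>s u. nxt s u \<longrightarrow> par s \<noteq> par u"
proof -
  define rep where "rep s = (SOME s'. s' \<in> SP \<and> cl s' = cl s)" for s
  \<comment> \<open>Half-open, so that the step from \<open>s\<close> to \<open>u\<close> adds
    exactly \<open>u\<close> to the right of \<open>rep s\<close> and removes exactly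
    \<open>u\<close> to the left of it.\<close>
  define B where "B s = {w \<in> SP. min (\<tau> (rep s)) (\<tau> s) < \<tau> w \<and> \<tau> w \<le> max (\<tau> (rep s)) (\<tau> s)}" for s
  have "even (card (B s)) \<noteq> even (card (B u))" if n: "nxt s u" for s u
  proof -
    have su: "s \<in> SP" "u \<in> SP" "\<tau> s < \<tau> u" "cl s = cl u" using nxtD[OF n] by auto
    have ru: "rep u = rep s" unfolding rep_def using su by simp
    have "rep s \<in> SP \<and> cl (rep s) = cl s" unfolding rep_def by (rule someI[of _ s]) (use su in simp)
    then have r: "rep s \<in> SP" "cl (rep s) = cl s" by auto
    have fin: "finite (B x)" if "x \<in> SP" "cl x = cl s" "rep x = rep s" for x
    proof -
      have "finite {w \<in> SP. \<tau> (rep s) \<le> \<tau> w \<and> \<tau> w \<le> \<tau> x}" "finite {w \<in> SP. \<tau> x \<le> \<tau> w \<and> \<tau> w \<le> \<tau> (rep s)}"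
        using finite_range[OF SP_cl_no_E] r that by auto
      then have "finite ({w \<in> SP. \<tau> (rep s) \<le> \<tau> w \<and> \<tau> w \<le> \<tau> x} \<union> {w \<in> SP. \<tau> x \<le> \<tau> w \<and> \<tau> w \<le> \<tau> (rep s)})"
        by blast
      then show ?thesis by (rule rev_finite_subset) (auto simp: B_def that)
    qed
    have fs: "finite (B s)" "finite (B u)" using fin[of s] fin[of u] su ru by auto
    show ?thesis
    proof (cases "\<tau> (rep s) \<le> \<tau> s")
      case True
      have "w \<in> B u \<longleftrightarrow> w \<in> insert u (B s)" for w
        unfolding B_def ru using True su nxt_before[OF n, of w] inj_onD[OF tau_inj, of w u]
        by (cases "\<tau> w < \<tau> u"; cases "\<tau> w = \<tau> u") (auto simp: min_def max_def split: if_splits)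
      then have "B u = insert u (B s)" by blast
      moreover have "u \<notin> B s" unfolding B_def using True su by auto
      ultimately show ?thesis using fs by simp
    next
      case False
      then have ur: "\<tau> u \<le> \<tau> (rep s)" using nxt_after[OF n] r by auto
      have "w \<in> B s \<longleftrightarrow> w \<in> insert u (B u)" for w
        unfolding B_def ru using False ur su nxt_after[OF n, of w] inj_onD[OF tau_inj, of w u]
        by (cases "\<tau> s < \<tau> w"; cases "\<tau> w = \<tau> u") (auto simp: min_def max_def split: if_splits)
      then have "B s = insert u (B u)" by blast
      moreover have "u \<notin> B u" unfolding B_def ru using ur by auto
      ultimately show ?thesis using fs by simp
    qed
  qed
  then show ?thesis by (intro exI[of _ "\<lambda>s. even (card (B s))"]) blast
qed

text \<open>The position of \<open>s\<close> is isolated among the spine positions and has positive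
  distance from \<open>E\<close>. The factor 3 makes a displacement by \<open>w\<close> at most a
  third of each of these distances, so that displaced blocks keep their order and their side of
  every end; the bound 1/4 confines displaced positions to [-1/4, 5/4].\<close>

lemma width_ex:
  assumes s: "s \<in> SP"
  shows "\<exists>w>0. w \<le> 1/4 \<and> (\<forall>s'\<in>SP. s' \<noteq> s \<longrightarrow> 3 * w \<le> \<bar>\<tau> s - \<tau> s'\<bar>) \<and> (\<forall>e\<in>E. 3 * w \<le> \<bar>\<tau> s - e\<bar>)"
proof -
  obtain \<epsilon> where e: "\<epsilon> > 0" "finite {s' \<in> SP. \<bar>\<tau> s' - \<tau> s\<bar> < \<epsilon>}" using discr[OF tau01[OF s] tau_E[OF s]] by blast
  let ?F = "(\<lambda>s'. \<bar>\<tau> s - \<tau> s'\<bar>) ` ({s' \<in> SP. \<bar>\<tau> s' - \<tau> s\<bar> < \<epsilon>} - {s})"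
  have "finite ?F" using e by auto
  moreover have "\<forall>d\<in>?F. d > 0" using inj_onD[OF tau_inj] s by fastforce
  ultimately have m: "Min (insert \<epsilon> ?F) > 0" "\<And>d. d \<in> insert \<epsilon> ?F \<Longrightarrow> Min (insert \<epsilon> ?F) \<le> d" using e by auto
  obtain d where d: "d > 0" "\<forall>e\<in>E. d \<le> dist (\<tau> s) e"
    using separate_point_closed[OF E_closed tau_E[OF s]] by blast
  define w where "w = min (1/4) (min (Min (insert \<epsilon> ?F)) d / 3)"
  have w: "3 * w \<le> Min (insert \<epsilon> ?F)" "3 * w \<le> d" "w > 0" "w \<le> 1/4" unfolding w_def using m d by (auto simp: min_def)
  have "3 * w \<le> \<bar>\<tau> s - \<tau> s'\<bar>" if "s' \<in> SP" "s' \<noteq> s" for s'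
  proof (cases "\<bar>\<tau> s' - \<tau> s\<bar> < \<epsilon>")
    case True
    then have "\<bar>\<tau> s - \<tau> s'\<bar> \<in> insert \<epsilon> ?F" using that by auto
    then show ?thesis using m(2) w(1) by (meson order_trans)
  next
    case False
    then show ?thesis using m(2)[of \<epsilon>] w(1) by auto
  qed
  moreover have "\<forall>e\<in>E. 3 * w \<le> \<bar>\<tau> s - e\<bar>" using d w by (force simp: dist_real_def)
  ultimately show ?thesis using w by blast
qed

text \<open>The offsets stay below 1/2 in order to reserve the larger value 3/4 for an exit
  leaf.\<close>

lemma offsets_ex: "\<exists>\<rho> :: 'v \<Rightarrow> real. (\<forall>z. 0 < \<rho> z \<and> \<rho> z < 1/2) \<and> (\<forall>s\<in>SP. inj_on \<rho> {z \<in> V. sp z = s})"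
proof -
  have "\<forall>s\<in>SP. \<exists>g :: 'v \<Rightarrow> nat. inj_on g {z \<in> V. sp z = s}"
    using fin_block finite_imp_inj_to_nat_seg by metis
  then obtain g :: "'v \<Rightarrow> 'v \<Rightarrow> nat" where g: "\<And>s. s \<in> SP \<Longrightarrow> inj_on (g s) {z \<in> V. sp z = s}" by metis
  show ?thesis
    by (rule exI[of _ "\<lambda>z. 1 / (real (g (sp z) z) + 3)"])
      (use g in \<open>auto simp: inj_on_def field_simps\<close>)
qed

end

subsection \<open>A route between the two ends of the spine\<close>

text \<open>The route passes through the gaps of \<open>mid i\<close> for \<open>i\<close> in \<open>J\<close>, entering the \<open>i\<close>-th one at
  \<open>ent i\<close> and leaving it at \<open>ext i\<close>. These vertices carry no information if \<open>i\<close> is the least, respectively the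
  greatest, element of \<open>J\<close>; that gap then borders on 0, respectively 1.\<close>

locale routed = spine +
  fixes J :: "int set" and ent ext mid :: "int \<Rightarrow> 'a"
  assumes J_ne: "J \<noteq> {}"
    and mid_V: "i \<in> J \<Longrightarrow> mid i \<in> V"
    and mid_inj: "i \<in> J \<Longrightarrow> j \<in> J \<Longrightarrow> cl (mid i) = cl (mid j) \<Longrightarrow> i = j"
    and ent: "i \<in> J \<Longrightarrow> j \<in> J \<Longrightarrow> j < i \<Longrightarrow> ent i \<in> V \<and> cl (ent i) = cl (mid i)"
    and ext: "i \<in> J \<Longrightarrow> j \<in> J \<Longrightarrow> i < j \<Longrightarrow> ext i \<in> V \<and> cl (ext i) = cl (mid i)"
    and bridge: "i \<in> J \<Longrightarrow> j \<in> J \<Longrightarrow> i < j \<Longrightarrow> \<forall>k\<in>J. \<not> (i < k \<and> k < j) \<Longrightarrow> adj (ext i) (ent j)"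
    and first: "i \<in> J \<Longrightarrow> \<forall>j\<in>J. i \<le> j \<Longrightarrow> cl (mid i) = E \<inter> {0}"
    and last: "i \<in> J \<Longrightarrow> \<forall>j\<in>J. j \<le> i \<Longrightarrow> cl (mid i) = E - {1}"
    and below: "\<forall>i\<in>J. \<exists>j\<in>J. j < i \<Longrightarrow>
      0 \<in> E \<and> (\<forall>\<delta>>0. \<exists>N. \<forall>i\<in>J. i < N \<longrightarrow> pos (ent i) < \<delta> \<and> pos (ext i) < \<delta>)"
    and above: "\<forall>i\<in>J. \<exists>j\<in>J. i < j \<Longrightarrow>
      1 \<in> E \<and> (\<forall>\<delta>>0. \<exists>N. \<forall>i\<in>J. N < i \<longrightarrow> 1 - \<delta> < pos (ent i) \<and> 1 - \<delta> < pos (ext i))"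

context spine
begin

text \<open>Stationary steps are allowed, so a finite path becomes a walk that is eventually
  constant.\<close>

definition walk :: "(nat \<Rightarrow> 'v) \<Rightarrow> bool" where
  "walk f \<longleftrightarrow> (\<forall>k. f k \<in> V) \<and> (\<forall>k. f k = f (Suc k) \<or> adj (f k) (f (Suc k)))"

lemma walk_extend:
  assumes "u \<in> V" "walk g"
  shows "\<exists>f K. walk f \<and> f 0 = u \<and> (\<forall>k. f (K + k) = g k)"
proof -
  have "adj\<^sup>*\<^sup>* u (g 0)" using conn assms unfolding walk_def by blast
  then show ?thesis using assms(1)
  proof (induction rule: converse_rtranclp_induct)
    case base
    then show ?case using assms by (intro exI[of _ g] exI[of _ 0]) auto
  next
    case (step x y)
    then obtain f K where f: "walk f" "f 0 = y" "\<forall>k. f (K + k) = g k" using adj_V by blast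
    show ?case
    proof (intro exI[of _ "case_nat x f"] exI[of _ "Suc K"] conjI)
      show "walk (case_nat x f)" unfolding walk_def using f step adj_V
        by (auto simp: walk_def split: nat.splits)
    qed (use f in auto)
  qed
qed

text \<open>\<open>E \<inter> {0}\<close> is the value of \<open>cl\<close> on a gap that borders on
  0. If no vertex lies in such a gap, then 0 is an end with further ends between it and every
  vertex, and the ray from \<open>rays\<close> converges to it.\<close>

lemma walk_to_0:
  "(\<exists>f. walk f \<and> cl (f 0) = E \<inter> {0} \<and> (\<forall>k. f k = f 0)) \<or>
   0 \<in> E \<and> (\<forall>z\<in>V. \<exists>e\<in>E. 0 < e \<and> e < pos z) \<and> (\<exists>f. walk f \<and> (\<lambda>k. pos (f k)) \<longlonglongrightarrow> 0)"
proof (cases "\<exists>m\<in>V. cl m = E \<inter> {0}")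
  case True
  then obtain m where "m \<in> V" "cl m = E \<inter> {0}" by blast
  then show ?thesis by (intro disjI1 exI[of _ "\<lambda>_. m"]) (auto simp: walk_def)
next
  case False
  have 0: "0 \<in> E"
  proof (rule ccontr)
    assume n: "0 \<notin> E"
    then obtain s where s: "s \<in> SP" "\<tau> s \<le> 0" using around[of 0] by auto
    then have "cl s = E \<inter> {0}" using n E01 pos_SP unfolding cl_def by force
    then show False using False s SP_V by blast
  qed
  have "\<exists>e\<in>E. 0 < e \<and> e < pos z" if z: "z \<in> V" for z
  proof -
    have "pos z \<noteq> 0" using pos_E[OF z] 0 by metis
    then have "0 \<in> cl z" unfolding cl_def using 0 pos01[OF z] by auto
    moreover have "cl z \<noteq> E \<inter> {0}" "cl z \<subseteq> E" using False z unfolding cl_def by auto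
    ultimately have "\<not> cl z \<subseteq> {0}" using 0 by auto
    then obtain e where e: "e \<in> cl z" "e \<noteq> 0" by auto
    then have "e \<in> E" "e < pos z" unfolding cl_def by auto
    then show ?thesis using e E_range[of e] by (intro bexI[of _ e]) auto
  qed
  moreover obtain r where r: "\<forall>n. adj (r n) (r (Suc n))" "(\<lambda>n. \<tau> (sp (r n))) \<longlonglongrightarrow> 0" using rays[OF 0] by blast
  then have "walk r" "(\<lambda>n. pos (r n)) \<longlonglongrightarrow> 0" unfolding walk_def pos_def using adj_V by blast+
  ultimately show ?thesis using 0 by blast
qed

text \<open>The mirror image of \<open>walk_to_0\<close>. In the first case only a target vertex is
  given, because the walk to it has to start at a vertex fixed later.\<close>

lemma walk_to_1:
  "(\<exists>m\<in>V. cl m = E - {1}) \<or>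
   1 \<in> E \<and> (\<forall>z\<in>V. \<exists>e\<in>E. pos z < e \<and> e < 1) \<and> (\<exists>f. walk f \<and> (\<lambda>k. pos (f k)) \<longlonglongrightarrow> 1)"
proof (cases "\<exists>m\<in>V. cl m = E - {1}")
  case False
  have 1: "1 \<in> E"
  proof (rule ccontr)
    assume n: "1 \<notin> E"
    then obtain s where s: "s \<in> SP" "1 \<le> \<tau> s" using around[of 1] by auto
    have "e < \<tau> s" if "e \<in> E" for e
      using E_range[OF that] tau_E[OF s(1)] that s(2) by (cases "e = \<tau> s") auto
    then have "cl s = E - {1}" using n pos_SP[OF s(1)] unfolding cl_def by auto
    then show False using False s SP_V by blast
  qed
  have "\<exists>e\<in>E. pos z < e \<and> e < 1" if z: "z \<in> V" for z
  proof -
    have "cl z \<noteq> E - {1}" "cl z \<subseteq> E - {1}" using False z pos01[OF z] unfolding cl_def by auto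
    then obtain e where e: "e \<in> E" "e \<noteq> 1" "\<not> e < pos z" unfolding cl_def by blast
    then have "e \<noteq> pos z" using pos_E[OF z] by metis
    then show ?thesis using e E_range[of e] by (intro bexI[of _ e]) auto
  qed
  moreover obtain r where r: "\<forall>n. adj (r n) (r (Suc n))" "(\<lambda>n. \<tau> (sp (r n))) \<longlonglongrightarrow> 1" using rays[OF 1] by blast
  then have "walk r" "(\<lambda>n. pos (r n)) \<longlonglongrightarrow> 1" unfolding walk_def pos_def using adj_V by blast+
  ultimately show ?thesis using 1 by blast
qed blast

text \<open>Two walks from a common vertex, \<open>fX\<close> towards 0 and \<open>fY\<close>
  towards 1, are loop-erased at the level of gaps. The route follows \<open>fX\<close> backwards up
  to a switching gap, which receives index 0, and from there follows \<open>fY\<close>.\<close>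

lemma route_ex: "\<exists>J ent ext mid. routed V SP adj sp \<tau> E J ent ext mid"
proof -
  obtain fX where wX: "walk fX" and
    X: "cl (fX 0) = E \<inter> {0} \<and> (\<forall>k. fX k = fX 0) \<or>
      0 \<in> E \<and> (\<forall>z\<in>V. \<exists>e\<in>E. 0 < e \<and> e < pos z) \<and> (\<lambda>k. pos (fX k)) \<longlonglongrightarrow> 0"
    using walk_to_0 by blast
  define finX where "finX t \<longleftrightarrow> finite {m. cl (fX m) = cl (fX t)}" for t
  obtain JX lX where JX: "0 \<in> JX" "\<And>t. t \<in> JX \<Longrightarrow> finX t \<Longrightarrow> Suc (lX t) \<in> JX"
    and lX: "\<And>t. finX t \<Longrightarrow> t \<le> lX t" "\<And>t. finX t \<Longrightarrow> cl (fX (lX t)) = cl (fX t)"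
    "\<And>t m. finX t \<Longrightarrow> lX t < m \<Longrightarrow> cl (fX m) \<noteq> cl (fX t)"
    and JX2: "\<And>t t'. t \<in> JX \<Longrightarrow> t' \<in> JX \<Longrightarrow> t < t' \<Longrightarrow> finX t \<and> lX t < t'"
    unfolding finX_def by (rule loop_erasure[of cl fX]) blast
  define CX where "CX = cl ` fX ` JX"
  have fXV: "fX k \<in> V" for k using wX unfolding walk_def by blast
  \<comment> \<open>Some end lies between 0 and \<open>fX t\<close>, and the walk eventually stays
    to the left of this end.\<close>
  have XB: "finX t" if B: "\<forall>z\<in>V. \<exists>e\<in>E. 0 < e \<and> e < pos z" "(\<lambda>k. pos (fX k)) \<longlonglongrightarrow> 0" for t
  proof -
    obtain e where e: "e \<in> E" "0 < e" "e < pos (fX t)" using B(1) fXV by blast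
    obtain K where K: "\<forall>k\<ge>K. pos (fX k) < e" using order_tendstoD(2)[OF B(2) e(2)] unfolding eventually_sequentially by blast
    have "m < K" if "cl (fX m) = cl (fX t)" for m
    proof (rule ccontr)
      assume "\<not> m < K" then have "pos (fX m) < e" using K by simp
      then show False using cl_eqD[OF that e(1)] e by simp
    qed
    then have "{m. cl (fX m) = cl (fX t)} \<subseteq> {..<K}" by auto
    then show ?thesis unfolding finX_def by (rule finite_subset) simp
  qed
  \<comment> \<open>A constant walk visits its gap infinitely often, so the erasure stops at
    once.\<close>
  have XA: "JX = {0}" if "\<forall>k. fX k = fX 0"
  proof -
    have "cl (fX m) = cl (fX 0)" for m using that by metis
    then have "{m. cl (fX m) = cl (fX 0)} = UNIV" by blast
    then have "\<not> finX 0" unfolding finX_def by simp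
    then show ?thesis using JX JX2[OF JX(1)] by fastforce
  qed
  have "\<exists>fY. walk fY \<and> fY 0 = fX 0 \<and> ((\<exists>m\<in>V. cl m = E - {1} \<and> (\<exists>K. \<forall>k\<ge>K. fY k = m)) \<or>
      1 \<in> E \<and> (\<forall>z\<in>V. \<exists>e\<in>E. pos z < e \<and> e < 1) \<and> (\<lambda>k. pos (fY k)) \<longlonglongrightarrow> 1)"
    using walk_to_1
  proof (elim disjE conjE bexE exE)
    fix m assume m: "m \<in> V" "cl m = E - {1}"
    have "walk (\<lambda>_. m)" unfolding walk_def using m by simp
    then obtain f K where f: "walk f" "f 0 = fX 0" "\<forall>k. f (K + k) = m" using walk_extend[OF fXV[of 0]] by blast
    then have "\<forall>k\<ge>K. f k = m" by (metis le_Suc_ex)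
    then show ?thesis using f m by (intro exI[of _ f]) blast
  next
    fix g assume g: "walk g" "(\<lambda>k. pos (g k)) \<longlonglongrightarrow> 1" and e: "1 \<in> E" "\<forall>z\<in>V. \<exists>e\<in>E. pos z < e \<and> e < 1"
    obtain f K where f: "walk f" "f 0 = fX 0" "\<forall>k. f (K + k) = g k" using walk_extend[OF fXV[of 0] g(1)] by blast
    have "(\<lambda>k. pos (f (k + K))) \<longlonglongrightarrow> 1" using g f by (simp add: add.commute)
    then have "(\<lambda>k. pos (f k)) \<longlonglongrightarrow> 1" by (rule LIMSEQ_offset)
    then show ?thesis using f e by (intro exI[of _ f]) blast
  qed
  then obtain fY where wY: "walk fY" "fY 0 = fX 0" and
    Y: "(\<exists>m\<in>V. cl m = E - {1} \<and> (\<exists>K. \<forall>k\<ge>K. fY k = m)) \<or>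
      1 \<in> E \<and> (\<forall>z\<in>V. \<exists>e\<in>E. pos z < e \<and> e < 1) \<and> (\<lambda>k. pos (fY k)) \<longlonglongrightarrow> 1" by blast
  have fYV: "fY k \<in> V" for k using wY unfolding walk_def by blast
  \<comment> \<open>All gaps used on the way to 0 are collapsed to \<open>None\<close>, so that the way to 1 leaves them for good.\<close>
  define \<kappa> where "\<kappa> z = (if cl z \<in> CX then None else Some (cl z))" for z
  define finY where "finY t \<longleftrightarrow> finite {m. \<kappa> (fY m) = \<kappa> (fY t)}" for t
  obtain JY lY where JY: "0 \<in> JY" "\<And>t. t \<in> JY \<Longrightarrow> finY t \<Longrightarrow> Suc (lY t) \<in> JY"
    and lY: "\<And>t. finY t \<Longrightarrow> t \<le> lY t" "\<And>t. finY t \<Longrightarrow> \<kappa> (fY (lY t)) = \<kappa> (fY t)"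
    "\<And>t m. finY t \<Longrightarrow> lY t < m \<Longrightarrow> \<kappa> (fY m) \<noteq> \<kappa> (fY t)"
    and JY2: "\<And>t t'. t \<in> JY \<Longrightarrow> t' \<in> JY \<Longrightarrow> t < t' \<Longrightarrow> finY t \<and> lY t < t'"
    unfolding finY_def by (rule loop_erasure[of \<kappa> fY]) blast
  have k0: "\<kappa> (fY 0) = None" unfolding \<kappa>_def CX_def using wY JX by auto
  have YB: "finY t" if B: "\<forall>z\<in>V. \<exists>e\<in>E. pos z < e \<and> e < 1" "(\<lambda>k. pos (fY k)) \<longlonglongrightarrow> 1" for t
  proof -
    have one: "finite {m. cl (fY m) = cl z}" if z: "z \<in> V" for z
    proof -
      obtain e where e: "e \<in> E" "pos z < e" "e < 1" using B(1) z by blast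
      obtain K where K: "\<forall>k\<ge>K. e < pos (fY k)" using order_tendstoD(1)[OF B(2) e(3)] unfolding eventually_sequentially by blast
      have "m < K" if "cl (fY m) = cl z" for m
      proof (rule ccontr)
        assume "\<not> m < K" then have "e < pos (fY m)" using K by simp
        then show False using cl_eqD[OF that e(1)] e by simp
      qed
      then have "{m. cl (fY m) = cl z} \<subseteq> {..<K}" by auto
      then show ?thesis by (rule finite_subset) simp
    qed
    \<comment> \<open>Late vertices of \<open>fY\<close> lie to the right of \<open>e\<close> and
      late vertices of \<open>fX\<close> to its left, so at late times \<open>fY\<close> can only
      meet the gaps of finitely many \<open>fX k\<close>.\<close>
    have blob: "finite {m. cl (fY m) \<in> CX}" using X
    proof (elim disjE conjE)
      assume "\<forall>k. fX k = fX 0"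
      then have "CX = {cl (fX 0)}" unfolding CX_def using XA by simp
      then show ?thesis using one[OF fXV[of 0]] by simp
    next
      assume XX: "\<forall>z\<in>V. \<exists>e\<in>E. 0 < e \<and> e < pos z" "(\<lambda>k. pos (fX k)) \<longlonglongrightarrow> 0"
      obtain e where e: "e \<in> E" "0 < e" "e < pos (fX 0)" using XX(1) fXV by blast
      then have e1: "e < 1" using pos01[OF fXV[of 0]] by simp
      obtain K where K: "\<forall>k\<ge>K. e < pos (fY k)" using order_tendstoD(1)[OF B(2) e1] unfolding eventually_sequentially by blast
      obtain K' where K': "\<forall>k\<ge>K'. pos (fX k) < e" using order_tendstoD(2)[OF XX(2) e(2)] unfolding eventually_sequentially by blast
      have "{m. cl (fY m) \<in> CX} \<subseteq> {..<K} \<union> (\<Union>k<K'. {m. cl (fY m) = cl (fX k)})"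
      proof
        fix m assume "m \<in> {m. cl (fY m) \<in> CX}"
        then obtain k where k: "cl (fY m) = cl (fX k)" unfolding CX_def by auto
        have "m < K \<or> k < K'"
        proof (rule ccontr)
          assume "\<not> (m < K \<or> k < K')"
          then have "e < pos (fY m)" "pos (fX k) < e" using K K' by auto
          then show False using cl_eqD[OF k e(1)] by simp
        qed
        then show "m \<in> {..<K} \<union> (\<Union>k<K'. {m. cl (fY m) = cl (fX k)})" using k by auto
      qed
      then show ?thesis by (rule finite_subset) (use one[OF fXV] in auto)
    qed
    have "{m. \<kappa> (fY m) = \<kappa> (fY t)} \<subseteq> {m. cl (fY m) \<in> CX} \<union> {m. cl (fY m) = cl (fY t)}"
      unfolding \<kappa>_def by (auto split: if_splits)
    then show ?thesis unfolding finY_def using blob one[OF fYV] by (meson finite_UnI finite_subset)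
  qed
  \<comment> \<open>If \<open>fY\<close> settles at \<open>m\<close>, only the class of
    \<open>m\<close> is visited infinitely often.\<close>
  have YA: "\<kappa> (fY t) = \<kappa> m" if K: "\<forall>k\<ge>K. fY k = m" and nf: "\<not> finY t" for m K t
  proof (rule ccontr)
    assume n: "\<kappa> (fY t) \<noteq> \<kappa> m"
    have "k < K" if "\<kappa> (fY k) = \<kappa> (fY t)" for k
    proof (rule ccontr)
      assume "\<not> k < K" then have "fY k = m" using K by simp
      then show False using that n by simp
    qed
    then have "{k. \<kappa> (fY k) = \<kappa> (fY t)} \<subseteq> {..<K}" by auto
    then show False using nf unfolding finY_def using finite_subset by blast
  qed
  \<comment> \<open>The switch: the last vertex of \<open>fY\<close> in a gap used by
    \<open>fX\<close>, or a vertex of the final gap if \<open>fY\<close> never leaves those gaps for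
    good.\<close>
  have "\<exists>zz\<in>V. cl zz \<in> CX \<and> (finY 0 \<longrightarrow> zz = fY (lY 0)) \<and> (\<not> finY 0 \<longrightarrow> cl zz = E - {1})"
  proof (cases "finY 0")
    case True
    then have "\<kappa> (fY (lY 0)) = None" using lY(2) k0 by simp
    then have "cl (fY (lY 0)) \<in> CX" unfolding \<kappa>_def by (auto split: if_splits)
    then show ?thesis using True fYV by blast
  next
    case False
    then obtain m K where m: "m \<in> V" "cl m = E - {1}" "\<forall>k\<ge>K. fY k = m" using Y YB by blast
    then have "\<kappa> m = None" using YA[OF m(3) False] k0 by simp
    then have "cl m \<in> CX" unfolding \<kappa>_def by (simp split: if_splits)
    then show ?thesis using m False by (intro bexI[of _ m]) auto
  qed
  then obtain zz where zz: "zz \<in> V" "cl zz \<in> CX" "finY 0 \<Longrightarrow> zz = fY (lY 0)" "\<not> finY 0 \<Longrightarrow> cl zz = E - {1}" by blast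
  obtain t0 where t0: "t0 \<in> JX" "cl (fX t0) = cl zz" using zz(2) unfolding CX_def by force
  \<comment> \<open>Translates indices up to 0 into times of \<open>fX\<close>; the erased walk
    \<open>fX\<close> is in the switching gap at time \<open>t0\<close>.\<close>
  define bX where "bX i = (if i = 0 then t0 else nat (- i))" for i :: int
  \<comment> \<open>Times of \<open>fX\<close> before \<open>t0\<close> are dropped, as the route
    coming from 0 leaves \<open>fX\<close> at the switch.\<close>
  define J where "J = {i. i < 0 \<and> nat (- i) \<in> JX \<and> nat (- i) > t0} \<union> {0} \<union> {i. i > 0 \<and> nat i \<in> JY}"
  define mid where "mid i = (if i < 0 then fX (nat (- i)) else if i = 0 then zz else fY (nat i))" for i :: int
  \<comment> \<open>Since \<open>fX\<close> is followed backwards, its last visit to a gap becomes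
    the entry and the time recorded in \<open>JX\<close> the exit; along \<open>fY\<close> it is the
    other way round.\<close>
  define ent where "ent i = (if i \<le> 0 then fX (lX (bX i)) else fY (nat i))" for i :: int
  define ext where "ext i = (if i < 0 then fX (nat (- i)) else if i = 0 then zz else fY (lY (nat i)))" for i :: int
  have bXJ: "bX i \<in> JX" if "i \<in> J" "i \<le> 0" for i using that t0 unfolding J_def bX_def by auto
  have bX_less: "bX j < bX i" if "i \<in> J" "j \<in> J" "i < j" "j \<le> 0" for i j
    using that unfolding J_def bX_def by auto
  have bYJ: "nat i \<in> JY" if "i \<in> J" "0 \<le> i" for i using that JY unfolding J_def by auto
  have negJ: "- int t \<in> J" if "t \<in> JX" "t > t0" for t using that unfolding J_def by auto
  have posJ: "int t \<in> J" if "t \<in> JY" for t using that unfolding J_def by auto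
  have clmid: "cl (mid i) = cl (fX (bX i))" if "i \<in> J" "i \<le> 0" for i
    using that t0 unfolding mid_def bX_def by auto
  have clCX: "cl (mid i) \<in> CX" if "i \<in> J" "i \<le> 0" for i using clmid bXJ that unfolding CX_def by auto
  have posk: "\<kappa> (fY (nat i)) \<noteq> None" if "i \<in> J" "i > 0" for i
    using JY2[OF JY(1) bYJ[of i]] lY(3)[of 0 "nat i"] that k0 by auto
  have posCX: "cl (mid i) \<notin> CX" if "i \<in> J" "i > 0" for i
    using posk[OF that] that unfolding mid_def \<kappa>_def by (auto split: if_splits)
  have neg_succ: "\<exists>j\<in>J. j < i" if "i \<in> J" "i \<le> 0" "finX (bX i)" for i
  proof (intro bexI)
    have "Suc (lX (bX i)) \<in> JX" "bX i < Suc (lX (bX i))" using JX(2) lX(1) bXJ that by (auto simp: less_Suc_eq_le)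
    moreover have "t0 \<le> bX i" using that unfolding J_def bX_def by auto
    ultimately show "- int (Suc (lX (bX i))) \<in> J" by (intro negJ) auto
    show "- int (Suc (lX (bX i))) < i" using \<open>bX i < Suc (lX (bX i))\<close> that unfolding bX_def by (auto split: if_splits)
  qed
  have pos_succ: "\<exists>j\<in>J. i < j" if "i \<in> J" "0 \<le> i" "finY (nat i)" for i
  proof (intro bexI)
    show "int (Suc (lY (nat i))) \<in> J" using posJ JY(2) bYJ that by blast
    show "i < int (Suc (lY (nat i)))" using lY(1)[OF that(3)] that by linarith
  qed
  have "routed V SP adj sp \<tau> E J ent ext mid"
  proof (unfold_locales)
    show "J \<noteq> {}" unfolding J_def by auto
  next
    fix i assume "i \<in> J"
    show "mid i \<in> V" unfolding mid_def using fXV fYV zz by auto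
  next
    fix i j assume ij: "i \<in> J" "j \<in> J" "cl (mid i) = cl (mid j)"
    have neg: False if h: "i \<in> J" "j \<in> J" "i < j" "j \<le> 0" "cl (mid i) = cl (mid j)" for i j
    proof -
      have b: "bX j < bX i" "bX j \<in> JX" "bX i \<in> JX" using bX_less bXJ h by auto
      then have "finX (bX j)" "lX (bX j) < bX i" using JX2 by auto
      then have "cl (fX (bX i)) \<noteq> cl (fX (bX j))" using lX(3) by blast
      then show False using h clmid by auto
    qed
    have ps: False if h: "i \<in> J" "j \<in> J" "i < j" "0 < i" "cl (mid i) = cl (mid j)" for i j
    proof -
      have b: "nat i < nat j" "nat i \<in> JY" "nat j \<in> JY" using bYJ h by auto
      then have "finY (nat i)" "lY (nat i) < nat j" using JY2 by auto
      then have "\<kappa> (fY (nat j)) \<noteq> \<kappa> (fY (nat i))" using lY(3) by blast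
      then show False using h posk[of i] posk[of j] unfolding mid_def \<kappa>_def by (auto split: if_splits)
    qed
    show "i = j"
    proof (cases "i \<le> 0"; cases "j \<le> 0")
      assume "i \<le> 0" "j \<le> 0" then show ?thesis using neg[of i j] neg[of j i] ij by fastforce
    next
      assume "\<not> i \<le> 0" "\<not> j \<le> 0" then show ?thesis using ps[of i j] ps[of j i] ij by fastforce
    next
      assume "i \<le> 0" "\<not> j \<le> 0" then show ?thesis using clCX[of i] posCX[of j] ij by simp
    next
      assume "\<not> i \<le> 0" "j \<le> 0" then show ?thesis using clCX[of j] posCX[of i] ij by simp
    qed
  next
    fix i j assume ij: "i \<in> J" "j \<in> J" "j < i"
    show "ent i \<in> V \<and> cl (ent i) = cl (mid i)"
    proof (cases "i \<le> 0")
      case True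
      then have "finX (bX i)" using JX2[OF bXJ[of i] bXJ[of j] bX_less[of j i]] ij by simp
      then show ?thesis using True lX(2) clmid ij fXV unfolding ent_def by simp
    qed (use fYV in \<open>auto simp: ent_def mid_def\<close>)
  next
    fix i j assume ij: "i \<in> J" "j \<in> J" "i < j"
    show "ext i \<in> V \<and> cl (ext i) = cl (mid i)"
    proof (cases "i > 0")
      case True
      then have "finY (nat i)" using JY2[OF bYJ[of i] bYJ[of j]] ij by simp
      then have "\<kappa> (fY (lY (nat i))) = \<kappa> (fY (nat i))" using lY by blast
      then have "cl (fY (lY (nat i))) = cl (fY (nat i))" using posk[OF ij(1) True] unfolding \<kappa>_def by (auto split: if_splits)
      then show ?thesis using True fYV unfolding ext_def mid_def by simp
    qed (use fXV zz in \<open>auto simp: ext_def mid_def\<close>)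
  next
    fix i j assume ij: "i \<in> J" "j \<in> J" "i < j" and no: "\<forall>k\<in>J. \<not> (i < k \<and> k < j)"
    have "0 \<in> J" unfolding J_def by simp
    then have "j \<le> 0 \<or> 0 \<le> i" using no by force
    then show "adj (ext i) (ent j)"
    proof
      assume j0: "j \<le> 0"
      let ?t = "bX j" and ?t' = "bX i"
      have b: "?t < ?t'" "?t \<in> JX" "?t' \<in> JX" using bX_less bXJ ij j0 by auto
      then have f: "finX ?t" "lX ?t < ?t'" using JX2 by auto
      have tt: "t0 \<le> ?t" using ij j0 unfolding J_def bX_def by auto
      \<comment> \<open>Otherwise the next time of the erasure would be an index strictly between
        \<open>i\<close> and \<open>j\<close>.\<close>
      have "\<not> Suc (lX ?t) < ?t'"
      proof
        assume less: "Suc (lX ?t) < ?t'"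
        have "- int (Suc (lX ?t)) \<in> J" using JX(2) b f lX(1)[of ?t] tt by (intro negJ) auto
        moreover have "i < - int (Suc (lX ?t))" using less ij j0 unfolding bX_def by (auto split: if_splits)
        moreover have "- int (Suc (lX ?t)) < j" using lX(1)[OF f(1)] j0 unfolding bX_def by (auto split: if_splits)
        ultimately show False using no by blast
      qed
      then have t': "?t' = Suc (lX ?t)" using f by simp
      have "cl (fX ?t') \<noteq> cl (fX (lX ?t))" using lX(2,3) f by metis
      then have "adj (fX (lX ?t)) (fX ?t')" using wX t' unfolding walk_def by metis
      then show ?thesis using adj_sym ij j0 unfolding ext_def ent_def bX_def by auto
    next
      assume i0: "0 \<le> i"
      let ?t = "nat i" and ?t' = "nat j"
      have b: "?t < ?t'" "?t \<in> JY" "?t' \<in> JY" using bYJ ij i0 by auto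
      then have f: "finY ?t" "lY ?t < ?t'" using JY2 by auto
      have "\<not> Suc (lY ?t) < ?t'"
      proof
        assume less: "Suc (lY ?t) < ?t'"
        have "int (Suc (lY ?t)) \<in> J" using posJ JY(2) b f by blast
        moreover have "i < int (Suc (lY ?t))" "int (Suc (lY ?t)) < j" using less lY(1)[OF f(1)] i0 by auto
        ultimately show False using no by blast
      qed
      then have t': "?t' = Suc (lY ?t)" using f by simp
      have "\<kappa> (fY ?t') \<noteq> \<kappa> (fY (lY ?t))" using lY(2,3) f by metis
      then have "adj (fY (lY ?t)) (fY ?t')" using wY t' unfolding walk_def by metis
      moreover have "ext i = fY (lY ?t)" unfolding ext_def using i0 zz(3) f by auto
      ultimately show ?thesis using ij i0 unfolding ent_def by auto
    qed
  next
    fix i assume i: "i \<in> J" "\<forall>j\<in>J. i \<le> j"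
    have "0 \<in> J" unfolding J_def by simp
    then have i0: "i \<le> 0" using i by blast
    then have nf: "\<not> finX (bX i)" using neg_succ i by force
    then have A: "cl (fX 0) = E \<inter> {0} \<and> (\<forall>k. fX k = fX 0)" using X XB by blast
    then have "cl (fX (bX i)) = E \<inter> {0}" by metis
    then show "cl (mid i) = E \<inter> {0}" using clmid[OF i(1) i0] by simp
  next
    fix i assume i: "i \<in> J" "\<forall>j\<in>J. j \<le> i"
    have "0 \<in> J" unfolding J_def by simp
    then have i0: "0 \<le> i" using i by blast
    then have nf: "\<not> finY (nat i)" using pos_succ i by force
    show "cl (mid i) = E - {1}"
    proof (cases "i = 0")
      case True then show ?thesis using nf zz(4) unfolding mid_def by simp
    next
      case False
      obtain m K where m: "m \<in> V" "cl m = E - {1}" "\<forall>k\<ge>K. fY k = m" using Y YB nf by blast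
      then have "\<kappa> (fY (nat i)) = \<kappa> m" using YA nf by blast
      then have "cl (fY (nat i)) = cl m" using posk[OF i(1)] False i0 unfolding \<kappa>_def by (auto split: if_splits)
      then show ?thesis using m False i0 unfolding mid_def by simp
    qed
  next
    assume unb: "\<forall>i\<in>J. \<exists>j\<in>J. j < i"
    have "0 \<in> J" unfolding J_def by simp
    then obtain j where "j \<in> J" "j < 0" using unb by blast
    then have "nat (- j) \<in> JX" "nat (- j) \<noteq> 0" unfolding J_def by auto
    then have "JX \<noteq> {0}" by auto
    then have "\<not> (\<forall>k. fX k = fX 0)" using XA by (rule contrapos_nn)
    then have B: "0 \<in> E" "\<forall>z\<in>V. \<exists>e\<in>E. 0 < e \<and> e < pos z" "(\<lambda>k. pos (fX k)) \<longlonglongrightarrow> 0" using X by blast+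
    have "\<exists>N. \<forall>i\<in>J. i < N \<longrightarrow> pos (ent i) < \<delta> \<and> pos (ext i) < \<delta>" if d: "\<delta> > 0" for \<delta>
    proof -
      obtain K where K: "\<forall>k\<ge>K. pos (fX k) < \<delta>" using order_tendstoD(2)[OF B(3) d] unfolding eventually_sequentially by blast
      have "pos (ent i) < \<delta> \<and> pos (ext i) < \<delta>" if i: "i \<in> J" "i < - int K" for i
      proof -
        have "K \<le> nat (- i)" "nat (- i) \<le> lX (nat (- i))" using i lX(1) XB[OF B(2,3)] by auto
        then show ?thesis using K i unfolding ent_def ext_def bX_def by auto
      qed
      then show ?thesis by blast
    qed
    then show "0 \<in> E \<and> (\<forall>\<delta>>0. \<exists>N. \<forall>i\<in>J. i < N \<longrightarrow> pos (ent i) < \<delta> \<and> pos (ext i) < \<delta>)" using B by blast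
  next
    assume unb: "\<forall>i\<in>J. \<exists>j\<in>J. i < j"
    have big: "\<exists>i\<in>J. int K < i" for K
    proof (induction K)
      case 0
      have "0 \<in> J" unfolding J_def by simp
      then show ?case using unb by auto
    next
      case (Suc K)
      then obtain i where "i \<in> J" "int K < i" by blast
      moreover then obtain j where "j \<in> J" "i < j" using unb by blast
      ultimately show ?case by (intro bexI[of _ j]) auto
    qed
    have "\<not> (\<exists>m\<in>V. cl m = E - {1} \<and> (\<exists>K. \<forall>k\<ge>K. fY k = m))"
    proof
      assume "\<exists>m\<in>V. cl m = E - {1} \<and> (\<exists>K. \<forall>k\<ge>K. fY k = m)"
      then obtain m K where m: "\<forall>k\<ge>K. fY k = m" by blast
      obtain i where i: "i \<in> J" "int K < i" using big by blast
      then obtain j where j: "j \<in> J" "i < j" using unb by blast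
      have f: "finY (nat i)" using JY2[OF bYJ[of i] bYJ[of j]] i j by simp
      have "{K..} \<subseteq> {k. \<kappa> (fY k) = \<kappa> (fY (nat i))}" using m i by auto
      then show False using f infinite_Ici[of K] unfolding finY_def using finite_subset by blast
    qed
    then have B: "1 \<in> E" "\<forall>z\<in>V. \<exists>e\<in>E. pos z < e \<and> e < 1" "(\<lambda>k. pos (fY k)) \<longlonglongrightarrow> 1" using Y by blast+
    have "\<exists>N. \<forall>i\<in>J. N < i \<longrightarrow> 1 - \<delta> < pos (ent i) \<and> 1 - \<delta> < pos (ext i)" if d: "\<delta> > 0" for \<delta>
    proof -
      have "1 - \<delta> < 1" using d by simp
      then obtain K where K: "\<forall>k\<ge>K. 1 - \<delta> < pos (fY k)" using order_tendstoD(1)[OF B(3)] unfolding eventually_sequentially by blast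
      have "1 - \<delta> < pos (ent i) \<and> 1 - \<delta> < pos (ext i)" if i: "i \<in> J" "int K < i" for i
      proof -
        have "K \<le> nat i" "nat i \<le> lY (nat i)" using i lY(1) YB[OF B(2,3)] by auto
        then show ?thesis using K i unfolding ent_def ext_def by auto
      qed
      then show ?thesis by blast
    qed
    then show "1 \<in> E \<and> (\<forall>\<delta>>0. \<exists>N. \<forall>i\<in>J. N < i \<longrightarrow> 1 - \<delta> < pos (ent i) \<and> 1 - \<delta> < pos (ext i))" using B by blast
  qed
  then show ?thesis by blast
qed

end

subsection \<open>Splitting the vertices into two strands\<close>

lemma int_no_min:
  fixes J :: "int set"
  assumes "J \<noteq> {}" "\<forall>i\<in>J. \<exists>j\<in>J. j < i" shows "\<exists>j\<in>J. j < N"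
proof (rule ccontr)
  assume "\<not> ?thesis"
  then have lb: "\<forall>j\<in>J. N \<le> j" by auto
  obtain j0 where "j0 \<in> J" using assms(1) by blast
  then obtain i where i: "i \<in> J" "\<forall>j. j \<in> J \<longrightarrow> nat (i - N) \<le> nat (j - N)"
    using ex_has_least_nat[of "\<lambda>i. i \<in> J" j0 "\<lambda>i. nat (i - N)"] by blast
  then obtain j where "j \<in> J" "j < i" using assms(2) by blast
  then show False using i lb by force
qed

text \<open>The signed number of elements between a fixed \<open>k\<close> and \<open>a\<close> is
  finite by assumption and strictly increasing in \<open>key a\<close>.\<close>

lemma int_index_ex:
  fixes key :: "'a \<Rightarrow> real"
  assumes fin: "\<And>a b. a \<in> K \<Longrightarrow> b \<in> K \<Longrightarrow> finite {c \<in> K. key a \<le> key c \<and> key c \<le> key b}"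
  shows "\<exists>\<nu> :: 'a \<Rightarrow> int. \<forall>a\<in>K. \<forall>b\<in>K. key a < key b \<longrightarrow> \<nu> a < \<nu> b"
proof (cases "K = {}")
  case False
  then obtain k where k: "k \<in> K" by blast
  define \<nu> where "\<nu> a = (if key k \<le> key a then int (card {c \<in> K. key k \<le> key c \<and> key c < key a})
    else - int (card {c \<in> K. key a \<le> key c \<and> key c < key k}))" for a
  have f: "finite {c \<in> K. key a \<le> key c \<and> key c < key b}" if "a \<in> K" "b \<in> K" for a b
    by (rule finite_subset[OF _ fin[OF that]]) auto
  have "\<nu> a < \<nu> b" if ab: "a \<in> K" "b \<in> K" "key a < key b" for a b
  proof -
    consider "key k \<le> key a" | "key a < key k" "key k \<le> key b" | "key b < key k" using ab by linarith
    then show ?thesis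
    proof cases
      case 1
      have "{c \<in> K. key k \<le> key c \<and> key c < key a} \<subset> {c \<in> K. key k \<le> key c \<and> key c < key b}"
      proof (rule psubsetI)
        have "a \<in> {c \<in> K. key k \<le> key c \<and> key c < key b}" "a \<notin> {c \<in> K. key k \<le> key c \<and> key c < key a}" using 1 ab by auto
        then show "{c \<in> K. key k \<le> key c \<and> key c < key a} \<noteq> {c \<in> K. key k \<le> key c \<and> key c < key b}" by blast
      qed (use ab in auto)
      then show ?thesis unfolding \<nu>_def using 1 ab psubset_card_mono[OF f[OF k ab(2)]] by auto
    next
      case 2
      have "a \<in> {c \<in> K. key a \<le> key c \<and> key c < key k}" using 2 ab by simp
      then have "card {c \<in> K. key a \<le> key c \<and> key c < key k} > 0" using f[OF ab(1) k] by (metis card_gt_0_iff empty_iff)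
      then show ?thesis unfolding \<nu>_def using 2 by auto
    next
      case 3
      have "{c \<in> K. key b \<le> key c \<and> key c < key k} \<subset> {c \<in> K. key a \<le> key c \<and> key c < key k}"
      proof (rule psubsetI)
        have "a \<in> {c \<in> K. key a \<le> key c \<and> key c < key k}" "a \<notin> {c \<in> K. key b \<le> key c \<and> key c < key k}" using 3 ab by auto
        then show "{c \<in> K. key b \<le> key c \<and> key c < key k} \<noteq> {c \<in> K. key a \<le> key c \<and> key c < key k}" by blast
      qed (use ab in auto)
      then show ?thesis unfolding \<nu>_def using 3 ab psubset_card_mono[OF f[OF ab(1) k]] by auto
    qed
  qed
  then show ?thesis by blast
qed simp

text \<open>The choices provided by \<open>parity_ex\<close>, \<open>width_ex\<close> and
  \<open>offsets_ex\<close>, fixed here so that explicit strands can be defined from them.\<close>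

locale coloured = routed +
  fixes par :: "'a \<Rightarrow> bool" and wd rho0 :: "'a \<Rightarrow> real"
  assumes par: "nxt s u \<Longrightarrow> par s \<noteq> par u"
    and wd_pos: "s \<in> SP \<Longrightarrow> 0 < wd s" and wd_le: "s \<in> SP \<Longrightarrow> wd s \<le> 1/4"
    and wd_SP: "s \<in> SP \<Longrightarrow> s' \<in> SP \<Longrightarrow> s' \<noteq> s \<Longrightarrow> 3 * wd s \<le> \<bar>\<tau> s - \<tau> s'\<bar>"
    and wd_E: "s \<in> SP \<Longrightarrow> e \<in> E \<Longrightarrow> 3 * wd s \<le> \<bar>\<tau> s - e\<bar>"
    and rho0: "0 < rho0 z \<and> rho0 z < 1/2"
    and rho0_inj: "s \<in> SP \<Longrightarrow> inj_on rho0 {z \<in> V. sp z = s}"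
begin

text \<open>The section of the \<open>i\<close>-th gap lies between the positions \<open>pin i\<close> and \<open>pout i\<close> and is traversed by the
  second strand \<open>Q\<close> in the direction \<open>dir i\<close>. In blocks with the parity of the entry block (\<open>ev\<close>), \<open>Q\<close> takes the
  spine vertex and the first strand \<open>A\<close> the leaves; in the other blocks of the section it is the other way
  round. If the route enters at a leaf, then \<open>Q\<close> takes this leaf as well, just before the spine vertex.
  Outside the section, \<open>A\<close> takes everything: leaves precede their spine vertex to the left of the section
  (\<open>lft\<close>) and follow it to the right, so that \<open>A\<close> meets the section at spine vertices.
  The exit leaf is the last one of its block in the direction of travel.\<close>

definition low :: "int \<Rightarrow> bool" where "low i \<longleftrightarrow> (\<exists>j\<in>J. j < i)"
definition upp :: "int \<Rightarrow> bool" where "upp i \<longleftrightarrow> (\<exists>j\<in>J. i < j)"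
definition pin :: "int \<Rightarrow> real" where "pin i = (if low i then pos (ent i) else 0)"
definition pout :: "int \<Rightarrow> real" where "pout i = (if upp i then pos (ext i) else 1)"
definition anc :: "int \<Rightarrow> 'a" where "anc i = sp (if low i then ent i else if upp i then ext i else mid i)"
definition dir :: "int \<Rightarrow> real" where "dir i = (if pin i \<le> pout i then 1 else - 1)"
definition has :: "'a \<Rightarrow> bool" where "has z \<longleftrightarrow> (\<exists>i\<in>J. cl (mid i) = cl z)"
definition ix :: "'a \<Rightarrow> int" where "ix z = (THE i. i \<in> J \<and> cl (mid i) = cl z)"
definition insec :: "'a \<Rightarrow> bool" where
  "insec z \<longleftrightarrow> has z \<and> min (pin (ix z)) (pout (ix z)) \<le> pos z \<and> pos z \<le> max (pin (ix z)) (pout (ix z))"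
definition lft :: "'a \<Rightarrow> bool" where "lft z \<longleftrightarrow> has z \<and> pos z < min (pin (ix z)) (pout (ix z))"
definition ev :: "'a \<Rightarrow> bool" where "ev z \<longleftrightarrow> par (sp z) = par (anc (ix z))"
definition entleaf :: "'a \<Rightarrow> bool" where "entleaf z \<longleftrightarrow> has z \<and> z \<notin> SP \<and> low (ix z) \<and> z = ent (ix z)"
definition extleaf :: "'a \<Rightarrow> bool" where "extleaf z \<longleftrightarrow> has z \<and> z \<notin> SP \<and> upp (ix z) \<and> z = ext (ix z)"
definition A :: "'a set" where
  "A = {z \<in> V. \<not> insec z \<or> (if ev z then z \<notin> SP \<and> \<not> entleaf z else z \<in> SP)}"
definition Q :: "'a set" where
  "Q = {z \<in> V. insec z \<and> (if ev z then z \<in> SP \<or> entleaf z else z \<notin> SP)}"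
definition rho :: "'a \<Rightarrow> real" where
  "rho z = (if z \<in> SP then 0 else
     (if entleaf z then - dir (ix z) else if insec z then dir (ix z) else if lft z then - 1 else 1) *
     (if extleaf z then 3/4 else rho0 z))"
definition X :: "'a \<Rightarrow> real" where "X z = pos z + wd (sp z) * rho z"

text \<open>The second strand is ordered lexicographically by section and then by position,
  read in the direction of travel.\<close>

definition key :: "'a \<Rightarrow> real" where "key z = of_int (ix z) + (dir (ix z) * X z + 2) / 5"

section \<open>Sections, offsets and displaced positions\<close>

lemma AQ: "A \<union> Q = V" "A \<inter> Q = {}" unfolding A_def Q_def by auto

lemma A_V: "a \<in> A \<Longrightarrow> a \<in> V" and Q_V: "a \<in> Q \<Longrightarrow> a \<in> V" using AQ by auto

lemma dir_cases: "dir i = 1 \<or> dir i = -1" unfolding dir_def by auto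

lemma ix_eq: "i \<in> J \<Longrightarrow> cl (mid i) = cl z \<Longrightarrow> ix z = i \<and> has z"
  unfolding ix_def has_def using mid_inj by (auto intro!: the_equality)

lemma hasD: "has z \<Longrightarrow> ix z \<in> J \<and> cl (mid (ix z)) = cl z"
  using ix_eq unfolding has_def by metis

lemma has_cong: "cl z = cl z' \<Longrightarrow> has z = has z' \<and> ix z = ix z'"
  unfolding has_def ix_def by simp

lemma has_sp: "z \<in> V \<Longrightarrow> has (sp z) = has z \<and> ix (sp z) = ix z"
  using has_cong cl_sp by blast

lemma insec_sp: "z \<in> V \<Longrightarrow> insec (sp z) = insec z" and lft_sp: "z \<in> V \<Longrightarrow> lft (sp z) = lft z"
  and ev_sp: "z \<in> V \<Longrightarrow> ev (sp z) = ev z"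
  unfolding insec_def lft_def ev_def using has_sp pos_sp sp_sp by auto

text \<open>The default values 0 and 1 in \<open>pin\<close> and \<open>pout\<close> let the first
  and the last section extend to the border of the unit interval, so these are always traversed to
  the right.\<close>

lemma not_low: "\<not> low i \<Longrightarrow> i \<in> J \<Longrightarrow> cl (mid i) = E \<inter> {0} \<and> pin i = 0 \<and> dir i = 1"
  and not_upp: "\<not> upp i \<Longrightarrow> i \<in> J \<Longrightarrow> cl (mid i) = E - {1} \<and> pout i = 1 \<and> dir i = 1"
proof -
  assume i: "i \<in> J"
  have p: "0 \<le> pin i" "pin i \<le> 1" "0 \<le> pout i" "pout i \<le> 1"
    using ent[OF i] ext[OF i] pos01 unfolding pin_def pout_def low_def upp_def by auto
  show "\<not> low i \<Longrightarrow> cl (mid i) = E \<inter> {0} \<and> pin i = 0 \<and> dir i = 1"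
    using first[OF i] p unfolding low_def pin_def dir_def by force
  show "\<not> upp i \<Longrightarrow> cl (mid i) = E - {1} \<and> pout i = 1 \<and> dir i = 1"
    using last[OF i] p unfolding upp_def pout_def dir_def by force
qed

lemma ent_sec: "i \<in> J \<Longrightarrow> low i \<Longrightarrow> ent i \<in> V \<and> insec (ent i) \<and> ix (ent i) = i \<and> sp (ent i) = anc i \<and> pos (ent i) = pin i"
  using ent[of i] ix_eq[of i "ent i"] unfolding insec_def low_def pin_def anc_def by auto

lemma ext_sec: "i \<in> J \<Longrightarrow> upp i \<Longrightarrow> ext i \<in> V \<and> insec (ext i) \<and> ix (ext i) = i \<and> pos (ext i) = pout i"
  using ext[of i] ix_eq[of i "ext i"] unfolding insec_def upp_def pout_def by auto

text \<open>Guarantees that every section contributes to \<open>Q\<close>: the anchor is a spine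
  vertex of the section, and parities are measured against it. If there is neither entry nor exit,
  the section is the whole gap and \<open>mid i\<close> can serve.\<close>

lemma anc_sec:
  assumes i: "i \<in> J"
  shows "anc i \<in> SP" "cl (anc i) = cl (mid i)" "insec (anc i)" "ix (anc i) = i" "ev (anc i)" "anc i \<in> Q"
proof -
  define z where "z = (if low i then ent i else if upp i then ext i else mid i)"
  have z: "z \<in> V" "ix z = i" "has z" "insec z"
  proof -
    show "z \<in> V" unfolding z_def using ent_sec[OF i] ext_sec[OF i] mid_V[OF i] by auto
    show "ix z = i" unfolding z_def using ent_sec[OF i] ext_sec[OF i] ix_eq[OF i] by auto
    show iz: "insec z"
    proof (cases "low i \<or> upp i")
      case True then show ?thesis unfolding z_def using ent_sec[OF i] ext_sec[OF i] by auto
    next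
      case False
      then have "pin i = 0" "pout i = 1" using not_low[OF _ i] not_upp[OF _ i] by auto
      then show ?thesis using False ix_eq[OF i, of "mid i"] pos01[OF mid_V[OF i]] unfolding z_def insec_def by auto
    qed
    then show "has z" unfolding insec_def by blast
  qed
  have a: "anc i = sp z" unfolding anc_def z_def by simp
  show "anc i \<in> SP" "insec (anc i)" "ix (anc i) = i" using z a sp_SP insec_sp has_sp by auto
  then show "ev (anc i)" unfolding ev_def by (simp add: sp_id)
  show "cl (anc i) = cl (mid i)" using hasD[OF z(3)] z cl_sp a by simp
  show "anc i \<in> Q" unfolding Q_def using \<open>anc i \<in> SP\<close> \<open>insec (anc i)\<close> \<open>ev (anc i)\<close> SP_V by auto
qed

lemma entleafD:
  assumes "entleaf z"
  shows "z \<in> V" "insec z" "ev z" "pos z = pin (ix z)" "z \<notin> SP" "sp z = anc (ix z)" "z \<in> Q"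
proof -
  have i: "ix z \<in> J" "low (ix z)" "z = ent (ix z)" using assms hasD unfolding entleaf_def by auto
  show z: "z \<in> V" "insec z" "pos z = pin (ix z)" "z \<notin> SP" "sp z = anc (ix z)"
    using ent_sec[OF i(1,2)] i(3) assms unfolding entleaf_def by auto
  show "ev z" unfolding ev_def using z by simp
  then show "z \<in> Q" unfolding Q_def using z assms by auto
qed

lemma rho_abs: "\<bar>rho z\<bar> < 1"
proof -
  have "\<bar>if extleaf z then 3/4 else rho0 z\<bar> < (1::real)" using rho0[of z] by auto
  moreover have "\<bar>if entleaf z then - dir (ix z) else if insec z then dir (ix z) else if lft z then - 1 else 1\<bar> = (1::real)"
    using dir_cases[of "ix z"] by auto
  ultimately show ?thesis unfolding rho_def by (auto simp: abs_mult)
qed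

lemma rho_SP [simp]: "s \<in> SP \<Longrightarrow> rho s = 0" unfolding rho_def by simp

lemma rho_lft: "z \<notin> SP \<Longrightarrow> lft z \<Longrightarrow> rho z < 0"
  using rho0[of z] entleafD(2)[of z] unfolding rho_def lft_def insec_def by auto

lemma rho_right: "z \<notin> SP \<Longrightarrow> \<not> insec z \<Longrightarrow> \<not> lft z \<Longrightarrow> 0 < rho z"
  using rho0[of z] entleafD(2)[of z] unfolding rho_def by auto

lemma rho_ent: "entleaf z \<Longrightarrow> dir (ix z) * rho z < 0"
  using rho0[of z] dir_cases[of "ix z"] entleafD(5)[of z] unfolding rho_def by auto

text \<open>Within a block the absolute value of \<open>rho\<close> identifies a vertex: 0 for the
  spine vertex, 3/4 for the exit leaf, and values of the injective \<open>rho0\<close> below 1/2 for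
  the remaining leaves.\<close>

lemma rho_inj:
  assumes z: "z \<in> V" "z' \<in> V" "sp z = sp z'" "rho z = rho z'"
  shows "z = z'"
proof -
  have sgn: "\<bar>rho z\<bar> = (if z \<in> SP then 0 else if extleaf z then 3/4 else rho0 z)" for z
    unfolding rho_def using dir_cases[of "ix z"] rho0[of z] by auto
  have ixe: "ix z = ix z'" using has_sp[OF z(1)] has_sp[OF z(2)] z(3) by simp
  show ?thesis
  proof (cases "z \<in> SP \<or> z' \<in> SP")
    case True
    then have "z \<in> SP \<and> z' \<in> SP" using sgn[of z] sgn[of z'] z(4) rho0[of z] rho0[of z'] by (auto split: if_splits)
    then show ?thesis using z(3) sp_id by auto
  next
    case False
    then have eq: "(if extleaf z then 3/4 else rho0 z) = (if extleaf z' then 3/4 else rho0 z')"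
      using sgn[of z] sgn[of z'] z(4) by simp
    show ?thesis
    proof (cases "extleaf z \<or> extleaf z'")
      case True
      then have "extleaf z \<and> extleaf z'" using eq rho0[of z] rho0[of z'] by (auto split: if_splits)
      then show ?thesis using ixe unfolding extleaf_def by metis
    next
      case False
      then show ?thesis using eq rho0_inj[OF sp_SP[OF z(1)]] z unfolding inj_on_def by auto
    qed
  qed
qed

lemma X_pos: "z \<in> V \<Longrightarrow> \<bar>X z - pos z\<bar> \<le> wd (sp z)"
  unfolding X_def using rho_abs[of z] wd_pos[OF sp_SP, of z] by (simp add: abs_mult mult_left_le)

lemma X_SP: "s \<in> SP \<Longrightarrow> X s = \<tau> s" unfolding X_def by (simp add: pos_SP)

text \<open>A consequence of \<open>wd_E\<close>. It ensures that displacing leaves changes neither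
  their side of an end nor convergence to an end.\<close>

lemma X_E: "z \<in> V \<Longrightarrow> e \<in> E \<Longrightarrow> 3 * \<bar>X z - pos z\<bar> \<le> \<bar>pos z - e\<bar>"
proof -
  assume z: "z \<in> V" "e \<in> E"
  have "3 * \<bar>X z - pos z\<bar> \<le> 3 * wd (sp z)" using X_pos[OF z(1)] by simp
  also have "\<dots> \<le> \<bar>pos z - e\<bar>" using wd_E[OF sp_SP[OF z(1)] z(2)] unfolding pos_def .
  finally show ?thesis .
qed

lemma X_E_less: "z \<in> V \<Longrightarrow> e \<in> E \<Longrightarrow> e < X z \<longleftrightarrow> e < pos z"
  using X_E[of z e] pos_E[of z] by (cases "e = pos z") (auto simp: abs_if split: if_splits)

text \<open>Each of the two displacements is at most a third of the distance between the
  blocks.\<close>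

lemma X_less_pos:
  assumes z: "z \<in> V" "z' \<in> V" "pos z < pos z'"
  shows "X z < X z'"
proof -
  have s: "sp z \<in> SP" "sp z' \<in> SP" "sp z \<noteq> sp z'" using z sp_SP unfolding pos_def by auto
  have "3 * wd (sp z) \<le> pos z' - pos z" "3 * wd (sp z') \<le> pos z' - pos z"
    using wd_SP[OF s(1,2)] wd_SP[OF s(2,1)] s(3) z(3) unfolding pos_def by auto
  then show ?thesis using X_pos[OF z(1)] X_pos[OF z(2)] wd_pos[OF s(1)] wd_pos[OF s(2)] by linarith
qed

lemma pos_eq_sp: "z \<in> V \<Longrightarrow> z' \<in> V \<Longrightarrow> pos z = pos z' \<Longrightarrow> sp z = sp z'"
  using tau_inj sp_SP unfolding pos_def inj_on_def by blast

lemma X_less_rho: "z \<in> V \<Longrightarrow> z' \<in> V \<Longrightarrow> sp z = sp z' \<Longrightarrow> X z < X z' \<longleftrightarrow> rho z < rho z'"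
  using wd_pos[OF sp_SP, of z'] unfolding X_def pos_def by simp

lemma X_lessD: "z \<in> V \<Longrightarrow> z' \<in> V \<Longrightarrow> X z < X z' \<Longrightarrow> pos z < pos z' \<or> sp z = sp z' \<and> rho z < rho z'"
  using X_less_pos[of z' z] X_less_rho[of z z'] pos_eq_sp[of z z'] by force

lemma X_inj: "inj_on X V"
proof (rule inj_onI)
  fix z z' assume z: "z \<in> V" "z' \<in> V" "X z = X z'"
  then have "pos z = pos z'" using X_less_pos[of z z'] X_less_pos[of z' z] by linarith
  then have s: "sp z = sp z'" using pos_eq_sp z by blast
  then have "rho z = rho z'" using X_less_rho[OF z(1,2)] X_less_rho[OF z(2,1)] z(3) by simp
  then show "z = z'" using rho_inj z s by blast
qed

lemma X_range: "z \<in> V \<Longrightarrow> - (1/4) \<le> X z \<and> X z \<le> 5/4"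
  using X_pos[of z] pos01[of z] wd_le[OF sp_SP, of z] by auto

lemma X_discrete:
  assumes t: "t \<notin> E" shows "\<exists>\<epsilon>>0. finite {z \<in> V. \<bar>X z - t\<bar> < \<epsilon>}"
proof -
  obtain d where d: "d > 0" "\<forall>e\<in>E. d \<le> dist t e" using separate_point_closed[OF E_closed t] by blast
  \<comment> \<open>If \<open>\<bar>X z - t\<bar> < d/2\<close>, then \<open>X_E\<close> yields that
    \<open>d\<close> is at most \<open>d/2\<close> plus 4/3 of \<open>\<bar>pos z - e\<bar>\<close>;
    this is the origin of 3/8.\<close>
  define K where "K = {0..1} \<inter> (\<Inter>e\<in>E. {x. 3 * d / 8 \<le> \<bar>x - e\<bar>})"
  have "compact K" unfolding K_def
    by (intro compact_Int_closed compact_Icc closed_INT ballI closed_Collect_le continuous_intros)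
  moreover have "K \<inter> E = {}" unfolding K_def using d by force
  ultimately have "finite {z \<in> V. pos z \<in> K}" by (rule finite_compact_V)
  moreover have "{z \<in> V. \<bar>X z - t\<bar> < d/2} \<subseteq> {z \<in> V. pos z \<in> K}"
  proof
    fix z assume "z \<in> {z \<in> V. \<bar>X z - t\<bar> < d/2}"
    then have z: "z \<in> V" "\<bar>X z - t\<bar> < d/2" by auto
    have "3 * d / 8 \<le> \<bar>pos z - e\<bar>" if e: "e \<in> E" for e
    proof -
      have "d \<le> \<bar>t - e\<bar>" using d e by (auto simp: dist_real_def)
      moreover have "3 * \<bar>X z - pos z\<bar> \<le> \<bar>pos z - e\<bar>" using X_E z e by blast
      moreover have "\<bar>t - e\<bar> \<le> \<bar>X z - t\<bar> + \<bar>X z - pos z\<bar> + \<bar>pos z - e\<bar>" by linarith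
      ultimately have "d \<le> d/2 + \<bar>pos z - e\<bar> / 3 + \<bar>pos z - e\<bar>" using z(2) by linarith
      then show ?thesis by simp
    qed
    then show "z \<in> {z \<in> V. pos z \<in> K}" using z pos01[OF z(1)] unfolding K_def by auto
  qed
  ultimately have "finite {z \<in> V. \<bar>X z - t\<bar> < d/2}" by (rule rev_finite_subset)
  then show ?thesis using d by (intro exI[of _ "d/2"]) auto
qed

section \<open>Consecutive vertices of a strand are adjacent in the square\<close>

lemma nxt_state:
  assumes n: "nxt s u"
  shows "insec s \<Longrightarrow> insec u \<Longrightarrow> ev s \<noteq> ev u" "lft u \<Longrightarrow> lft s" "insec u \<Longrightarrow> \<not> insec s \<Longrightarrow> lft s"
proof -
  have su: "s \<in> SP" "u \<in> SP" "\<tau> s < \<tau> u" "cl s = cl u" using nxtD[OF n] by auto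
  have h: "has s = has u" "ix s = ix u" using has_cong[OF su(4)] by auto
  show "ev s \<noteq> ev u" using par[OF n] h su unfolding ev_def by (simp add: sp_id) metis
  show "lft u \<Longrightarrow> lft s" "insec u \<Longrightarrow> \<not> insec s \<Longrightarrow> lft s"
    using h su pos_SP[OF su(1)] pos_SP[OF su(2)] unfolding lft_def insec_def by auto
qed

lemma A_SP: "s \<in> SP \<Longrightarrow> s \<in> A \<longleftrightarrow> \<not> insec s \<or> \<not> ev s"
  unfolding A_def using SP_V by auto

lemma A_leaf: "z \<in> A \<Longrightarrow> z \<notin> SP \<Longrightarrow> \<not> insec (sp z) \<or> ev (sp z) \<and> \<not> entleaf z"
  unfolding A_def using insec_sp ev_sp by (auto split: if_splits)

lemma Q_SP: "s \<in> SP \<Longrightarrow> s \<in> Q \<longleftrightarrow> insec s \<and> ev s"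
  unfolding Q_def using SP_V entleafD(5) by auto

lemma QD: "z \<in> Q \<Longrightarrow> insec z \<and> has z \<and> ix z \<in> J" unfolding Q_def insec_def using hasD by auto

text \<open>One of the two is the common spine vertex, or it is the middle vertex of a path joining
  them.\<close>

lemma block_adj2: "z \<in> V \<Longrightarrow> z' \<in> V \<Longrightarrow> sp z = sp z' \<Longrightarrow> z \<noteq> z' \<Longrightarrow> adj2 z z'"
  unfolding adj2_def using sp_adj[of z] sp_adj[of z'] sp_id adj_sym by metis

text \<open>Two leaves of neighbouring blocks are three steps apart along the caterpillar, so at
  least one of the two vertices has to be on the spine.\<close>

lemma nxt_adj2:
  assumes "nxt s u \<or> nxt u s" "a \<in> V" "b \<in> V" "sp a = s" "sp b = u" "a \<in> SP \<or> b \<in> SP"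
  shows "adj2 a b"
proof -
  have su: "adj s u" "s \<noteq> u" "s \<in> SP" "u \<in> SP" using assms(1) nxt_adj nxtD adj_sym by blast+
  have ab: "a \<noteq> b" using assms su by auto
  show ?thesis
  proof (cases "a \<in> SP")
    case True
    then have a: "a = s" using assms sp_id by auto
    show ?thesis using su a ab sp_adj[OF assms(3)] assms(5) sp_id[of b] adj_sym unfolding adj2_def by metis
  next
    case False
    then have b: "b = u" using assms sp_id by auto
    show ?thesis using su b ab sp_adj[OF assms(2) False] assms(4) unfolding adj2_def by metis
  qed
qed

lemma nxt2_adj2: "nxt s u \<Longrightarrow> nxt u s' \<Longrightarrow> adj2 s s'"
  unfolding adj2_def using nxt_adj nxtD by (metis less_asym')

text \<open>Consecutive vertices of \<open>A\<close> lie in one block, or in neighbouring blocks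
  with one of them on the spine, or they are spine vertices on both sides of a single skipped block.
  The placement of leaves and the alternation of parities exclude everything else.\<close>

lemma A_consec:
  assumes ab: "a \<in> A" "b \<in> A" "X a < X b" and no: "\<And>c. c \<in> A \<Longrightarrow> X a < X c \<Longrightarrow> X c < X b \<Longrightarrow> False"
    and noE: "\<And>e. e \<in> E \<Longrightarrow> X a < e \<Longrightarrow> e < X b \<Longrightarrow> False"
  shows "adj2 a b"
proof -
  have V: "a \<in> V" "b \<in> V" using ab A_V by auto
  define s s' where "s = sp a" and "s' = sp b"
  have S: "s \<in> SP" "s' \<in> SP" "pos a = \<tau> s" "pos b = \<tau> s'" "s \<in> V" "s' \<in> V"
    using V sp_SP SP_V unfolding s_def s'_def pos_def by auto
  show ?thesis
  proof (cases "s = s'")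
    case True then show ?thesis using block_adj2 V ab unfolding s_def s'_def by auto
  next
    case False
    then have less: "\<tau> s < \<tau> s'" using X_lessD[OF V ab(3)] S unfolding s_def s'_def by auto
    have "cl a = cl b"
    proof (rule cl_eqI)
      fix e assume e: "e \<in> E"
      show "\<not> (min (pos a) (pos b) \<le> e \<and> e < max (pos a) (pos b))"
      proof
        assume "min (pos a) (pos b) \<le> e \<and> e < max (pos a) (pos b)"
        then have "pos a \<le> e" "e < pos b" using less S by auto
        then have "\<not> e < X a" "e < X b" "e \<noteq> X a"
          using X_E_less[OF V(1) e] X_E_less[OF V(2) e] X_E[OF V(1) e] pos_E[OF V(1)] e by auto
        then show False using noE[OF e] by auto
      qed
    qed
    then have cl: "cl s = cl s'" using cl_sp V unfolding s_def s'_def by simp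
    obtain u where u: "nxt s u" "\<tau> u \<le> \<tau> s'" using succ_ex[OF S(1,2) cl less] by blast
    have uS: "u \<in> SP" "u \<in> V" "\<tau> s < \<tau> u" using nxtD[OF u(1)] SP_V by auto
    have noin: "s'' \<notin> A" if "s'' \<in> SP" "\<tau> s < \<tau> s''" "\<tau> s'' < \<tau> s'" for s''
      using no[of s''] X_less_pos[of a s''] X_less_pos[of s'' b] V S that SP_V pos_SP[of s''] by auto
    \<comment> \<open>Otherwise the spine vertex \<open>s\<close>, belonging to \<open>A\<close>,
      would lie strictly between its leaf \<open>a\<close> and \<open>b\<close>.\<close>
    have aS: "s \<in> A \<Longrightarrow> a \<notin> SP \<Longrightarrow> 0 < rho a"
    proof (rule ccontr)
      assume h: "s \<in> A" "a \<notin> SP" "\<not> 0 < rho a"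
      have "sp s = s" using S sp_id by auto
      moreover have "a \<noteq> s" using h S by auto
      ultimately have "rho a \<noteq> rho s" using rho_inj[OF V(1) S(5)] s_def by auto
      then have "X a < X s" using X_less_rho[OF V(1) S(5)] h S \<open>sp s = s\<close> unfolding s_def by simp
      moreover have "X s < X b" using X_less_pos[OF S(5) V(2)] S less pos_SP by auto
      ultimately show False using no h by blast
    qed
    have bS: "s' \<in> A \<Longrightarrow> b \<notin> SP \<Longrightarrow> rho b < 0"
    proof (rule ccontr)
      assume h: "s' \<in> A" "b \<notin> SP" "\<not> rho b < 0"
      have "sp s' = s'" using S sp_id by auto
      moreover have "b \<noteq> s'" using h S by auto
      ultimately have "rho b \<noteq> rho s'" using rho_inj[OF V(2) S(6)] s'_def by auto
      then have "X s' < X b" using X_less_rho[OF S(6) V(2)] h S \<open>sp s' = s'\<close> unfolding s'_def by simp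
      moreover have "X a < X s'" using X_less_pos[OF V(1) S(6)] S less pos_SP by auto
      ultimately show False using no h by blast
    qed
    \<comment> \<open>A leaf can be the last vertex of \<open>A\<close> in its block only if the
      spine vertex went to \<open>Q\<close> or the leaves are placed after it, as happens to the
      right of a section and in gaps without one.\<close>
    have aL: "insec s \<and> ev s \<or> \<not> insec s \<and> \<not> lft s" if "a \<notin> SP"
      using A_leaf[OF ab(1) that] A_SP[OF S(1)] aS that rho_lft[OF that] lft_sp[OF V(1)] unfolding s_def by force
    have bL: "insec s' \<and> ev s' \<or> \<not> insec s' \<and> lft s'" if "b \<notin> SP"
      using A_leaf[OF ab(2) that] A_SP[OF S(2)] bS that rho_right[OF that] lft_sp[OF V(2)] insec_sp[OF V(2)] unfolding s'_def by force
    show ?thesis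
    proof (cases "u = s'")
      case True
      have "a \<in> SP \<or> b \<in> SP"
        using aL bL nxt_state[OF u(1)] unfolding True insec_def lft_def by force
      then show ?thesis using nxt_adj2[of s s' a b] u True V unfolding s_def s'_def by auto
    next
      case False
      then have us: "\<tau> u < \<tau> s'" using u S uS inj_onD[OF tau_inj, of u s'] by force
      \<comment> \<open>A block is skipped by \<open>A\<close> only if its spine vertex went to
        \<open>Q\<close>; the next block has the other parity, so two blocks in a row cannot be
        skipped.\<close>
      have iu: "insec u \<and> ev u" using noin[OF uS(1,3) us] A_SP uS by blast
      obtain u' where u': "nxt u u'" "\<tau> u' \<le> \<tau> s'" using succ_ex[OF uS(1) S(2) _ us] nxtD[OF u(1)] cl by auto
      have u'S: "u' \<in> SP" "\<tau> u < \<tau> u'" using nxtD[OF u'(1)] by auto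
      have "u' = s'"
      proof (rule ccontr)
        assume "u' \<noteq> s'"
        then have "\<tau> u' < \<tau> s'" using u' S u'S inj_onD[OF tau_inj, of u' s'] by force
        then have "insec u' \<and> ev u'" using noin[OF u'S(1)] uS u'S A_SP by force
        then show False using nxt_state(1)[OF u'(1)] iu by blast
      qed
      then have n2: "nxt u s'" using u' by simp
      have "a \<in> SP" using aL nxt_state[OF u(1)] iu by blast
      moreover have "b \<in> SP" using bL nxt_state[OF n2] iu unfolding insec_def lft_def by force
      ultimately have "a = s" "b = s'" using sp_id unfolding s_def s'_def by auto
      then show ?thesis using nxt2_adj2[OF u(1) n2] by simp
    qed
  qed
qed

lemma entleaf_side:
  assumes "entleaf z"
  shows "dir (ix z) = 1 \<and> pos z = min (pin (ix z)) (pout (ix z)) \<and> rho z < 0 \<or>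
    dir (ix z) = -1 \<and> pos z = max (pin (ix z)) (pout (ix z)) \<and> 0 < rho z"
  using rho_ent[OF assms] entleafD(4)[OF assms] unfolding dir_def by (auto split: if_splits)

lemma Q_cases: "z \<in> Q \<Longrightarrow> \<not> entleaf z \<Longrightarrow> ev z \<longleftrightarrow> z \<in> SP"
  unfolding Q_def by (auto split: if_splits)

text \<open>The counterpart of \<open>A_consec\<close> inside a section, with the parities
  exchanged, and formulated for increasing \<open>X\<close> so that it serves both directions of
  travel. When \<open>a\<close> and \<open>b\<close> lie in different blocks, neither is an entry
  leaf, because the spine vertex of its block is also in \<open>Q\<close> and would come
  between.\<close>

lemma Q_consec_section:
  assumes ab: "a \<in> Q" "b \<in> Q" "ix a = ix b" "X a < X b"
    and no: "\<And>c. c \<in> Q \<Longrightarrow> ix c = ix a \<Longrightarrow> X a < X c \<Longrightarrow> X c < X b \<Longrightarrow> False"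
  shows "adj2 a b"
proof -
  have V: "a \<in> V" "b \<in> V" using ab Q_V by auto
  define s s' where "s = sp a" and "s' = sp b"
  have S: "s \<in> SP" "s' \<in> SP" "pos a = \<tau> s" "pos b = \<tau> s'" "s \<in> V" "s' \<in> V"
    using V sp_SP SP_V unfolding s_def s'_def pos_def by auto
  have cl: "cl s = cl s'" using hasD QD[OF ab(1)] QD[OF ab(2)] ab(3) cl_sp V unfolding s_def s'_def by metis
  have ins: "insec s" "insec s'" "ev s = ev a" "ev s' = ev b" "ix s = ix a" "ix s' = ix a" "has s"
    using insec_sp ev_sp has_sp V QD ab unfolding s_def s'_def by auto
  show ?thesis
  proof (cases "s = s'")
    case True then show ?thesis using block_adj2 V ab unfolding s_def s'_def by auto
  next
    case False
    then have less: "\<tau> s < \<tau> s'" using X_lessD[OF V ab(4)] S unfolding s_def s'_def by auto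
    have ina: "insec c" "ix c = ix a" if "c \<in> SP" "\<tau> s \<le> \<tau> c" "\<tau> c \<le> \<tau> s'" for c
    proof -
      have "cl c = cl s" using cl_between[OF cl, of c] that pos_SP[OF S(1)] pos_SP[OF S(2)] pos_SP[OF that(1)] by simp
      then have h: "has c = has s" "ix c = ix s" using has_cong[of c s] by blast+
      then show "ix c = ix a" using ins by simp
      have "ix s' = ix s" using ins by simp
      then show "insec c" using ins(1,2) h that(2,3) pos_SP[OF S(1)] pos_SP[OF S(2)] pos_SP[OF that(1)] unfolding insec_def by auto
    qed
    have na: "\<not> entleaf a"
    proof
      assume e: "entleaf a"
      have "pos a \<noteq> max (pin (ix a)) (pout (ix a))" using ins(2,6) less S pos_SP[OF S(2)] unfolding insec_def by auto
      then have r: "rho a < 0" using entleaf_side[OF e] by blast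
      have "s \<in> Q" using Q_SP S ins entleafD(3)[OF e] by simp
      moreover have "X a < X s" using X_less_rho[OF V(1) S(5)] r S sp_id unfolding s_def by auto
      moreover have "X s < X b" using X_less_pos[OF S(5) V(2)] less S pos_SP by auto
      ultimately show False using no ins by blast
    qed
    have nb: "\<not> entleaf b"
    proof
      assume e: "entleaf b"
      have "pos b \<noteq> min (pin (ix b)) (pout (ix b))" using ins(1,5) less S pos_SP[OF S(1)] ab(3) unfolding insec_def by auto
      then have r: "0 < rho b" using entleaf_side[OF e] by blast
      have "s' \<in> Q" using Q_SP S ins entleafD(3)[OF e] by simp
      moreover have "X s' < X b" using X_less_rho[OF S(6) V(2)] r S sp_id unfolding s'_def by auto
      moreover have "X a < X s'" using X_less_pos[OF V(1) S(6)] less S pos_SP by auto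
      ultimately show False using no ins by blast
    qed
    obtain u where u: "nxt s u" "\<tau> u \<le> \<tau> s'" using succ_ex[OF S(1,2) cl less] by blast
    have uS: "u \<in> SP" "u \<in> V" "\<tau> s < \<tau> u" using nxtD[OF u(1)] SP_V by auto
    have iu: "insec u" using ina uS u by auto
    have noin: "\<not> ev c" if "c \<in> SP" "\<tau> s < \<tau> c" "\<tau> c < \<tau> s'" for c
    proof
      assume "ev c"
      then have "c \<in> Q" using Q_SP that ina by auto
      moreover have "X a < X c" "X c < X b" using X_less_pos[of a c] X_less_pos[of c b] V S that SP_V pos_SP by auto
      ultimately show False using no[of c] ina(2)[of c] that by auto
    qed
    show ?thesis
    proof (cases "u = s'")
      case True
      then have "ev a \<noteq> ev b" using nxt_state(1)[OF u(1)] ins by simp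
      then have "a \<in> SP \<or> b \<in> SP" using Q_cases ab na nb by blast
      then show ?thesis using nxt_adj2[of s s' a b] u True V unfolding s_def s'_def by auto
    next
      case False
      then have us: "\<tau> u < \<tau> s'" using u S uS inj_onD[OF tau_inj, of u s'] by force
      have ou: "\<not> ev u" using noin uS us by blast
      obtain u' where u': "nxt u u'" "\<tau> u' \<le> \<tau> s'" using succ_ex[OF uS(1) S(2) _ us] nxtD[OF u(1)] cl by auto
      have u'S: "u' \<in> SP" "\<tau> u < \<tau> u'" using nxtD[OF u'(1)] by auto
      have "ev u'" using nxt_state(1)[OF u'(1) iu] ina(1)[of u'] u'S uS u' ou by auto
      then have "u' = s'" using noin[of u'] u'S uS u' inj_onD[OF tau_inj, of u' s'] S by force
      then have n2: "nxt u s'" using u' by simp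
      have "ev a" "ev b" using nxt_state(1)[OF u(1)] nxt_state(1)[OF n2] ins iu ou by auto
      then have "a = s" "b = s'" using Q_cases ab na nb sp_id unfolding s_def s'_def by auto
      then show ?thesis using nxt2_adj2[OF u(1) n2] by simp
    qed
  qed
qed

lemma dX_less_pos:
  assumes "z \<in> V" "z' \<in> V" "dir i * pos z < dir i * pos z'"
  shows "dir i * X z < dir i * X z'"
  using dir_cases[of i] X_less_pos[of z z'] X_less_pos[of z' z] assms by auto

lemma dX_less_rho:
  assumes "z \<in> V" "z' \<in> V" "sp z = sp z'" "dir i * rho z < dir i * rho z'"
  shows "dir i * X z < dir i * X z'"
  using dir_cases[of i] X_less_rho[of z z'] X_less_rho[of z' z] assms by auto

text \<open>\<open>X_range\<close> puts \<open>dir i * X z + 2\<close> between 3/4 and 13/4. After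
  division by 5 it cannot outweigh a difference of section indices in \<open>key\<close>.\<close>

lemma key_frac: "z \<in> V \<Longrightarrow> 0 < (dir i * X z + 2) / 5 \<and> (dir i * X z + 2) / 5 < 1"
  using dir_cases[of i] X_range[of z] by auto

lemma key_less:
  assumes "a \<in> V" "b \<in> V"
  shows "key a < key b \<longleftrightarrow> ix a < ix b \<or> ix a = ix b \<and> dir (ix a) * X a < dir (ix a) * X b"
proof -
  have f: "0 < (dir (ix a) * X a + 2) / 5" "(dir (ix a) * X a + 2) / 5 < 1" 
    "0 < (dir (ix b) * X b + 2) / 5" "(dir (ix b) * X b + 2) / 5 < 1"
    using key_frac assms by blast+
  consider "ix a < ix b" | "ix a = ix b" | "ix b < ix a" by linarith
  then show ?thesis
  proof cases
    case 1
    then have "real_of_int (ix a) + 1 \<le> real_of_int (ix b)" by linarith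
    then show ?thesis unfolding key_def using f 1 by linarith
  next
    case 2 then show ?thesis unfolding key_def by simp
  next
    case 3
    then have "real_of_int (ix b) + 1 \<le> real_of_int (ix a)" by linarith
    then show ?thesis unfolding key_def using f 3 by linarith
  qed
qed

lemma key_inj: "a \<in> V \<Longrightarrow> b \<in> V \<Longrightarrow> key a = key b \<Longrightarrow> a = b"
proof -
  assume ab: "a \<in> V" "b \<in> V" "key a = key b"
  have i: "ix a = ix b" using key_less[OF ab(1,2)] key_less[OF ab(2,1)] ab(3) by force
  then have "X a = X b" using ab(3) dir_cases[of "ix a"] unfolding key_def by auto
  then show ?thesis using X_inj ab unfolding inj_on_def by blast
qed

lemma sec_extreme: "insec c \<Longrightarrow> dir (ix c) * pin (ix c) \<le> dir (ix c) * pos c \<and> dir (ix c) * pos c \<le> dir (ix c) * pout (ix c)"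
  unfolding insec_def dir_def by (auto split: if_splits)

text \<open>The predecessor in the direction of travel, which for \<open>d = -1\<close> is the
  successor on the line.\<close>

lemma dstep:
  assumes d: "d = 1 \<or> d = (-1::real)" and s: "s \<in> SP" "s' \<in> SP" "cl s = cl s'" "d * \<tau> s < d * \<tau> s'"
  shows "\<exists>u\<in>SP. (nxt u s' \<or> nxt s' u) \<and> d * \<tau> s \<le> d * \<tau> u \<and> d * \<tau> u < d * \<tau> s' \<and>
     (\<forall>x\<in>SP. d * \<tau> x < d * \<tau> s' \<longrightarrow> d * \<tau> x \<le> d * \<tau> u)"
  using d
proof
  assume d: "d = 1"
  then obtain u where u: "nxt u s'" "\<tau> s \<le> \<tau> u" using pred_ex[OF s(1-3)] s(4) by auto
  then show ?thesis using d nxtD[OF u(1)] nxt_before[OF u(1)] by (intro bexI[of _ u]) auto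
next
  assume d: "d = - 1"
  then obtain u where u: "nxt s' u" "\<tau> u \<le> \<tau> s" using succ_ex[OF s(2,1) s(3)[symmetric]] s(4) by auto
  then show ?thesis using d nxtD[OF u(1)] nxt_after[OF u(1)] by (intro bexI[of _ u]) auto
qed

lemma ent_cl: "i \<in> J \<Longrightarrow> low i \<Longrightarrow> cl (ent i) = cl (mid i)"
  and ext_cl: "i \<in> J \<Longrightarrow> upp i \<Longrightarrow> cl (ext i) = cl (mid i)"
  using ent ext unfolding low_def upp_def by blast+

text \<open>In the entry block \<open>Q\<close> takes the spine vertex and no leaf except the entry
  leaf, which is displaced against the direction of travel.\<close>

lemma ent_first:
  assumes i: "i \<in> J" "low i"
  shows "ent i \<in> Q" and "\<And>c. c \<in> Q \<Longrightarrow> ix c = i \<Longrightarrow> c \<noteq> ent i \<Longrightarrow> key (ent i) < key c"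
proof -
  have e: "ent i \<in> V" "insec (ent i)" "ix (ent i) = i" "sp (ent i) = anc i" "pos (ent i) = pin i"
    using ent_sec[OF i] by auto
  have lf: "entleaf (ent i)" if "ent i \<notin> SP" unfolding entleaf_def using e i that unfolding insec_def by auto
  show "ent i \<in> Q"
  proof (cases "ent i \<in> SP")
    case True then show ?thesis using anc_sec(6)[OF i(1)] e sp_id by simp
  next
    case False then show ?thesis using entleafD(7)[OF lf] by blast
  qed
  fix c assume c: "c \<in> Q" "ix c = i" "c \<noteq> ent i"
  have V: "c \<in> V" using c Q_V by blast
  have "dir i * pin i \<le> dir i * pos c" using sec_extreme[of c] QD[OF c(1)] c(2) by simp
  then consider "dir i * pos (ent i) < dir i * pos c" | "dir i * pos (ent i) = dir i * pos c" using e by fastforce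
  then have "dir i * X (ent i) < dir i * X c"
  proof cases
    case 1 then show ?thesis using dX_less_pos e V by blast
  next
    case 2
    then have "pos (ent i) = pos c" using dir_cases[of i] by auto
    then have sp: "sp (ent i) = sp c" using pos_eq_sp e V by blast
    then have "ev c" unfolding ev_def using c e by simp
    moreover have "\<not> entleaf c" using c unfolding entleaf_def by auto
    ultimately have "c \<in> SP" using Q_cases c by blast
    then have "ent i \<notin> SP" using sp sp_id c by auto
    then have "dir i * rho (ent i) < dir i * rho c" using rho_ent[OF lf] e \<open>c \<in> SP\<close> by simp
    then show ?thesis using dX_less_rho e V sp by blast
  qed
  then show "key (ent i) < key c" using key_less[OF e(1) V] e c by simp
qed

text \<open>Between two sections, \<open>b\<close> is the entry \<open>ent j\<close>, which is
  adjacent to \<open>ext i\<close>, so \<open>a\<close> must be \<open>ext i\<close> or a neighbour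
  of it. If the exit block has the entry parity, \<open>a\<close> is its spine vertex. Otherwise
  \<open>a\<close> is the exit leaf or, when \<open>ext i\<close> is on the spine, a leaf hanging
  from it or the spine vertex before it.\<close>

lemma Q_consec:
  assumes ab: "a \<in> Q" "b \<in> Q" "key a < key b" and no: "\<And>c. c \<in> Q \<Longrightarrow> key a < key c \<Longrightarrow> key c < key b \<Longrightarrow> False"
  shows "adj2 a b"
proof (cases "ix a = ix b")
  case True
  have V: "a \<in> V" "b \<in> V" using ab Q_V by auto
  have d: "dir (ix a) * X a < dir (ix a) * X b" using key_less[OF V] ab(3) True by simp
  have no': False if c: "c \<in> Q" "ix c = ix a" "dir (ix a) * X a < dir (ix a) * X c" "dir (ix a) * X c < dir (ix a) * X b" for c
    using no[OF c(1)] key_less[OF V(1) Q_V[OF c(1)]] key_less[OF Q_V[OF c(1)] V(2)] c True by simp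
  show ?thesis using dir_cases[of "ix a"]
  proof
    assume dd: "dir (ix a) = 1"
    show ?thesis by (rule Q_consec_section[OF ab(1,2) True]) (use d no' dd in auto)
  next
    assume dd: "dir (ix a) = -1"
    have "adj2 b a" by (rule Q_consec_section[OF ab(2,1) True[symmetric]]) (use d no' dd True in auto)
    then show ?thesis by (rule adj2_sym)
  qed
next
  case False
  define i j where "i = ix a" and "j = ix b"
  have V: "a \<in> V" "b \<in> V" using ab Q_V by auto
  have ij: "i < j" "i \<in> J" "j \<in> J" using key_less[OF V] ab(3) False QD[OF ab(1)] QD[OF ab(2)] unfolding i_def j_def by auto
  have up: "upp i" "low j" unfolding upp_def low_def using ij by auto
  \<comment> \<open>A section in between would contribute its anchor to \<open>Q\<close>.\<close>
  have "\<not> (i < k \<and> k < j)" if k: "k \<in> J" for k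
  proof
    assume h: "i < k \<and> k < j"
    have "anc k \<in> Q" "ix (anc k) = k" "anc k \<in> V" using anc_sec[OF k] Q_V by auto
    then show False using no[of "anc k"] key_less[OF V(1), of "anc k"] key_less[OF _ V(2), of "anc k"] h unfolding i_def j_def by auto
  qed
  then have br: "adj (ext i) (ent j)" using bridge ij by blast
  have less: "key c < key b" if "c \<in> Q" "ix c = i" for c
    using key_less[OF Q_V[OF that(1)] V(2)] that ij unfolding j_def by simp
  have b: "b = ent j"
  proof (rule ccontr)
    assume "b \<noteq> ent j"
    then have "key (ent j) < key b" using ent_first(2)[OF ij(3) up(2) ab(2)] j_def by simp
    moreover have "ent j \<in> Q" "ent j \<in> V" "ix (ent j) = j" using ent_first(1) ent_sec ij up by auto
    moreover have "key a < key (ent j)" using key_less[OF V(1), of "ent j"] calculation ij unfolding i_def by simp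
    ultimately show False using no by blast
  qed
  have x: "ext i \<in> V" "insec (ext i)" "ix (ext i) = i" "pos (ext i) = pout i" using ext_sec ij up by auto
  define w where "w = sp (ext i)"
  have w: "w \<in> SP" "w \<in> V" "insec w" "ix w = i" "\<tau> w = pout i" "ev w = ev (ext i)" "sp w = w" "cl w = cl (mid i)"
    using x sp_SP SP_V insec_sp has_sp ev_sp pos_sp sp_id cl_sp ext_cl[OF ij(2) up(1)] unfolding w_def pos_def insec_def by auto
  have ia: "insec a" "cl a = cl (mid i)" using QD[OF ab(1)] hasD[of a] unfolding i_def by auto
  \<comment> \<open>\<open>adj2\<close> asks for distinct vertices; those of the \<open>i\<close>-th
    gap differ from \<open>b\<close> because different indices belong to different gaps.\<close>
  have notb: "z \<noteq> b" if "cl z = cl (mid i)" for z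
  proof
    assume "z = b"
    then have "cl (mid i) = cl (mid j)" using that hasD[of b] QD[OF ab(2)] unfolding j_def by simp
    then show False using mid_inj ij by auto
  qed
  have last: "dir i * X c \<le> dir i * X a" if c: "c \<in> Q" "ix c = i" for c
  proof (rule ccontr)
    assume "\<not> ?thesis"
    then have "key a < key c" using key_less[OF V(1) Q_V[OF c(1)]] c unfolding i_def by simp
    then show False using no[OF c(1)] less[OF c] by blast
  qed
  have pa: "dir i * pos a \<le> dir i * \<tau> w" using sec_extreme[OF ia(1)] w unfolding i_def by simp
  have aw: "dir i * pos a < dir i * \<tau> w" if "sp a \<noteq> w"
  proof -
    have "pos a \<noteq> \<tau> w" using that pos_eq_sp[OF V(1) w(2)] w pos_SP by auto
    then show ?thesis using pa dir_cases[of i] by auto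
  qed
  have before: "\<not> dir i * X a < dir i * X c" if "c \<in> Q" "ix c = i" for c using last[OF that] by simp
  \<comment> \<open>In the block of such a \<open>c\<close>, \<open>Q\<close> takes nothing but
    \<open>c\<close> and possibly the entry leaf, which comes earlier. As no vertex of
    \<open>Q\<close> in this section comes after \<open>a\<close>, only \<open>a = c\<close>
    remains.\<close>
  have spine_last: "a = c" if c: "c \<in> SP" "insec c" "ev c" "ix c = i" "dir i * pos a \<le> dir i * \<tau> c" for c
  proof -
    have cQ: "c \<in> Q" "c \<in> V" using Q_SP c SP_V by auto
    have "pos a = pos c"
    proof (rule ccontr)
      assume "pos a \<noteq> pos c"
      then have "dir i * pos a < dir i * pos c" using c(5) pos_SP[OF c(1)] dir_cases[of i] by auto
      then show False using dX_less_pos[OF V(1) cQ(2)] before cQ c by blast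
    qed
    then have sp: "sp a = c" using pos_eq_sp[OF V(1) cQ(2)] sp_id[OF c(1)] by simp
    then have "ev a" using ev_sp[OF V(1)] c by simp
    moreover have "\<not> entleaf a"
    proof
      assume "entleaf a"
      then have "dir i * rho a < dir i * rho c" using rho_ent c unfolding i_def by simp
      then show False using dX_less_rho[OF V(1) cQ(2)] before cQ c sp sp_id by metis
    qed
    ultimately have "a \<in> SP" using Q_cases ab by blast
    then show "a = c" using sp sp_id by simp
  qed
  show ?thesis
  proof (cases "ev w")
    case True
    then have "a = w" using spine_last[of w] w pa by simp
    then show ?thesis using br b sp_adj[OF x(1)] adj_sym notb w sp_id[of "ext i"] unfolding adj2_def w_def by metis
  next
    case ow: False
    show ?thesis
    proof (cases "ext i \<in> SP")
      case False
      have xl: "extleaf (ext i)" unfolding extleaf_def using False up x unfolding insec_def by simp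
      have nx: "\<not> entleaf z" if "z \<in> V" "sp z = w" for z
        using entleafD(3)[of z] ev_sp[of z] that ow by auto
      have xQ: "ext i \<in> Q" unfolding Q_def using x False ow w by auto
      have "a = ext i"
      proof (rule ccontr)
        assume ne: "a \<noteq> ext i"
        have "dir i * X a < dir i * X (ext i)"
        proof (cases "sp a = w")
          case True
          have na: "\<not> extleaf a" using ne unfolding extleaf_def i_def by simp
          have as: "a \<notin> SP" using Q_cases[OF ab(1) nx[OF V(1) True]] ev_sp[OF V(1)] True ow by simp
          \<comment> \<open>The offset 3/4 exceeds every value of \<open>rho0\<close>, which makes
            the exit leaf the last vertex of its block.\<close>
          have "rho a = dir i * rho0 a" "rho (ext i) = dir i * (3/4)"
            unfolding rho_def using na as False nx[OF V(1) True] nx[OF x(1) w_def[symmetric]] ia x xl i_def by simp_all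
          then have "dir i * rho a < dir i * rho (ext i)" using dir_cases[of i] rho0[of a] by auto
          then show ?thesis using dX_less_rho[OF V(1) x(1)] True w_def by simp
        next
          case False
          then show ?thesis using dX_less_pos[OF V(1) x(1)] aw x w by simp
        qed
        then show False using before xQ x by blast
      qed
      then show ?thesis using br b unfolding adj2_def by simp
    next
      case True
      then have xw: "ext i = w" using sp_id unfolding w_def by simp
      show ?thesis
      proof (cases "sp a = w")
        case sa: True
        have "a \<noteq> w" using Q_SP[OF w(1)] ab ow by auto
        then have "a \<notin> SP" using sa sp_id by auto
        then show ?thesis using sp_adj[OF V(1)] sa br b xw notb[OF ia(2)] unfolding adj2_def by metis
      next
        case sa: False
        \<comment> \<open>The anchor lies before the exit block and has the other parity, so the
          block just before the exit still belongs to the section and has its spine vertex in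
          \<open>Q\<close>.\<close>
        have an: "anc i \<in> SP" "cl (anc i) = cl w" "insec (anc i)" "ix (anc i) = i" "ev (anc i)" using anc_sec[OF ij(2)] w by auto
        have "dir i * \<tau> (anc i) \<le> dir i * \<tau> w" using sec_extreme[OF an(3)] an w pos_SP by simp
        moreover have "\<tau> (anc i) \<noteq> \<tau> w" using inj_onD[OF tau_inj _ an(1) w(1)] an(5) ow by auto
        ultimately have "dir i * \<tau> (anc i) < dir i * \<tau> w" using dir_cases[of i] by auto
        then obtain u where u: "u \<in> SP" "nxt u w \<or> nxt w u" "dir i * \<tau> (anc i) \<le> dir i * \<tau> u" "dir i * \<tau> u < dir i * \<tau> w"
          "\<forall>x\<in>SP. dir i * \<tau> x < dir i * \<tau> w \<longrightarrow> dir i * \<tau> x \<le> dir i * \<tau> u"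
          using dstep[OF dir_cases an(1) w(1) an(2)] by blast
        have clu: "cl u = cl w" using nxtD u(2) by metis
        have hu: "has u" "ix u = i" using has_cong[OF clu] w unfolding insec_def by auto
        have "insec u" using an(3,4) w(3,4) u(3,4) hu dir_cases[of i] pos_SP[OF u(1)] pos_SP[OF an(1)] pos_SP[OF w(1)]
          unfolding insec_def by auto
        then have eu: "ev u" using u(2) nxt_state(1)[of u w] nxt_state(1)[of w u] ow w by blast
        have "dir i * pos a \<le> dir i * \<tau> u" using u(5) aw[OF sa] sp_SP[OF V(1)] unfolding pos_def by blast
        then have au: "a = u" using spine_last \<open>insec u\<close> eu hu u by blast
        have "adj u w" using u(2) nxt_adj adj_sym by blast
        then show ?thesis using au br b xw notb[OF ia(2)] unfolding adj2_def by metis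
      qed
    qed
  qed
qed

text \<open>Entry and exit of a section lie in one gap, so there are no ends between them and the
  section is finite. The first and the last section may be infinite, but there \<open>q1\<close> and
  \<open>q2\<close> serve as bounds.\<close>

lemma Q_finite_between:
  assumes q: "q1 \<in> Q" "q2 \<in> Q"
  shows "finite {c \<in> Q. key q1 \<le> key c \<and> key c \<le> key q2}"
proof -
  have V: "q1 \<in> V" "q2 \<in> V" using q Q_V by auto
  let ?B = "\<lambda>i. {c \<in> Q. ix c = i \<and> key q1 \<le> key c \<and> key c \<le> key q2}"
  have fin: "finite (?B i)" if i: "i \<in> J" for i
  proof (cases "?B i = {}")
    case False
    then obtain c0 where c0: "c0 \<in> Q" "ix c0 = i" "key q1 \<le> key c0" "key c0 \<le> key q2" by blast
    have io: "ix q1 \<le> i" "i \<le> ix q2" using key_less[OF Q_V[OF c0(1)] V(1)] key_less[OF V(2) Q_V[OF c0(1)]] c0 by auto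
    have "\<exists>l\<in>V. cl l = cl (mid i) \<and> (\<forall>c\<in>?B i. pos l \<le> pos c)"
    proof (cases "low i")
      case True
      show ?thesis
      proof (cases "upp i \<and> pout i < pin i")
        case True
        then have e: "ext i \<in> V" "cl (ext i) = cl (mid i)" "pos (ext i) = pout i" 
          using ext_sec[OF i] ext_cl[OF i] by auto
        have "pout i \<le> pos c" if "c \<in> ?B i" for c using QD[of c] that True unfolding insec_def by auto
        then show ?thesis using e by (intro bexI[of _ "ext i"]) auto
      next
        case False
        have e: "ent i \<in> V" "cl (ent i) = cl (mid i)" "pos (ent i) = pin i" 
          using ent_sec[OF i True] ent_cl[OF i True] by auto
        have "pin i \<le> pout i" using False not_upp[OF _ i] e pos01[of "ent i"] by auto
        then have "pin i \<le> pos c" if "c \<in> ?B i" for c using QD[of c] that unfolding insec_def by auto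
        then show ?thesis using e by (intro bexI[of _ "ent i"]) auto
      qed
    next
      case False
      \<comment> \<open>A section without entry has the least index, so it must be the one
        containing \<open>q1\<close>.\<close>
      then have "ix q1 = i" "dir i = 1" using io QD[OF q(1)] not_low[OF False i] unfolding low_def by force+
      moreover have "pos q1 \<le> pos c" if c: "c \<in> ?B i" for c
        using X_less_pos[of c q1] key_less[of c q1] Q_V[of c] V c calculation by force
      ultimately show ?thesis using V hasD[of q1] QD[OF q(1)] by (intro bexI[of _ q1]) auto
    qed
    then obtain l where l: "l \<in> V" "cl l = cl (mid i)" "\<forall>c\<in>?B i. pos l \<le> pos c" by blast
    have "\<exists>l\<in>V. cl l = cl (mid i) \<and> (\<forall>c\<in>?B i. pos c \<le> pos l)"
    proof (cases "upp i")
      case True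
      show ?thesis
      proof (cases "low i \<and> pout i < pin i")
        case True
        then have e: "ent i \<in> V" "cl (ent i) = cl (mid i)" "pos (ent i) = pin i" 
          using ent_sec[OF i] ent_cl[OF i] by auto
        have "pos c \<le> pin i" if "c \<in> ?B i" for c using QD[of c] that True unfolding insec_def by auto
        then show ?thesis using e by (intro bexI[of _ "ent i"]) auto
      next
        case False
        have e: "ext i \<in> V" "cl (ext i) = cl (mid i)" "pos (ext i) = pout i" 
          using ext_sec[OF i True] ext_cl[OF i True] by auto
        have "pin i \<le> pout i" using False not_low[OF _ i] e pos01[of "ext i"] by auto
        then have "pos c \<le> pout i" if "c \<in> ?B i" for c using QD[of c] that unfolding insec_def by auto
        then show ?thesis using e by (intro bexI[of _ "ext i"]) auto
      qed
    next
      case False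
      then have "ix q2 = i" "dir i = 1" using io QD[OF q(2)] not_upp[OF False i] unfolding upp_def by force+
      moreover have "pos c \<le> pos q2" if c: "c \<in> ?B i" for c
        using X_less_pos[of q2 c] key_less[of q2 c] Q_V[of c] V c calculation by force
      ultimately show ?thesis using V hasD[of q2] QD[OF q(2)] by (intro bexI[of _ q2]) auto
    qed
    then obtain h where h: "h \<in> V" "cl h = cl (mid i)" "\<forall>c\<in>?B i. pos c \<le> pos h" by blast
    have "?B i \<subseteq> {z \<in> V. pos l \<le> pos z \<and> pos z \<le> pos h}" using l h Q_V by blast
    moreover have "finite {z \<in> V. pos l \<le> pos z \<and> pos z \<le> pos h}"
      by (rule finite_range_V[OF cl_no_E[OF h(1) l(1)]]) (simp add: l h)
    ultimately show ?thesis by (rule finite_subset)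
  next
    case True
    then show ?thesis by (simp only: finite.emptyI)
  qed
  have "{c \<in> Q. key q1 \<le> key c \<and> key c \<le> key q2} \<subseteq> (\<Union>i\<in>{ix q1..ix q2} \<inter> J. ?B i)"
  proof
    fix c assume "c \<in> {c \<in> Q. key q1 \<le> key c \<and> key c \<le> key q2}"
    then have c: "c \<in> Q" "key q1 \<le> key c" "key c \<le> key q2" by auto
    then have "ix q1 \<le> ix c" "ix c \<le> ix q2" using key_less[OF Q_V[OF c(1)] V(1)] key_less[OF V(2) Q_V[OF c(1)]] by auto
    then show "c \<in> (\<Union>i\<in>{ix q1..ix q2} \<inter> J. ?B i)" using c QD by auto
  qed
  then show ?thesis by (rule finite_subset) (use fin in auto)
qed

end

section \<open>Accumulation of the strands at ends\<close>

context spine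
begin

text \<open>\<open>around\<close> supplies spine vertices arbitrarily close to \<open>e\<close> on
  its right. A consecutive pair is wanted rather than a single vertex, because parity then puts one
  of the two into the desired strand.\<close>

lemma accumulate_right:
  assumes e: "e \<in> E" "e < t" "e < 1" "\<forall>e'\<in>E. \<not> (e < e' \<and> e' < t)"
  shows "\<exists>s u. nxt s u \<and> e < \<tau> s \<and> \<tau> u < t"
proof -
  have s_ex: "\<exists>s\<in>SP. e < \<tau> s \<and> \<tau> s \<le> x" if x: "e < x" "x < t" "x \<le> 1" for x
  proof -
    have "x \<in> {0..1}" "x \<notin> E" using x e E_range[OF e(1)] by auto
    then obtain s s' where s: "s \<in> SP" "\<tau> s \<le> x" "x \<le> \<tau> s'" "\<forall>e\<in>E. \<not> (\<tau> s \<le> e \<and> e \<le> \<tau> s')" using around by blast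
    then have "e < \<tau> s" using e x by force
    then show ?thesis using s by blast
  qed
  define x where "x = min ((e + t) / 2) 1"
  have x: "e < x" "x < t" "x \<le> 1" unfolding x_def using e by (auto simp: min_def)
  obtain s where s: "s \<in> SP" "e < \<tau> s" "\<tau> s \<le> x" using s_ex[OF x] by blast
  obtain s2 where s2: "s2 \<in> SP" "e < \<tau> s2" "\<tau> s2 \<le> (e + \<tau> s) / 2" using s_ex[of "(e + \<tau> s) / 2"] s x by auto
  have "\<tau> s2 < \<tau> s" using s s2 by auto
  moreover have "cl s2 = cl s" by (rule cl_eqI) (use s s2 x e pos_SP in force)
  ultimately obtain u where "nxt s2 u" "\<tau> u \<le> \<tau> s" using succ_ex s s2 by blast
  then show ?thesis using s2 s x by (intro exI[of _ s2] exI[of _ u]) auto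
qed

lemma accumulate_left:
  assumes e: "e \<in> E" "t < e" "0 < e" "\<forall>e'\<in>E. \<not> (t < e' \<and> e' < e)"
  shows "\<exists>s u. nxt s u \<and> t < \<tau> s \<and> \<tau> u < e"
proof -
  have s_ex: "\<exists>s\<in>SP. \<tau> s < e \<and> x \<le> \<tau> s" if x: "x < e" "t < x" "0 \<le> x" for x
  proof -
    have "x \<in> {0..1}" "x \<notin> E" using x e E_range[OF e(1)] by auto
    then obtain s s' where s: "s' \<in> SP" "\<tau> s \<le> x" "x \<le> \<tau> s'" "\<forall>e\<in>E. \<not> (\<tau> s \<le> e \<and> e \<le> \<tau> s')" using around by blast
    then have "\<tau> s' < e" using e x by force
    then show ?thesis using s by blast
  qed
  define x where "x = max ((e + t) / 2) 0"
  have x: "x < e" "t < x" "0 \<le> x" unfolding x_def using e by (auto simp: max_def)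
  obtain s where s: "s \<in> SP" "\<tau> s < e" "x \<le> \<tau> s" using s_ex[OF x] by blast
  obtain s2 where s2: "s2 \<in> SP" "\<tau> s2 < e" "(e + \<tau> s) / 2 \<le> \<tau> s2" using s_ex[of "(e + \<tau> s) / 2"] s x by auto
  have "\<tau> s < \<tau> s2" using s s2 by auto
  moreover have "cl s = cl s2" by (rule cl_eqI) (use s s2 x e pos_SP in force)
  ultimately obtain u where "nxt u s2" "\<tau> s \<le> \<tau> u" using pred_ex s s2 by blast
  then show ?thesis using s2 s x by (intro exI[of _ u] exI[of _ s2]) auto
qed

end

context coloured
begin

text \<open>Outside a section all vertices are in \<open>A\<close>, and inside it consecutive spine
  vertices have different parities.\<close>

lemma nxt_A: "nxt s u \<Longrightarrow> s \<in> A \<or> u \<in> A"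
  using nxt_state(1) A_SP nxtD by blast

text \<open>The first section extends to 0, so it contains the consecutive pairs of spine vertices
  near 0, and one vertex of each pair has the parity of \<open>Q\<close>.\<close>

lemma Q_near_0:
  assumes i: "i \<in> J" "\<not> low i" and E0: "0 \<in> E" and d: "0 < \<delta>"
  shows "\<exists>q\<in>Q. ix q = i \<and> pos q < \<delta>"
proof -
  have c: "cl (mid i) = E \<inter> {0}" "pin i = 0" using not_low i by auto
  have a: "anc i \<in> SP" "cl (anc i) = {0}" "insec (anc i)" "ix (anc i) = i" using anc_sec[OF i(1)] c E0 by auto
  have pa: "0 < pos (anc i)" "pos (anc i) \<le> max (pin i) (pout i)" "pos (anc i) = \<tau> (anc i)"
    using a pos_SP unfolding cl_def insec_def by auto
  define t where "t = min \<delta> (pos (anc i))"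
  have t: "0 < t" "t \<le> \<delta>" "t \<le> pos (anc i)" unfolding t_def using d pa by auto
  have below_t: "e' = 0" if "e' \<in> E" "e' < t" for e'
  proof -
    have "e' \<in> cl (anc i)" unfolding cl_def using that t by auto
    then show ?thesis using a(2) by simp
  qed
  then have "\<forall>e'\<in>E. \<not> (0 < e' \<and> e' < t)" by auto
  then obtain s u where n: "nxt s u" "0 < \<tau> s" "\<tau> u < t" using accumulate_right[OF E0 t(1)] by auto
  have S: "s \<in> SP" "u \<in> SP" "\<tau> s < \<tau> u" using nxtD[OF n(1)] by auto
  have "insec x \<and> ix x = i" if x: "x \<in> SP" "0 < \<tau> x" "\<tau> x < t" for x
  proof -
    have "cl x = {0}" unfolding cl_def pos_SP[OF x(1)] using below_t E0 x by auto
    then have "ix x = i \<and> has x" using ix_eq[OF i(1)] c E0 by auto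
    then show ?thesis using x t c pa pos_SP[OF x(1)] unfolding insec_def by auto
  qed
  then have "insec s" "insec u" "ix s = i" "ix u = i" using S n by auto
  moreover then have "s \<in> Q \<or> u \<in> Q" using nxt_state(1)[OF n(1)] Q_SP S by blast
  moreover have "pos s < \<delta>" "pos u < \<delta>" using S n t pos_SP[OF S(1)] pos_SP[OF S(2)] by auto
  ultimately show ?thesis by blast
qed

lemma Q_near_1:
  assumes i: "i \<in> J" "\<not> upp i" and E1: "1 \<in> E" and d: "0 < \<delta>"
  shows "\<exists>q\<in>Q. ix q = i \<and> 1 - \<delta> < pos q"
proof -
  have c: "cl (mid i) = E - {1}" "pout i = 1" using not_upp i by auto
  have a: "anc i \<in> SP" "cl (anc i) = E - {1}" "insec (anc i)" "ix (anc i) = i" using anc_sec[OF i(1)] c by auto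
  have V: "anc i \<in> V" using a SP_V by blast
  have "pos (anc i) \<noteq> 1" using pos_E[OF V] E1 by metis
  then have pa: "pos (anc i) < 1" "min (pin i) (pout i) \<le> pos (anc i)" "pos (anc i) = \<tau> (anc i)"
    using a pos01[OF V] pos_SP unfolding insec_def by auto
  define t where "t = max (1 - \<delta>) (pos (anc i))"
  have t: "t < 1" "1 - \<delta> \<le> t" "pos (anc i) \<le> t" unfolding t_def using d pa by auto
  have "\<forall>e'\<in>E. \<not> (t < e' \<and> e' < 1)"
  proof (intro ballI notI)
    fix e' assume e': "e' \<in> E" "t < e' \<and> e' < 1"
    then have "e' \<in> cl (anc i)" using a by simp
    then show False using e' t unfolding cl_def by auto
  qed
  then obtain s u where n: "nxt s u" "t < \<tau> s" "\<tau> u < 1" using accumulate_left[OF E1 t(1)] by auto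
  have S: "s \<in> SP" "u \<in> SP" "\<tau> s < \<tau> u" using nxtD[OF n(1)] by auto
  have "insec x \<and> ix x = i" if x: "x \<in> SP" "t < \<tau> x" "\<tau> x < 1" for x
  proof -
    have "cl x = E - {1}"
    proof
      show "cl x \<subseteq> E - {1}" unfolding cl_def using x pos_SP[OF x(1)] by auto
      show "E - {1} \<subseteq> cl x"
      proof
        fix e assume e: "e \<in> E - {1}"
        then have "e \<in> cl (anc i)" using a by simp
        then show "e \<in> cl x" unfolding cl_def using x t pos_SP[OF x(1)] by auto
      qed
    qed
    then have "ix x = i \<and> has x" using ix_eq[OF i(1)] c by auto
    then show ?thesis using x t c pa pos_SP[OF x(1)] unfolding insec_def by auto
  qed
  then have "insec s" "insec u" "ix s = i" "ix u = i" using S n by auto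
  moreover then have "s \<in> Q \<or> u \<in> Q" using nxt_state(1)[OF n(1)] Q_SP S by blast
  moreover have "1 - \<delta> < pos s" "1 - \<delta> < pos u" using S n t pos_SP[OF S(1)] pos_SP[OF S(2)] by auto
  ultimately show ?thesis by blast
qed

lemma key_less_pos: 
  assumes "a \<in> V" "b \<in> V" "ix a = ix b" "dir (ix a) = 1"
  shows "pos a < pos b \<Longrightarrow> key a < key b" "key a < key b \<Longrightarrow> pos a \<le> pos b"
  using key_less[OF assms(1,2)] X_less_pos[OF assms(1,2)] X_less_pos[OF assms(2,1)] assms by force+

text \<open>Either the indices of the sections are unbounded below, and the sections converge to 0
  by \<open>below\<close>, or there is a first section, which itself accumulates at 0.\<close>

lemma Q_below:
  assumes E0: "0 \<in> E"
  shows "\<forall>q\<in>Q. \<exists>q'\<in>Q. key q' < key q" "\<forall>\<delta>>0. \<exists>q'\<in>Q. \<forall>q\<in>Q. key q < key q' \<longrightarrow> pos q < \<delta>"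
proof -
  have "(\<forall>q\<in>Q. \<exists>q'\<in>Q. key q' < key q) \<and> (\<forall>\<delta>>0. \<exists>q'\<in>Q. \<forall>q\<in>Q. key q < key q' \<longrightarrow> pos q < \<delta>)"
  proof (cases "\<forall>i\<in>J. low i")
    case True
    have "\<exists>q'\<in>Q. key q' < key q" if q: "q \<in> Q" for q
    proof -
      obtain j where j: "j \<in> J" "j < ix q" using True QD[OF q] unfolding low_def by blast
      then show ?thesis using anc_sec[OF j(1)] key_less[of "anc j" q] Q_V q by (intro bexI[of _ "anc j"]) auto
    qed
    moreover have "\<exists>q'\<in>Q. \<forall>q\<in>Q. key q < key q' \<longrightarrow> pos q < \<delta>" if d: "\<delta> > 0" for \<delta>
    proof -
      have unb: "\<forall>i\<in>J. \<exists>j\<in>J. j < i" using True unfolding low_def by blast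
      then obtain N where N: "\<forall>i\<in>J. i < N \<longrightarrow> pos (ent i) < \<delta> \<and> pos (ext i) < \<delta>" using below d by blast
      obtain j0 where j0: "j0 \<in> J" using J_ne by blast
      obtain j where j: "j \<in> J" "j < min N j0" using int_no_min[OF J_ne unb] by blast
      have "pos q < \<delta>" if q: "q \<in> Q" "key q < key (anc j)" for q
      proof -
        have "ix q \<le> j" using key_less[of q "anc j"] q anc_sec[OF j(1)] Q_V by auto
        then have i: "ix q \<in> J" "ix q < N" "low (ix q)" "upp (ix q)" using QD[OF q(1)] j j0 True unfolding upp_def by (auto intro!: bexI[of _ j0])
        then show ?thesis using N QD[OF q(1)] ent_sec[OF i(1,3)] ext_sec[OF i(1,4)] unfolding insec_def by auto
      qed
      then show ?thesis using anc_sec[OF j(1)] by (intro bexI[of _ "anc j"]) auto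
    qed
    ultimately show ?thesis by blast
  next
    case False
    then obtain i where i: "i \<in> J" "\<not> low i" by blast
    have d1: "dir i = 1" using not_low i by blast
    have ge: "i \<le> ix q" if "q \<in> Q" for q using QD[OF that] i(2) unfolding low_def by force
    have "\<exists>q'\<in>Q. key q' < key q" if q: "q \<in> Q" for q
    proof (cases "ix q = i")
      case True
      have "pos q \<noteq> 0" using pos_E[OF Q_V[OF q]] E0 by metis
      then have "0 < pos q" using pos01[OF Q_V[OF q]] by auto
      then obtain q' where "q' \<in> Q" "ix q' = i" "pos q' < pos q" using Q_near_0[OF i E0] by blast
      then show ?thesis using key_less_pos(1)[of q' q] Q_V q True d1 by auto
    next
      case False
      then show ?thesis using anc_sec[OF i(1)] key_less[of "anc i" q] Q_V q ge[OF q] by (intro bexI[of _ "anc i"]) auto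
    qed
    moreover have "\<exists>q'\<in>Q. \<forall>q\<in>Q. key q < key q' \<longrightarrow> pos q < \<delta>" if d: "\<delta> > 0" for \<delta>
    proof -
      obtain q' where q': "q' \<in> Q" "ix q' = i" "pos q' < \<delta>" using Q_near_0[OF i E0 d] by blast
      have "pos q < \<delta>" if q: "q \<in> Q" "key q < key q'" for q
      proof -
        have "ix q = i" using key_less[of q q'] q q' Q_V ge[OF q(1)] by auto
        then show ?thesis using key_less_pos(2)[of q q'] q q' Q_V d1 by auto
      qed
      then show ?thesis using q' by blast
    qed
    ultimately show ?thesis by blast
  qed
  then show "\<forall>q\<in>Q. \<exists>q'\<in>Q. key q' < key q" "\<forall>\<delta>>0. \<exists>q'\<in>Q. \<forall>q\<in>Q. key q < key q' \<longrightarrow> pos q < \<delta>" by blast+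
qed

lemma Q_above:
  assumes E1: "1 \<in> E"
  shows "\<forall>q\<in>Q. \<exists>q'\<in>Q. key q < key q'" "\<forall>\<delta>>0. \<exists>q'\<in>Q. \<forall>q\<in>Q. key q' < key q \<longrightarrow> 1 - \<delta> < pos q"
proof -
  have "(\<forall>q\<in>Q. \<exists>q'\<in>Q. key q < key q') \<and> (\<forall>\<delta>>0. \<exists>q'\<in>Q. \<forall>q\<in>Q. key q' < key q \<longrightarrow> 1 - \<delta> < pos q)"
  proof (cases "\<forall>i\<in>J. upp i")
    case True
    have "\<exists>q'\<in>Q. key q < key q'" if q: "q \<in> Q" for q
    proof -
      obtain j where j: "j \<in> J" "ix q < j" using True QD[OF q] unfolding upp_def by blast
      then show ?thesis using anc_sec[OF j(1)] key_less[of q "anc j"] Q_V q by (intro bexI[of _ "anc j"]) auto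
    qed
    moreover have "\<exists>q'\<in>Q. \<forall>q\<in>Q. key q' < key q \<longrightarrow> 1 - \<delta> < pos q" if d: "\<delta> > 0" for \<delta>
    proof -
      have unb: "\<forall>i\<in>J. \<exists>j\<in>J. i < j" using True unfolding upp_def by blast
      then obtain N where N: "\<forall>i\<in>J. N < i \<longrightarrow> 1 - \<delta> < pos (ent i) \<and> 1 - \<delta> < pos (ext i)" using above d by blast
      obtain j0 where j0: "j0 \<in> J" using J_ne by blast
      have "\<exists>j\<in>uminus ` J. j < - max N j0" using int_no_min[of "uminus ` J" "- max N j0"] J_ne unb by force
      then obtain j where j: "j \<in> J" "max N j0 < j" by force
      have "1 - \<delta> < pos q" if q: "q \<in> Q" "key (anc j) < key q" for q
      proof -
        have "j \<le> ix q" using key_less[of "anc j" q] q anc_sec[OF j(1)] Q_V by auto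
        then have i: "ix q \<in> J" "N < ix q" "upp (ix q)" "low (ix q)" using QD[OF q(1)] j j0 True unfolding low_def by (auto intro!: bexI[of _ j0])
        then show ?thesis using N QD[OF q(1)] ent_sec[OF i(1,4)] ext_sec[OF i(1,3)] unfolding insec_def by auto
      qed
      then show ?thesis using anc_sec[OF j(1)] by (intro bexI[of _ "anc j"]) auto
    qed
    ultimately show ?thesis by blast
  next
    case False
    then obtain i where i: "i \<in> J" "\<not> upp i" by blast
    have d1: "dir i = 1" using not_upp i by blast
    have le: "ix q \<le> i" if "q \<in> Q" for q using QD[OF that] i(2) unfolding upp_def by force
    have "\<exists>q'\<in>Q. key q < key q'" if q: "q \<in> Q" for q
    proof (cases "ix q = i")
      case True
      have "pos q \<noteq> 1" using pos_E[OF Q_V[OF q]] E1 by metis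
      then have "0 < 1 - pos q" using pos01[OF Q_V[OF q]] by auto
      then obtain q' where "q' \<in> Q" "ix q' = i" "1 - (1 - pos q) < pos q'" using Q_near_1[OF i E1] by blast
      then show ?thesis using key_less_pos(1)[of q q'] Q_V q True d1 by auto
    next
      case False
      then show ?thesis using anc_sec[OF i(1)] key_less[of q "anc i"] Q_V q le[OF q] by (intro bexI[of _ "anc i"]) auto
    qed
    moreover have "\<exists>q'\<in>Q. \<forall>q\<in>Q. key q' < key q \<longrightarrow> 1 - \<delta> < pos q" if d: "\<delta> > 0" for \<delta>
    proof -
      obtain q' where q': "q' \<in> Q" "ix q' = i" "1 - \<delta> < pos q'" using Q_near_1[OF i E1 d] by blast
      have "1 - \<delta> < pos q" if q: "q \<in> Q" "key q' < key q" for q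
      proof -
        have "ix q = i" using key_less[of q' q] q q' Q_V le[OF q(1)] by auto
        then show ?thesis using key_less_pos(2)[of q' q] q q' Q_V d1 by auto
      qed
      then show ?thesis using q' by blast
    qed
    ultimately show ?thesis by blast
  qed
  then show "\<forall>q\<in>Q. \<exists>q'\<in>Q. key q < key q'" "\<forall>\<delta>>0. \<exists>q'\<in>Q. \<forall>q\<in>Q. key q' < key q \<longrightarrow> 1 - \<delta> < pos q" by blast+
qed

section \<open>Joining the two strands at 0 and at 1\<close>

lemma X_le_block: "z \<in> V \<Longrightarrow> z' \<in> V \<Longrightarrow> sp z \<noteq> sp z' \<Longrightarrow> pos z \<le> pos z' \<Longrightarrow> X z < X z'"
  using X_less_pos[of z z'] pos_eq_sp[of z z'] by force

lemma X_mono_rho: "z \<in> V \<Longrightarrow> z' \<in> V \<Longrightarrow> sp z = sp z' \<Longrightarrow> rho z \<le> rho z' \<Longrightarrow> X z \<le> X z'"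
  using X_less_rho[of z' z] by force

lemma key_mono_X: "a \<in> V \<Longrightarrow> b \<in> V \<Longrightarrow> ix a = ix b \<Longrightarrow> dir (ix a) = 1 \<Longrightarrow> X a \<le> X b \<Longrightarrow> key a \<le> key b"
  using key_less[of b a] by force

text \<open>Position 0 is occupied by a spine vertex \<open>x\<close>, and \<open>x\<close> is the
  first vertex of one strand. The other strand starts with a leaf hanging from \<open>x\<close> or,
  if it takes none of them, with the next spine vertex \<open>u\<close>.\<close>

lemma join_0:
  assumes E0: "0 \<notin> E"
  shows "\<exists>a\<in>A. \<exists>q\<in>Q. adj2 a q \<and> (\<forall>c\<in>A. X a \<le> X c) \<and> (\<forall>c\<in>Q. key q \<le> key c)"
proof -
  obtain i where i: "i \<in> J" "\<not> low i" using below E0 unfolding low_def by blast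
  have ii: "cl (mid i) = {}" "pin i = 0" "dir i = 1" using not_low[OF i(2,1)] E0 by auto
  obtain x where x: "x \<in> SP" "\<tau> x = 0" using around[of 0] E0 tau01 by force
  have xc: "cl x = {}" unfolding cl_def using E_range pos_SP[OF x(1)] x by force
  have xi: "ix x = i" "has x" using ix_eq[OF i(1), of x] ii xc by auto
  have xs: "insec x" unfolding insec_def using xi ii pos_SP[OF x(1)] x by auto
  have xV: "x \<in> V" "sp x = x" using x SP_V sp_id by auto
  obtain d where d: "d > 0" "\<forall>e\<in>E. d \<le> dist 0 e" using separate_point_closed[OF E_closed E0] by blast
  \<comment> \<open>No end lies at or to the left of \<open>t\<close>, so the spine vertex found
    close to \<open>t\<close> is in the gap of \<open>x\<close> and shows that \<open>x\<close> has
    a successor.\<close>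
  define t where "t = min (d/2) 1"
  have t: "0 < t" "t < d" "t \<le> 1" unfolding t_def using d by auto
  have tE: "\<not> e \<le> t" if "e \<in> E" for e
  proof -
    have "d \<le> \<bar>0 - e\<bar>" using d(2) that by (auto simp: dist_real_def)
    then show ?thesis using t E_range[OF that] by auto
  qed
  obtain s s' where s: "s' \<in> SP" "\<tau> s \<le> t" "t \<le> \<tau> s'" "\<forall>e\<in>E. \<not> (\<tau> s \<le> e \<and> e \<le> \<tau> s')" using around[of t] t tE by auto
  have "cl s' = {}" unfolding cl_def using s tE pos_SP[OF s(1)] by force
  then obtain u where u: "nxt x u" using succ_ex[OF x(1) s(1)] xc x s t by auto
  have uS: "u \<in> SP" "u \<in> V" "\<tau> x < \<tau> u" "cl u = {}" "sp u = u" using nxtD[OF u] xc SP_V sp_id by auto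
  have ui: "ix u = i" "has u" using ix_eq[OF i(1), of u] ii uS by auto
  have ge: "X y < X z" if "z \<in> V" "sp z \<noteq> x" "y \<in> V" "sp y = x" for y z
    using X_le_block[of y z] pos01[of z] that x unfolding pos_def by auto
  have geu: "X y < X z" if z: "z \<in> V" "sp z \<noteq> x" "sp z \<noteq> u" "y \<in> V" "sp y = u" for y z
  proof -
    have "\<tau> x \<noteq> \<tau> (sp z)" using z inj_onD[OF tau_inj _ x(1) sp_SP[OF z(1)]] by auto
    then have "\<tau> u \<le> \<tau> (sp z)" using nxt_after[OF u sp_SP[OF z(1)]] tau01[OF sp_SP[OF z(1)]] x by auto
    then show ?thesis using X_le_block[of y z] z unfolding pos_def by auto
  qed
  have ixq: "i \<le> ix c" if "c \<in> Q" for c using QD[OF that] i(2) unfolding low_def by force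
  have keyI: "key q \<le> key c" if "q \<in> Q" "ix q = i" "c \<in> Q" "ix c = i \<Longrightarrow> X q \<le> X c" for q c
    using that ixq[OF that(3)] key_mono_X[of q c] key_less[of q c] Q_V ii by (cases "ix c = i") force+
  \<comment> \<open>The first section has no entry, hence no entry leaf that would precede
    \<open>x\<close> in \<open>Q\<close>.\<close>
  have noent: "\<not> entleaf c" if "ix c = i" for c using that i unfolding entleaf_def by auto
  have min_ex: "\<exists>m\<in>W. \<forall>w\<in>W. X m \<le> X w" if "W \<subseteq> {z \<in> V. sp z = x}" "W \<noteq> {}" for W
    using finite_arg_min[OF finite_subset[OF that(1) fin_block[OF x(1)]] that(2)] .
  show ?thesis
  proof (cases "ev x")
    case True
    have xQ: "x \<in> Q" using Q_SP x xs True by blast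
    have qmin: "key x \<le> key c" if c: "c \<in> Q" for c
    proof (rule keyI[OF xQ xi(1) c])
      assume ic: "ix c = i"
      show "X x \<le> X c"
      proof (cases "sp c = x")
        case True
        then have "ev c" using \<open>ev x\<close> ev_sp[OF Q_V[OF c]] by simp
        then have "c = x" using Q_cases[OF c noent[OF ic]] True sp_id by auto
        then show ?thesis by simp
      next
        case False then show ?thesis using ge[of c x] Q_V c xV by force
      qed
    qed
    show ?thesis
    proof (cases "{z \<in> A. sp z = x} = {}")
      case False
      then obtain a where a: "a \<in> A" "sp a = x" "\<forall>w\<in>{z \<in> A. sp z = x}. X a \<le> X w" using min_ex[of "{z \<in> A. sp z = x}"] A_V by blast
      have "X a \<le> X c" if "c \<in> A" for c using a that ge[of c a] A_V by (cases "sp c = x") force+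
      moreover have "a \<noteq> x" using xQ a AQ by auto
      ultimately show ?thesis using a xQ qmin block_adj2[of a x] A_V xV by (intro bexI[of _ a] bexI[of _ x]) auto
    next
      case nA: True
      have uA: "u \<in> A" using A_SP[OF uS(1)] nxt_state(1)[OF u xs] True by blast
      have "X u \<le> X c" if c: "c \<in> A" for c
      proof (cases "sp c = u")
        case True
        show ?thesis
        proof (cases "c \<in> SP")
          case True then show ?thesis using \<open>sp c = u\<close> sp_id by auto
        next
          case False
          have "\<not> insec u" using A_leaf[OF c False] True nxt_state(1)[OF u xs] \<open>ev x\<close> by auto
          moreover have "\<not> lft u" using nxt_state(2)[OF u] xs unfolding insec_def lft_def by force
          ultimately have "0 < rho c" using rho_right[OF False] insec_sp[of c] lft_sp[of c] A_V c True by auto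
          then show ?thesis using X_mono_rho[of u c] uS A_V c True by auto
        qed
      next
        case False
        moreover have "sp c \<noteq> x" using nA c by auto
        ultimately show ?thesis using geu[of c u] A_V c uS by force
      qed
      moreover have "adj2 u x" using nxt_adj[OF u] adj_sym unfolding adj2_def by blast
      ultimately show ?thesis using uA xQ qmin by blast
    qed
  next
    case ox: False
    have xA: "x \<in> A" using A_SP x ox by blast
    have amin: "X x \<le> X c" if c: "c \<in> A" for c
    proof (cases "sp c = x")
      case True
      then have "c \<in> SP" using A_leaf[OF c] xs ox by auto
      then show ?thesis using True sp_id by auto
    next
      case False then show ?thesis using ge[of c x] A_V c xV by force
    qed
    show ?thesis
    proof (cases "{z \<in> Q. sp z = x} = {}")
      case False
      then obtain q where q: "q \<in> Q" "sp q = x" "\<forall>w\<in>{z \<in> Q. sp z = x}. X q \<le> X w" using min_ex[of "{z \<in> Q. sp z = x}"] Q_V by blast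
      have iq: "ix q = i" using has_sp[OF Q_V[OF q(1)]] q xi by simp
      have "key q \<le> key c" if c: "c \<in> Q" for c
      proof (rule keyI[OF q(1) iq c])
        show "X q \<le> X c" using q c ge[of c q] Q_V by (cases "sp c = x") force+
      qed
      moreover have "q \<noteq> x" using xA q AQ by auto
      ultimately show ?thesis using q xA amin block_adj2[of x q] Q_V xV by (intro bexI[of _ x] bexI[of _ q]) auto
    next
      case nQ: True
      \<comment> \<open>The anchor differs from \<open>x\<close> in parity, so the section reaches
        at least as far as \<open>u\<close>.\<close>
      have an: "anc i \<in> SP" "cl (anc i) = {}" "insec (anc i)" "ix (anc i) = i" "ev (anc i)" using anc_sec[OF i(1)] ii by auto
      have "anc i \<noteq> x" using an ox by auto
      then have "\<tau> x \<noteq> \<tau> (anc i)" using inj_onD[OF tau_inj _ x(1) an(1)] by auto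
      then have "\<tau> u \<le> \<tau> (anc i)" using nxt_after[OF u an(1)] tau01[OF an(1)] x by auto
      then have iu: "insec u" using an(3,4) ui ii uS x pos_SP[OF an(1)] pos_SP[OF uS(1)] unfolding insec_def by auto
      then have eu: "ev u" using nxt_state(1)[OF u xs iu] ox by blast
      have uQ: "u \<in> Q" using Q_SP uS iu eu by blast
      have "key u \<le> key c" if c: "c \<in> Q" for c
      proof (rule keyI[OF uQ ui(1) c])
        assume ic: "ix c = i"
        show "X u \<le> X c"
        proof (cases "sp c = u")
          case True
          then have "ev c" using eu ev_sp[OF Q_V[OF c]] by simp
          then have "c = u" using Q_cases[OF c noent[OF ic]] True sp_id by auto
          then show ?thesis by simp
        next
          case False
          moreover have "sp c \<noteq> x" using nQ c by auto
          ultimately show ?thesis using geu[of c u] Q_V c uS by force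
        qed
      qed
      moreover have "adj2 x u" using nxt_adj[OF u] unfolding adj2_def by blast
      ultimately show ?thesis using uQ xA amin by blast
    qed
  qed
qed

text \<open>The mirror image of \<open>join_0\<close>, except that the last section may have an
  entry leaf. As this section is traversed to the right, the leaf comes before its spine vertex, so
  it is never the last vertex of \<open>Q\<close>.\<close>

lemma join_1:
  assumes E1: "1 \<notin> E"
  shows "\<exists>a\<in>A. \<exists>q\<in>Q. adj2 a q \<and> (\<forall>c\<in>A. X c \<le> X a) \<and> (\<forall>c\<in>Q. key c \<le> key q)"
proof -
  obtain i where i: "i \<in> J" "\<not> upp i" using above E1 unfolding upp_def by blast
  have ii: "cl (mid i) = E" "pout i = 1" "dir i = 1" using not_upp[OF i(2,1)] E1 by auto
  obtain x where x: "x \<in> SP" "\<tau> x = 1" using around[of 1] E1 tau01 by force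
  have less1: "e < 1" if "e \<in> E" for e using E_range[OF that] E1 that by (cases "e = 1") auto
  have xc: "cl x = E" unfolding cl_def using less1 pos_SP[OF x(1)] x by force
  have xi: "ix x = i" "has x" using ix_eq[OF i(1), of x] ii xc by auto
  have xs: "insec x" unfolding insec_def using xi ii pos_SP[OF x(1)] x
    ent_sec[OF i(1)] pos01[of "ent i"] unfolding pin_def by auto
  have xV: "x \<in> V" "sp x = x" using x SP_V sp_id by auto
  obtain d where d: "d > 0" "\<forall>e\<in>E. d \<le> dist 1 e" using separate_point_closed[OF E_closed E1] by blast
  define t where "t = max (1 - d/2) 0"
  have t: "t < 1" "1 - d < t" "0 \<le> t" unfolding t_def using d by auto
  have tE: "\<not> t \<le> e" if "e \<in> E" for e
  proof -
    have "d \<le> \<bar>1 - e\<bar>" using d(2) that by (auto simp: dist_real_def)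
    then show ?thesis using t E_range[OF that] by auto
  qed
  obtain s s' where s: "s \<in> SP" "\<tau> s \<le> t" "t \<le> \<tau> s'" "\<forall>e\<in>E. \<not> (\<tau> s \<le> e \<and> e \<le> \<tau> s')" using around[of t] t tE by auto
  have "e < \<tau> s" if "e \<in> E" for e using s(4) tE[OF that] that s by force
  then have "cl s = E" unfolding cl_def using pos_SP[OF s(1)] by auto
  then obtain u where u: "nxt u x" using pred_ex[OF s(1) x(1)] xc x s t by auto
  have uS: "u \<in> SP" "u \<in> V" "\<tau> u < \<tau> x" "cl u = E" "sp u = u" using nxtD[OF u] xc SP_V sp_id by auto
  have ui: "ix u = i" "has u" using ix_eq[OF i(1), of u] ii uS by auto
  have ge: "X z < X y" if "z \<in> V" "sp z \<noteq> x" "y \<in> V" "sp y = x" for y z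
    using X_le_block[of z y] pos01[of z] that x unfolding pos_def by auto
  have geu: "X z < X y" if z: "z \<in> V" "sp z \<noteq> x" "sp z \<noteq> u" "y \<in> V" "sp y = u" for y z
  proof -
    have "\<tau> x \<noteq> \<tau> (sp z)" using z inj_onD[OF tau_inj _ x(1) sp_SP[OF z(1)]] by auto
    then have "\<tau> (sp z) \<le> \<tau> u" using nxt_before[OF u sp_SP[OF z(1)]] tau01[OF sp_SP[OF z(1)]] x by auto
    then show ?thesis using X_le_block[of z y] z unfolding pos_def by auto
  qed
  have ixq: "ix c \<le> i" if "c \<in> Q" for c using QD[OF that] i(2) unfolding upp_def by force
  have keyI: "key c \<le> key q" if "q \<in> Q" "ix q = i" "c \<in> Q" "ix c = i \<Longrightarrow> X c \<le> X q" for q c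
    using that ixq[OF that(3)] key_mono_X[of c q] key_less[of c q] Q_V ii by (cases "ix c = i") force+
  have entr: "rho c < 0" if "ix c = i" "entleaf c" for c using rho_ent[OF that(2)] that(1) ii by simp
  have max_ex: "\<exists>m\<in>W. \<forall>w\<in>W. X w \<le> X m" if "W \<subseteq> {z \<in> V. sp z = x}" "W \<noteq> {}" for W
    using finite_arg_max[OF finite_subset[OF that(1) fin_block[OF x(1)]] that(2)] .
  have spq: "X c \<le> X y" if y: "y \<in> SP" "ev y" "c \<in> Q" "ix c = i" "sp c = y" for c y
  proof (cases "entleaf c")
    case True
    then show ?thesis using entr[OF y(4) True] X_mono_rho[of c y] y SP_V sp_id Q_V by auto
  next
    case False
    have "ev c" using y ev_sp[OF Q_V[OF y(3)]] by simp
    then have "c = y" using Q_cases[OF y(3) False] y sp_id by auto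
    then show ?thesis by simp
  qed
  show ?thesis
  proof (cases "ev x")
    case True
    have xQ: "x \<in> Q" using Q_SP x xs True by blast
    have qmax: "key c \<le> key x" if c: "c \<in> Q" for c
    proof (rule keyI[OF xQ xi(1) c])
      assume ic: "ix c = i"
      show "X c \<le> X x"
      proof (cases "sp c = x")
        case True then show ?thesis using spq[OF x(1) \<open>ev x\<close> c ic] by simp
      next
        case False then show ?thesis using ge[of c x] Q_V c xV by force
      qed
    qed
    show ?thesis
    proof (cases "{z \<in> A. sp z = x} = {}")
      case False
      then obtain a where a: "a \<in> A" "sp a = x" "\<forall>w\<in>{z \<in> A. sp z = x}. X w \<le> X a" using max_ex[of "{z \<in> A. sp z = x}"] A_V by blast
      have "X c \<le> X a" if "c \<in> A" for c using a that ge[of c a] A_V by (cases "sp c = x") force+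
      moreover have "a \<noteq> x" using xQ a AQ by auto
      ultimately show ?thesis using a xQ qmax block_adj2[of a x] A_V xV by (intro bexI[of _ a] bexI[of _ x]) auto
    next
      case nA: True
      have uA: "u \<in> A" using A_SP[OF uS(1)] nxt_state(1)[OF u _ xs] True by blast
      have "X c \<le> X u" if c: "c \<in> A" for c
      proof (cases "sp c = u")
        case True
        show ?thesis
        proof (cases "c \<in> SP")
          case True then show ?thesis using \<open>sp c = u\<close> sp_id by auto
        next
          case False
          have "\<not> insec u" using A_leaf[OF c False] True nxt_state(1)[OF u _ xs] \<open>ev x\<close> by auto
          then have "lft u" using nxt_state(3)[OF u xs] by blast
          then have "rho c < 0" using rho_lft[OF False] lft_sp[of c] A_V c True by auto
          then show ?thesis using X_mono_rho[of c u] uS A_V c True by auto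
        qed
      next
        case False
        moreover have "sp c \<noteq> x" using nA c by auto
        ultimately show ?thesis using geu[of c u] A_V c uS by force
      qed
      moreover have "adj2 u x" using nxt_adj[OF u] unfolding adj2_def by blast
      ultimately show ?thesis using uA xQ qmax by blast
    qed
  next
    case ox: False
    have xA: "x \<in> A" using A_SP x ox by blast
    have amax: "X c \<le> X x" if c: "c \<in> A" for c
    proof (cases "sp c = x")
      case True
      then have "c \<in> SP" using A_leaf[OF c] xs ox by auto
      then show ?thesis using True sp_id by auto
    next
      case False then show ?thesis using ge[of c x] A_V c xV by force
    qed
    show ?thesis
    proof (cases "{z \<in> Q. sp z = x} = {}")
      case False
      then obtain q where q: "q \<in> Q" "sp q = x" "\<forall>w\<in>{z \<in> Q. sp z = x}. X w \<le> X q" using max_ex[of "{z \<in> Q. sp z = x}"] Q_V by blast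
      have iq: "ix q = i" using has_sp[OF Q_V[OF q(1)]] q xi by simp
      have "key c \<le> key q" if c: "c \<in> Q" for c
      proof (rule keyI[OF q(1) iq c])
        show "X c \<le> X q" using q c ge[of c q] Q_V by (cases "sp c = x") force+
      qed
      moreover have "q \<noteq> x" using xA q AQ by auto
      ultimately show ?thesis using q xA amax block_adj2[of x q] Q_V xV by (intro bexI[of _ x] bexI[of _ q]) auto
    next
      case nQ: True
      have an: "anc i \<in> SP" "insec (anc i)" "ix (anc i) = i" "ev (anc i)" using anc_sec[OF i(1)] by auto
      have "anc i \<noteq> x" using an ox by auto
      then have "\<tau> x \<noteq> \<tau> (anc i)" using inj_onD[OF tau_inj _ x(1) an(1)] by auto
      then have "\<tau> (anc i) \<le> \<tau> u" using nxt_before[OF u an(1)] tau01[OF an(1)] x by auto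
      then have iu: "insec u" using an(2,3) ui ii uS x pos_SP[OF an(1)] pos_SP[OF uS(1)] unfolding insec_def by auto
      then have eu: "ev u" using nxt_state(1)[OF u iu xs] ox by blast
      have uQ: "u \<in> Q" using Q_SP uS iu eu by blast
      have "key c \<le> key u" if c: "c \<in> Q" for c
      proof (rule keyI[OF uQ ui(1) c])
        assume ic: "ix c = i"
        show "X c \<le> X u"
        proof (cases "sp c = u")
          case True then show ?thesis using spq[OF uS(1) eu c ic] by simp
        next
          case False
          moreover have "sp c \<noteq> x" using nQ c by auto
          ultimately show ?thesis using geu[of c u] Q_V c uS by force
        qed
      qed
      moreover have "adj2 x u" using nxt_adj[OF u] adj_sym unfolding adj2_def by blast
      ultimately show ?thesis using uQ xA amax by blast
    qed
  qed
qed

end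

text \<open>All that is needed for closing up, with route and parities forgotten. \<open>A\<close>
  is placed by \<open>X\<close>, and each end is approached by \<open>A\<close> or by further ends;
  \<open>Q\<close> is indexed by integers and can accumulate only at the ends at 0 and 1.\<close>

locale stranded = spine +
  fixes A Q :: "'a set" and X :: "'a \<Rightarrow> real" and \<nu> :: "'a \<Rightarrow> int"
  assumes AQ: "A \<union> Q = V" "A \<inter> Q = {}"
    and X_inj: "inj_on X V"
    and X_range: "z \<in> V \<Longrightarrow> - (1/4) \<le> X z \<and> X z \<le> 5/4"
    and X_E: "z \<in> V \<Longrightarrow> e \<in> E \<Longrightarrow> 3 * \<bar>X z - pos z\<bar> \<le> \<bar>pos z - e\<bar>"
    and X_discrete: "t \<notin> E \<Longrightarrow> \<exists>\<epsilon>>0. finite {z \<in> V. \<bar>X z - t\<bar> < \<epsilon>}"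
    and A_consec: "a \<in> A \<Longrightarrow> b \<in> A \<Longrightarrow> X a < X b \<Longrightarrow> \<forall>c\<in>A. \<not> (X a < X c \<and> X c < X b) \<Longrightarrow>
      \<forall>e\<in>E. \<not> (X a < e \<and> e < X b) \<Longrightarrow> adj2 a b"
    and A_right: "e \<in> E \<Longrightarrow> e < t \<Longrightarrow> e < 1 \<Longrightarrow> (\<exists>a\<in>A. e < X a \<and> X a < t) \<or> (\<exists>e'\<in>E. e < e' \<and> e' < t)"
    and A_left: "e \<in> E \<Longrightarrow> t < e \<Longrightarrow> 0 < e \<Longrightarrow> (\<exists>a\<in>A. t < X a \<and> X a < e) \<or> (\<exists>e'\<in>E. t < e' \<and> e' < e)"
    and nu_inj: "inj_on \<nu> Q"
    and Q_consec: "a \<in> Q \<Longrightarrow> b \<in> Q \<Longrightarrow> \<nu> a < \<nu> b \<Longrightarrow> \<forall>c\<in>Q. \<not> (\<nu> a < \<nu> c \<and> \<nu> c < \<nu> b) \<Longrightarrow> adj2 a b"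
    and Q_ne: "Q \<noteq> {}"
    and Q_below: "0 \<in> E \<Longrightarrow> (\<forall>q\<in>Q. \<exists>q'\<in>Q. \<nu> q' < \<nu> q) \<and> (\<forall>\<delta>>0. \<exists>N. \<forall>q\<in>Q. \<nu> q < N \<longrightarrow> pos q < \<delta>)"
    and Q_above: "1 \<in> E \<Longrightarrow> (\<forall>q\<in>Q. \<exists>q'\<in>Q. \<nu> q < \<nu> q') \<and> (\<forall>\<delta>>0. \<exists>N. \<forall>q\<in>Q. N < \<nu> q \<longrightarrow> 1 - \<delta> < pos q)"
    and join_0: "0 \<notin> E \<Longrightarrow> \<exists>a\<in>A. \<exists>q\<in>Q. adj2 a q \<and> (\<forall>c\<in>A. X a \<le> X c) \<and> (\<forall>c\<in>Q. \<nu> q \<le> \<nu> c)"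
    and join_1: "1 \<notin> E \<Longrightarrow> \<exists>a\<in>A. \<exists>q\<in>Q. adj2 a q \<and> (\<forall>c\<in>A. X c \<le> X a) \<and> (\<forall>c\<in>Q. \<nu> c \<le> \<nu> q)"

context coloured
begin

lemma stranded_ex: "\<exists>\<nu>. stranded V SP adj sp \<tau> E A Q X \<nu>"
proof -
  obtain \<nu> :: "'a \<Rightarrow> int" where mono: "\<forall>a\<in>Q. \<forall>b\<in>Q. key a < key b \<longrightarrow> \<nu> a < \<nu> b"
    using int_index_ex[of Q key, OF Q_finite_between] by blast
  have nu: "\<nu> a < \<nu> b \<longleftrightarrow> key a < key b" if "a \<in> Q" "b \<in> Q" for a b
  proof
    assume l: "\<nu> a < \<nu> b"
    show "key a < key b"
    proof (rule ccontr)
      assume "\<not> key a < key b"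
      then have "key b < key a \<or> a = b" using key_inj[of a b] Q_V that by force
      then show False using mono that l by force
    qed
  qed (use mono that in blast)
  have nu_le: "\<nu> a \<le> \<nu> b \<longleftrightarrow> key a \<le> key b" if "a \<in> Q" "b \<in> Q" for a b using nu[OF that(2,1)] by force
  obtain i where "i \<in> J" using J_ne by blast
  then have Qne: "Q \<noteq> {}" using anc_sec(6) by blast
  have "stranded V SP adj sp \<tau> E A Q X \<nu>"
  proof (unfold_locales)
    show "inj_on \<nu> Q"
    proof (rule inj_onI)
      fix a b assume h: "a \<in> Q" "b \<in> Q" "\<nu> a = \<nu> b"
      then have "key a = key b" using nu[of a b] nu[of b a] by force
      then show "a = b" using key_inj Q_V h by blast
    qed
    show "adj2 a b" if "a \<in> A" "b \<in> A" "X a < X b" "\<forall>c\<in>A. \<not> (X a < X c \<and> X c < X b)" "\<forall>e\<in>E. \<not> (X a < e \<and> e < X b)" for a b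
      by (rule A_consec[OF that(1-3)]) (use that(4,5) in blast)+
    show "(\<exists>a\<in>A. e < X a \<and> X a < t) \<or> (\<exists>e'\<in>E. e < e' \<and> e' < t)" if h: "e \<in> E" "e < t" "e < 1" for e t
    proof (cases "\<exists>e'\<in>E. e < e' \<and> e' < t")
      case False
      then obtain s u where n: "nxt s u" "e < \<tau> s" "\<tau> u < t" using accumulate_right[OF h] by blast
      from nxt_A[OF n(1)] show ?thesis
      proof
        assume "s \<in> A" then show ?thesis using n nxtD[OF n(1)] X_SP[of s] by (intro disjI1 bexI[of _ s]) auto
      next
        assume "u \<in> A" then show ?thesis using n nxtD[OF n(1)] X_SP[of u] by (intro disjI1 bexI[of _ u]) auto
      qed
    qed blast
    show "(\<exists>a\<in>A. t < X a \<and> X a < e) \<or> (\<exists>e'\<in>E. t < e' \<and> e' < e)" if h: "e \<in> E" "t < e" "0 < e" for e t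
    proof (cases "\<exists>e'\<in>E. t < e' \<and> e' < e")
      case False
      then obtain s u where n: "nxt s u" "t < \<tau> s" "\<tau> u < e" using accumulate_left[OF h] by blast
      from nxt_A[OF n(1)] show ?thesis
      proof
        assume "s \<in> A" then show ?thesis using n nxtD[OF n(1)] X_SP[of s] by (intro disjI1 bexI[of _ s]) auto
      next
        assume "u \<in> A" then show ?thesis using n nxtD[OF n(1)] X_SP[of u] by (intro disjI1 bexI[of _ u]) auto
      qed
    qed blast
    show "adj2 a b" if h: "a \<in> Q" "b \<in> Q" "\<nu> a < \<nu> b" "\<forall>c\<in>Q. \<not> (\<nu> a < \<nu> c \<and> \<nu> c < \<nu> b)" for a b
      by (rule Q_consec[OF h(1,2)]) (use h nu in auto)
    show "(\<forall>q\<in>Q. \<exists>q'\<in>Q. \<nu> q' < \<nu> q) \<and> (\<forall>\<delta>>0. \<exists>N. \<forall>q\<in>Q. \<nu> q < N \<longrightarrow> pos q < \<delta>)" if "0 \<in> E"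
    proof
      show "\<forall>q\<in>Q. \<exists>q'\<in>Q. \<nu> q' < \<nu> q" using Q_below(1)[OF that] nu by blast
      show "\<forall>\<delta>>0. \<exists>N. \<forall>q\<in>Q. \<nu> q < N \<longrightarrow> pos q < \<delta>" using Q_below(2)[OF that] nu by meson
    qed
    show "(\<forall>q\<in>Q. \<exists>q'\<in>Q. \<nu> q < \<nu> q') \<and> (\<forall>\<delta>>0. \<exists>N. \<forall>q\<in>Q. N < \<nu> q \<longrightarrow> 1 - \<delta> < pos q)" if "1 \<in> E"
    proof
      show "\<forall>q\<in>Q. \<exists>q'\<in>Q. \<nu> q < \<nu> q'" using Q_above(1)[OF that] nu by blast
      show "\<forall>\<delta>>0. \<exists>N. \<forall>q\<in>Q. N < \<nu> q \<longrightarrow> 1 - \<delta> < pos q" using Q_above(2)[OF that] nu by meson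
    qed
    show "\<exists>a\<in>A. \<exists>q\<in>Q. adj2 a q \<and> (\<forall>c\<in>A. X a \<le> X c) \<and> (\<forall>c\<in>Q. \<nu> q \<le> \<nu> c)" if "0 \<notin> E"
      using join_0[OF that] nu_le by blast
    show "\<exists>a\<in>A. \<exists>q\<in>Q. adj2 a q \<and> (\<forall>c\<in>A. X c \<le> X a) \<and> (\<forall>c\<in>Q. \<nu> c \<le> \<nu> q)" if "1 \<notin> E"
      using join_1[OF that] nu_le by blast
  qed (use AQ X_inj X_range X_E X_discrete Qne in blast)+
  then show ?thesis by blast
qed

end

context spine
begin

lemma stranded_ex: "\<exists>A Q X \<nu>. stranded V SP adj sp \<tau> E A Q X \<nu>"
proof -
  obtain J ent ext mid where "routed V SP adj sp \<tau> E J ent ext mid" using route_ex by blast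
  then interpret routed V SP adj sp \<tau> E J ent ext mid .
  obtain par :: "'v \<Rightarrow> bool" where par: "\<forall>s u. nxt s u \<longrightarrow> par s \<noteq> par u" using parity_ex by blast
  obtain wd where wd: "\<And>s. s \<in> SP \<Longrightarrow> wd s > 0 \<and> wd s \<le> 1/4 \<and> (\<forall>s'\<in>SP. s' \<noteq> s \<longrightarrow> 3 * wd s \<le> \<bar>\<tau> s - \<tau> s'\<bar>) \<and>
      (\<forall>e\<in>E. 3 * wd s \<le> \<bar>\<tau> s - e\<bar>)" using width_ex by metis
  obtain rho0 :: "'v \<Rightarrow> real" where rho0: "\<forall>z. 0 < rho0 z \<and> rho0 z < 1/2" "\<forall>s\<in>SP. inj_on rho0 {z \<in> V. sp z = s}"
    using offsets_ex by blast
  interpret coloured V SP adj sp \<tau> E J ent ext mid par wd rho0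
    by unfold_locales (use par wd rho0 in auto)
  show ?thesis using stranded_ex by blast
qed

end

subsection \<open>Closing up the two strands\<close>

text \<open>An order embedding of the integers into the open unit interval whose values accumulate
  only at 0 and 1.\<close>

definition squash :: "int \<Rightarrow> real" where
  "squash n = (if n < 0 then 1 / (2 * (1 - real_of_int n)) else 1 - 1 / (2 * (1 + real_of_int n)))"

lemma squash_mono: "m < n \<Longrightarrow> squash m < squash n"
proof -
  assume mn: "m < n"
  have h: "squash k < 1/2" if "k < 0" for k using that unfolding squash_def by (simp add: field_simps)
  have h': "1/2 \<le> squash k" if "\<not> k < 0" for k using that unfolding squash_def by (simp add: field_simps)
  show ?thesis
  proof (cases "m < 0"; cases "n < 0")
    assume "m < 0" "n < 0" then show ?thesis using mn unfolding squash_def by (simp add: field_simps)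
  next
    assume "\<not> m < 0" "\<not> n < 0" then show ?thesis using mn unfolding squash_def by (simp add: field_simps)
  next
    assume "m < 0" "\<not> n < 0" then show ?thesis using h[of m] h'[of n] by linarith
  qed (use mn in auto)
qed

lemma squash_range: "0 < squash n" "squash n < 1"
  unfolding squash_def by (auto simp: field_simps)

lemma squash_less: "squash m < squash n \<longleftrightarrow> m < n"
  using squash_mono[of m n] squash_mono[of n m] by (cases m n rule: linorder_cases) auto

lemma squash_discrete:
  assumes "s \<noteq> 0" "s \<noteq> 1" shows "\<exists>\<epsilon>>0. finite {n. \<bar>squash n - s\<bar> < \<epsilon>}"
proof -
  define \<epsilon> where "\<epsilon> = min \<bar>s\<bar> \<bar>s - 1\<bar> / 2"
  have e: "\<epsilon> > 0" "2 * \<epsilon> \<le> \<bar>s\<bar>" "2 * \<epsilon> \<le> \<bar>s - 1\<bar>" unfolding \<epsilon>_def using assms by auto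
  obtain N :: nat where N: "1 / \<epsilon> < real N" using reals_Archimedean2 by blast
  have small: "1 / (2 * (1 + x)) < \<epsilon>" if "real N \<le> x" for x
  proof -
    have x: "0 \<le> x" "1 / \<epsilon> < x" using that N by auto
    then have "1 < \<epsilon> * x" using e by (simp add: field_simps)
    then have "1 < \<epsilon> * (2 * (1 + x))" using e x mult_nonneg_nonneg[of \<epsilon> x] by (simp add: algebra_simps)
    then show ?thesis using x by (simp add: field_simps)
  qed
  have "{n. \<bar>squash n - s\<bar> < \<epsilon>} \<subseteq> {- int N..int N}"
  proof
    fix n assume "n \<in> {n. \<bar>squash n - s\<bar> < \<epsilon>}"
    then have n: "\<bar>squash n - s\<bar> < \<epsilon>" by simp
    show "n \<in> {- int N..int N}"
    proof (rule ccontr)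
      assume "n \<notin> {- int N..int N}"
      then consider "int N < n" | "n < - int N" by fastforce
      then show False
      proof cases
        case 1
        then have "\<bar>squash n - 1\<bar> < \<epsilon>" using small[of "real_of_int n"] unfolding squash_def by auto
        then show False using n e by linarith
      next
        case 2
        then have "\<bar>squash n\<bar> < \<epsilon>" using small[of "- real_of_int n"] unfolding squash_def by auto
        then show False using n e by linarith
      qed
    qed
  qed
  then show ?thesis using e finite_subset by blast
qed

text \<open>Near a point off \<open>L\<close> only finitely many values occur, so the smallest
  positive distance to one of them, together with the distance to \<open>L\<close>, isolates the
  point.\<close>

lemma closed_discrete_union:
  fixes f :: "'b \<Rightarrow> real"
  assumes L: "closed L" and fin: "\<And>t. t \<notin> L \<Longrightarrow> \<exists>\<epsilon>>0. finite {x \<in> S. \<bar>f x - t\<bar> < \<epsilon>}"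
  shows "t \<notin> L \<Longrightarrow> \<exists>\<epsilon>>0. \<forall>z\<in>f ` S \<union> L. \<bar>z - t\<bar> < \<epsilon> \<longrightarrow> z = t" and "closed (f ` S \<union> L)"
proof -
  show iso: "\<exists>\<epsilon>>0. \<forall>z\<in>f ` S \<union> L. \<bar>z - t\<bar> < \<epsilon> \<longrightarrow> z = t" if t: "t \<notin> L" for t
  proof -
    obtain d where d: "d > 0" "\<forall>e\<in>L. d \<le> dist t e" using separate_point_closed[OF L t] by blast
    obtain \<epsilon> where e: "\<epsilon> > 0" "finite {x \<in> S. \<bar>f x - t\<bar> < \<epsilon>}" using fin[OF t] by blast
    let ?F = "(\<lambda>x. \<bar>f x - t\<bar>) ` {x \<in> S. \<bar>f x - t\<bar> < \<epsilon> \<and> f x \<noteq> t}"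
    have "finite ?F" by (rule finite_imageI, rule finite_subset[OF _ e(2)]) auto
    then have m: "Min (insert \<epsilon> ?F) > 0" "\<And>x. x \<in> insert \<epsilon> ?F \<Longrightarrow> Min (insert \<epsilon> ?F) \<le> x" using e by auto
    show ?thesis
    proof (intro exI[of _ "min d (Min (insert \<epsilon> ?F))"] conjI ballI impI)
      fix z assume z: "z \<in> f ` S \<union> L" "\<bar>z - t\<bar> < min d (Min (insert \<epsilon> ?F))"
      have "z \<notin> L"
      proof
        assume "z \<in> L" then have "d \<le> \<bar>t - z\<bar>" using d by (auto simp: dist_real_def)
        then show False using z by auto
      qed
      then obtain x where x: "x \<in> S" "z = f x" using z by blast
      show "z = t"
      proof (rule ccontr)
        assume ne: "z \<noteq> t"
        have "\<bar>z - t\<bar> < \<epsilon>" using z m(2)[of \<epsilon>] by auto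
        then have "\<bar>z - t\<bar> \<in> insert \<epsilon> ?F" using x ne by auto
        from m(2)[OF this] show False using z(2) by simp
      qed
    qed (use d m in auto)
  qed
  show "closed (f ` S \<union> L)" unfolding closed_def open_dist
  proof
    fix t assume t: "t \<in> - (f ` S \<union> L)"
    then obtain \<epsilon> where "\<epsilon> > 0" "\<forall>z\<in>f ` S \<union> L. \<bar>z - t\<bar> < \<epsilon> \<longrightarrow> z = t" using iso[of t] by blast
    then show "\<exists>e>0. \<forall>y. dist y t < e \<longrightarrow> y \<in> - (f ` S \<union> L)"
      using t by (intro exI[of _ \<epsilon>]) (auto simp: dist_real_def)
  qed
qed

context stranded
begin

lemma A_V: "a \<in> A \<Longrightarrow> a \<in> V" and Q_V: "q \<in> Q \<Longrightarrow> q \<in> V" using AQ by auto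

lemma X_E_less: "z \<in> V \<Longrightarrow> e \<in> E \<Longrightarrow> (e < X z \<longleftrightarrow> e < pos z) \<and> X z \<noteq> e"
  using X_E[of z e] pos_E[of z] by (cases "e = pos z") (auto simp: abs_if split: if_splits)

lemma X_close: "z \<in> V \<Longrightarrow> e \<in> E \<Longrightarrow> \<bar>pos z - e\<bar> \<le> 2 * \<bar>X z - e\<bar>"
  using X_E[of z e] by (auto simp: abs_if split: if_splits)

text \<open>Supplies the labelling for \<open>hamiltonian_from_labels\<close>. Here
  \<open>w e\<close> is the end of \<open>H\<close> at position \<open>e\<close>, and
  \<open>wc\<close> says that vertices and ends at nearby positions converge to it.\<close>

lemma hamiltonian_if_stranded:
  fixes H :: "'a graph" and w :: "real \<Rightarrow> (nat \<Rightarrow> 'a) set"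
  assumes H: "lf_graph H" "fst H = V" and HE: "\<And>u v. adj2 u v \<Longrightarrow> {u, v} \<in> snd H"
    and three: "v1 \<in> V" "v2 \<in> V" "v3 \<in> V" "v1 \<noteq> v2" "v1 \<noteq> v3" "v2 \<noteq> v3"
    and w: "\<And>e. e \<in> E \<Longrightarrow> w e \<in> ends H" "inj_on w E"
    and wc: "\<And>e S C. e \<in> E \<Longrightarrow> finite S \<Longrightarrow> S \<subseteq> V \<Longrightarrow> C \<in> comps H S \<Longrightarrow> \<forall>r\<in>w e. tail_in r C \<Longrightarrow>
      \<exists>\<delta>>0. (\<forall>z\<in>V. \<bar>pos z - e\<bar> < \<delta> \<longrightarrow> z \<in> C) \<and> (\<forall>e'\<in>E. \<bar>e' - e\<bar> < \<delta> \<longrightarrow> (\<forall>r\<in>w e'. tail_in r C))"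
  shows "hamiltonian H"
proof -
  interpret H: lf_graph H by (rule H)
  \<comment> \<open>The circle is cut open at the position 1: the first strand is read backwards from 1 to 0 on the negative
    axis, and the second one leads back from 0 to 1 on the interval from \<open>\<beta>\<close> to \<open>b\<close>.\<close>
  define \<beta> :: real where "\<beta> = (if 0 \<in> E then 0 else 1)"
  define P where "P z = (if z \<in> A then - X z else \<beta> + squash (\<nu> z))" for z
  define b where "b = \<beta> + 1"
  \<comment> \<open>The last vertex of \<open>A\<close>. If 1 is not an end, the circle starts at
    it, and its label is repeated at \<open>b\<close>.\<close>
  define a1 where "a1 = (SOME a. a \<in> A \<and> (\<exists>q\<in>Q. adj2 a q \<and> (\<forall>c\<in>A. X c \<le> X a) \<and> (\<forall>c\<in>Q. \<nu> c \<le> \<nu> q)))"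
  have a1: "a1 \<in> A" "\<exists>q\<in>Q. adj2 a1 q \<and> (\<forall>c\<in>A. X c \<le> X a1) \<and> (\<forall>c\<in>Q. \<nu> c \<le> \<nu> q)" if "1 \<notin> E"
    using someI_ex[of "\<lambda>a. a \<in> A \<and> (\<exists>q\<in>Q. adj2 a q \<and> (\<forall>c\<in>A. X c \<le> X a) \<and> (\<forall>c\<in>Q. \<nu> c \<le> \<nu> q))"] join_1[OF that]
    unfolding a1_def by blast+
  define a where "a = (if 1 \<in> E then - 1 else - X a1)"
  have PA: "P z = - X z" if "z \<in> A" for z using that by (simp add: P_def)
  have PQ: "P z = \<beta> + squash (\<nu> z)" if "z \<in> Q" for z using that AQ by (auto simp: P_def)
  have Qb: "\<beta> < P q" "P q < b" if "q \<in> Q" for q using PQ[OF that] squash_range[of "\<nu> q"] unfolding b_def by auto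
  have Ab: "P x < \<beta>" if "x \<in> A" for x
  proof (cases "0 \<in> E")
    case True
    have "0 < pos x" using pos01[OF A_V[OF that]] pos_E[OF A_V[OF that]] True by (cases "pos x = 0") auto
    then show ?thesis using X_E_less[OF A_V[OF that] True] PA[OF that] True unfolding \<beta>_def by simp
  next
    case False then show ?thesis using X_range[OF A_V[OF that]] PA[OF that] unfolding \<beta>_def by auto
  qed
  have Eb: "- e \<le> \<beta>" "0 \<notin> E \<Longrightarrow> - e < \<beta>" if "e \<in> E" for e using E_range[OF that] unfolding \<beta>_def by auto
  have b0: "\<beta> < b" unfolding b_def by simp
  have Pless: "P q < P q' \<longleftrightarrow> \<nu> q < \<nu> q'" if "q \<in> Q" "q' \<in> Q" for q q' using PQ that squash_less by simp
  have Pinj: "inj_on P V"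
  proof (rule inj_onI)
    fix z z' assume h: "z \<in> V" "z' \<in> V" "P z = P z'"
    consider "z \<in> A" "z' \<in> A" | "z \<in> Q" "z' \<in> Q" | "z \<in> A" "z' \<in> Q" | "z \<in> Q" "z' \<in> A" using AQ h by blast
    then show "z = z'"
    proof cases
      case 1 then show ?thesis using h PA X_inj A_V unfolding inj_on_def by auto
    next
      case 2
      then have "\<nu> z = \<nu> z'" using Pless[of z z'] Pless[of z' z] h by auto
      then show ?thesis using nu_inj 2 unfolding inj_on_def by blast
    next
      case 3 then show ?thesis using Ab[of z] Qb[of z'] h by auto
    next
      case 4 then show ?thesis using Ab[of z'] Qb[of z] h by auto
    qed
  qed
  have PE: "P z \<noteq> - e" if "z \<in> V" "e \<in> E" for z e
  proof (cases "z \<in> A")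
    case True then show ?thesis using PA X_E_less[OF that] by auto
  next
    case False
    then have "z \<in> Q" using that AQ by blast
    then show ?thesis using Qb[of z] Eb[OF that(2)] by auto
  qed
  have Pb: "P z \<noteq> b" if "z \<in> V" for z
    using that AQ Ab[of z] Qb[of z] b0 by fastforce
  define Z where "Z = P ` V \<union> uminus ` E \<union> {b}"
  define lab where "lab t = (if t = b then (if 1 \<in> E then Ep (w 1) else Gp (vertex_pt a1))
     else if t \<in> P ` V then Gp (vertex_pt (inv_into V P t)) else Ep (w (- t)))" for t
  have labV: "lab (P z) = Gp (vertex_pt z)" if "z \<in> V" for z
    using Pb[OF that] that inv_into_f_f[OF Pinj that] unfolding lab_def by auto
  have labE: "lab (- e) = Ep (w e)" if "e \<in> E" for e
  proof -
    have "- e \<notin> P ` V" using PE[OF _ that] by (metis imageE)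
    then show ?thesis using Eb[OF that] b0 unfolding lab_def by auto
  qed
  have labb: "lab b = (if 1 \<in> E then Ep (w 1) else Gp (vertex_pt a1))" unfolding lab_def by simp
  have Zcases: "(\<exists>x\<in>A. z = P x) \<or> (\<exists>q\<in>Q. z = P q) \<or> (\<exists>e\<in>E. z = - e) \<or> z = b" if "z \<in> Z" for z
    using that AQ unfolding Z_def by blast
  have ZA: "P x \<in> Z" if "x \<in> A" for x using that A_V unfolding Z_def by blast
  have ZQ: "P x \<in> Z" if "x \<in> Q" for x using that Q_V unfolding Z_def by blast
  have ZE: "- e \<in> Z" if "e \<in> E" for e using that unfolding Z_def by blast
  have Zb: "b \<in> Z" unfolding Z_def by blast
  have finA: "\<exists>\<epsilon>>0. finite {x \<in> A. \<bar>P x - t\<bar> < \<epsilon>}" if t: "t \<notin> uminus ` E" for t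
  proof -
    have "- t \<notin> E" using t by force
    then obtain \<epsilon> where e: "\<epsilon> > 0" "finite {z \<in> V. \<bar>X z - (- t)\<bar> < \<epsilon>}" using X_discrete by blast
    have "{x \<in> A. \<bar>P x - t\<bar> < \<epsilon>} \<subseteq> {z \<in> V. \<bar>X z - (- t)\<bar> < \<epsilon>}" using PA A_V by (auto simp: abs_minus_commute)
    then show ?thesis using e finite_subset by blast
  qed
  have cE: "closed (uminus ` E)" using E_closed by (simp add: closed_negations)
  note S1 = closed_discrete_union[OF cE finA]
  \<comment> \<open>Apart from \<open>b\<close>, the second strand can accumulate only at
    \<open>\<beta>\<close>, and only if 0 is an end.\<close>
  define L where "L = (if 0 \<in> E then {\<beta>, b} else {b})"
  have cL: "closed L" unfolding L_def by auto
  have finQ: "\<exists>\<epsilon>>0. finite {x \<in> Q. \<bar>P x - t\<bar> < \<epsilon>}" if t: "t \<notin> L" for t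
  proof (cases "t = \<beta>")
    case True
    then have n0: "0 \<notin> E" using t unfolding L_def by auto
    obtain q where q: "q \<in> Q" "\<forall>c\<in>Q. \<nu> q \<le> \<nu> c" using join_0[OF n0] by blast
    have "\<not> \<bar>P x - t\<bar> < squash (\<nu> q)" if "x \<in> Q" for x
    proof -
      have "squash (\<nu> q) \<le> squash (\<nu> x)" using q that squash_less[of "\<nu> x" "\<nu> q"] by force
      then show ?thesis using True PQ[OF that] by auto
    qed
    then have "{x \<in> Q. \<bar>P x - t\<bar> < squash (\<nu> q)} = {}" by blast
    then show ?thesis using squash_range[of "\<nu> q"] by (metis finite.emptyI)
  next
    case False
    moreover have "t \<noteq> b" using t unfolding L_def by (auto split: if_splits)
    ultimately obtain \<epsilon> where e: "\<epsilon> > 0" "finite {n. \<bar>squash n - (t - \<beta>)\<bar> < \<epsilon>}"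
      using squash_discrete[of "t - \<beta>"] unfolding b_def by auto
    have "\<nu> ` {x \<in> Q. \<bar>P x - t\<bar> < \<epsilon>} \<subseteq> {n. \<bar>squash n - (t - \<beta>)\<bar> < \<epsilon>}" using PQ by (auto simp: algebra_simps)
    then have "finite (\<nu> ` {x \<in> Q. \<bar>P x - t\<bar> < \<epsilon>})" using e finite_subset by blast
    moreover have "inj_on \<nu> {x \<in> Q. \<bar>P x - t\<bar> < \<epsilon>}" using nu_inj by (rule inj_on_subset) auto
    ultimately have "finite {x \<in> Q. \<bar>P x - t\<bar> < \<epsilon>}" using finite_imageD by blast
    then show ?thesis using e by blast
  qed
  note S2 = closed_discrete_union[OF cL finQ]
  have ZU: "Z = (P ` A \<union> uminus ` E) \<union> (P ` Q \<union> L)"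
  proof -
    have "P ` V = P ` A \<union> P ` Q" using AQ by auto
    moreover have "\<beta> = - 0" if "0 \<in> E" using that unfolding \<beta>_def by simp
    then have "L \<subseteq> uminus ` E \<union> {b}" "b \<in> L" unfolding L_def by auto
    ultimately show ?thesis unfolding Z_def by blast
  qed
  have low: "a \<le> - e" if e: "e \<in> E" for e
  proof (cases "1 \<in> E")
    case True then show ?thesis using E_range[OF e] unfolding a_def by simp
  next
    case False
    have "compact E" using E_closed E01 by (meson bounded_closed_interval bounded_subset compact_eq_bounded_closed)
    then obtain m where m: "m \<in> E" "\<forall>x\<in>E. x \<le> m" using compact_attains_sup[of E] e by blast
    have "m < 1" using m E_range[of m] False by (cases "m = 1") auto
    then obtain x where "x \<in> A" "m < X x" using A_right[OF m(1), of 2] m by force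
    then have "m < X a1" using a1[OF False] by force
    then show ?thesis using m e False unfolding a_def by force
  qed
  have lowA: "a \<le> P x" if x: "x \<in> A" for x
  proof (cases "1 \<in> E")
    case True
    have "pos x \<noteq> 1" using pos_E[OF A_V[OF x]] True by metis
    then have "\<not> 1 < X x" using X_E_less[OF A_V[OF x] True] pos01[OF A_V[OF x]] by auto
    then show ?thesis using PA x True unfolding a_def by simp
  next
    case False then show ?thesis using a1[OF False] PA x unfolding a_def by auto
  qed
  have aZ: "a \<in> Z" "a \<le> \<beta>"
  proof -
    have "a \<in> Z \<and> a \<le> \<beta>"
    proof (cases "1 \<in> E")
      case True then show ?thesis using ZE[OF True] Eb[OF True] unfolding a_def by simp
    next
      case False then show ?thesis using ZA[OF a1(1)] Ab[OF a1(1)] PA[OF a1(1)] unfolding a_def by auto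
    qed
    then show "a \<in> Z" "a \<le> \<beta>" by auto
  qed
  have Zab: "Z \<subseteq> {a..b}"
  proof
    fix z assume "z \<in> Z"
    from Zcases[OF this] show "z \<in> {a..b}"
    proof (elim disjE bexE)
      fix x assume "x \<in> A" "z = P x" then show ?thesis using lowA[of x] Ab[of x] b0 by simp
    next
      fix x assume "x \<in> Q" "z = P x" then show ?thesis using Qb[of x] aZ by simp
    next
      fix e assume e: "e \<in> E" "z = - e" then show ?thesis using low[OF e(1)] Eb(1)[OF e(1)] b0 by simp
    next
      assume "z = b" then show ?thesis using aZ b0 by simp
    qed
  qed
  have Z1: "z \<le> \<beta>" if "z \<in> P ` A \<union> uminus ` E" for z using that Ab Eb by (auto intro: less_imp_le)
  have Z2: "\<beta> \<le> z" if "z \<in> P ` Q \<union> L" for z using that Qb b0 unfolding L_def by (auto intro: less_imp_le split: if_splits)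
  \<comment> \<open>At most one of three vertices sits at \<open>a\<close>; two others provide the
    inner points that exclude a degenerate circle.\<close>
  have sorted: "\<exists>c d. c \<in> P ` V \<and> d \<in> P ` V \<and> a < c \<and> c < d"
  proof -
    have p: "P v1 \<noteq> P v2" "P v1 \<noteq> P v3" "P v2 \<noteq> P v3" using Pinj three unfolding inj_on_def by blast+
    have l: "a \<le> P v" if "v \<in> V" for v using Zab that unfolding Z_def by auto
    have pick: "\<exists>c d. c \<in> P ` V \<and> d \<in> P ` V \<and> a < c \<and> c < d" if h: "x \<in> V" "y \<in> V" "P x \<noteq> a" "P y \<noteq> a" "P x \<noteq> P y" for x y
    proof (cases "P x < P y")
      case True
      then show ?thesis using h l[of x] by (intro exI[of _ "P x"] exI[of _ "P y"]) simp
    next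
      case False
      then show ?thesis using h l[of y] by (intro exI[of _ "P y"] exI[of _ "P x"]) simp
    qed
    show ?thesis using pick[of v1 v2] pick[of v1 v3] pick[of v2 v3] p three by metis
  qed
  then obtain c0 d0 where cd: "c0 \<in> P ` V" "d0 \<in> P ` V" "a < c0" "c0 < d0" by blast
  show ?thesis
  proof (rule H.hamiltonian_from_labels[where Z = Z and a = a and b = b and lab = lab and c = c0 and d = d0])
    have "closed Z" unfolding ZU using S1(2) S2(2) by blast
    then show "compact Z" using Zab by (meson bounded_closed_interval bounded_subset compact_eq_bounded_closed)
    show "a \<in> Z" "b \<in> Z" "a < b" "Z \<subseteq> {a..b}" using aZ Zb b0 Zab by auto
  next
    fix z assume "z \<in> Z"
    then show "(\<exists>v\<in>fst H. lab z = Gp (vertex_pt v)) \<or> (\<exists>\<omega>\<in>ends H. lab z = Ep \<omega>)"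
      using Zcases[of z] labV labE labb w(1) a1(1) A_V Q_V H(2) by (cases "1 \<in> E") fastforce+
  next
    show "inj_on lab (Z - {b})"
    proof (rule inj_onI)
      fix x y assume h: "x \<in> Z - {b}" "y \<in> Z - {b}" "lab x = lab y"
      have c: "(\<exists>v\<in>V. z = P v) \<or> (\<exists>e\<in>E. z = - e)" if "z \<in> Z - {b}" for z using that unfolding Z_def by blast
      show "x = y" using c[OF h(1)] c[OF h(2)]
      proof (elim disjE bexE)
        fix e e' assume "e \<in> E" "x = - e" "e' \<in> E" "y = - e'"
        then show ?thesis using h(3) labE w(2) unfolding inj_on_def by auto
      qed (use h(3) labV labE in auto)
    qed
  next
    show "lab a = lab b"
    proof (cases "1 \<in> E")
      case True then show ?thesis using labE[OF True] labb unfolding a_def by simp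
    next
      case False then show ?thesis using labV[OF A_V[OF a1(1)[OF False]]] PA[OF a1(1)[OF False]] labb unfolding a_def by simp
    qed
  next
    fix v assume "v \<in> fst H" then show "\<exists>z\<in>Z. lab z = Gp (vertex_pt v)" using labV H(2) unfolding Z_def by blast
  next
    fix s t assume st: "s \<in> Z" "t \<in> Z" "s < t" "{s<..<t} \<inter> Z = {}"
    have no: False if "z \<in> Z" "s < z" "z < t" for z using st(4) that by auto
    obtain q0 where q0: "q0 \<in> Q" using Q_ne by blast
    have sb: "s \<noteq> b" using Zab st by auto
    have tb: False if "t = b" "s \<le> \<beta>" using no[OF ZQ[OF q0]] Qb[OF q0] that by auto
    show "\<exists>u v. lab s = Gp (vertex_pt u) \<and> lab t = Gp (vertex_pt v) \<and> {u, v} \<in> snd H"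
      using Zcases[OF st(1)]
    proof (elim disjE bexE)
      fix x assume x: "x \<in> A" "s = P x"
      have xV: "x \<in> V" using A_V x by blast
      show ?thesis using Zcases[OF st(2)]
      proof (elim disjE bexE)
        fix y assume y: "y \<in> A" "t = P y"
        have less: "X y < X x" using st x y PA by simp
        have "adj2 y x"
        proof (rule A_consec[OF y(1) x(1) less])
          show "\<forall>c\<in>A. \<not> (X y < X c \<and> X c < X x)"
          proof (intro ballI notI)
            fix c assume "c \<in> A" "X y < X c \<and> X c < X x"
            then show False using no[OF ZA[of c]] PA x y by auto
          qed
          show "\<forall>e\<in>E. \<not> (X y < e \<and> e < X x)"
          proof (intro ballI notI)
            fix e assume "e \<in> E" "X y < e \<and> e < X x"
            then show False using no[OF ZE[of e]] PA x y by auto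
          qed
        qed
        then show ?thesis using labV[OF xV] labV[OF A_V[OF y(1)]] x y HE[OF adj2_sym] by blast
      next
        fix q assume q: "q \<in> Q" "t = P q"
        have n0: "0 \<notin> E"
        proof
          assume "0 \<in> E"
          then have "\<beta> \<in> Z" using ZE[of 0] unfolding \<beta>_def by simp
          then show False using no[of \<beta>] Ab[OF x(1)] Qb[OF q(1)] x q by simp
        qed
        \<comment> \<open>The interval that leads from \<open>A\<close> to \<open>Q\<close> can only
          join the first vertices of the two strands.\<close>
        obtain c d where cd: "c \<in> A" "d \<in> Q" "adj2 c d" "\<forall>y\<in>A. X c \<le> X y" "\<forall>y\<in>Q. \<nu> d \<le> \<nu> y" using join_0[OF n0] by blast
        have "\<not> P x < P c" using no[OF ZA[OF cd(1)]] Ab[OF cd(1)] Qb[OF q(1)] x q by auto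
        then have "X c = X x" using cd x PA by force
        then have "c = x" using X_inj cd xV A_V unfolding inj_on_def by blast
        have "\<not> P d < P q" using no[OF ZQ[OF cd(2)]] Ab[OF x(1)] Qb[OF cd(2)] x q by auto
        then have "\<nu> d = \<nu> q" using Pless[OF cd(2) q(1)] cd q by force
        then have "d = q" using nu_inj cd q unfolding inj_on_def by blast
        then show ?thesis using \<open>c = x\<close> cd x q labV A_V Q_V HE by blast
      next
        fix e assume e: "e \<in> E" "t = - e"
        have less: "e < X x" using st x e PA by simp
        have "e \<noteq> 1"
        proof
          assume "e = 1"
          then show False using lowA[OF x(1)] e less PA[OF x(1)] unfolding a_def by auto
        qed
        then have e1: "e < 1" using E_range[OF e(1)] by auto
        \<comment> \<open>Points of \<open>Z\<close> come arbitrarily close to \<open>- e\<close>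
          from this side, so no complementary interval ends at an end.\<close>
        from A_right[OF e(1) less e1] have False
        proof (elim disjE bexE conjE)
          fix y assume "y \<in> A" "e < X y" "X y < X x"
          then show False using no[OF ZA[of y]] PA x e by auto
        next
          fix y assume "y \<in> E" "e < y" "y < X x"
          then show False using no[OF ZE[of y]] PA x e by auto
        qed
        then show ?thesis ..
      next
        assume "t = b" then show ?thesis using tb Ab[OF x(1)] x by force
      qed
    next
      fix q assume q: "q \<in> Q" "s = P q"
      show ?thesis using Zcases[OF st(2)]
      proof (elim disjE bexE)
        fix x assume "x \<in> A" "t = P x" then show ?thesis using Ab[of x] Qb[OF q(1)] st q by auto
      next
        fix e assume "e \<in> E" "t = - e" then show ?thesis using Eb[of e] Qb[OF q(1)] st q by auto
      next
        fix q' assume q': "q' \<in> Q" "t = P q'"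
        have "adj2 q q'"
        proof (rule Q_consec[OF q(1) q'(1)])
          show "\<nu> q < \<nu> q'" using st q q' Pless by simp
          show "\<forall>c\<in>Q. \<not> (\<nu> q < \<nu> c \<and> \<nu> c < \<nu> q')"
          proof (intro ballI notI)
            fix c assume "c \<in> Q" "\<nu> q < \<nu> c \<and> \<nu> c < \<nu> q'"
            then show False using no[OF ZQ[of c]] Pless q q' by auto
          qed
        qed
        then show ?thesis using labV Q_V q q' HE by blast
      next
        assume t: "t = b"
        have top: "\<not> \<nu> q < \<nu> c" if "c \<in> Q" for c using no[OF ZQ[OF that]] Qb[OF that] Pless[OF q(1) that] q t by auto
        then have n1: "1 \<notin> E" using Q_above q by blast
        obtain d where d: "d \<in> Q" "adj2 a1 d" "\<forall>c\<in>Q. \<nu> c \<le> \<nu> d" using a1(2)[OF n1] by blast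
        then have "\<nu> d = \<nu> q" using top[OF d(1)] q by force
        then have "d = q" using nu_inj d q unfolding inj_on_def by blast
        then show ?thesis using labV[OF Q_V[OF q(1)]] labb n1 t q HE[OF adj2_sym] d by auto
      qed
    next
      fix e assume e: "e \<in> E" "s = - e"
      \<comment> \<open>The same from the other side: \<open>A_left\<close> puts points of
        \<open>Z\<close> between \<open>- e\<close> and anything to its right.\<close>
      have pos_e: False if l: "0 < e" "l < e" "- l \<le> t" for l
        using A_left[OF e(1) l(2,1)]
      proof (elim disjE bexE conjE)
        fix y assume "y \<in> A" "l < X y" "X y < e"
        then show False using no[OF ZA[of y]] l(3) PA[of y] e by auto
      next
        fix y assume "y \<in> E" "l < y" "y < e"
        then show False using no[OF ZE[of y]] l(3) e by auto
      qed
      have False using Zcases[OF st(2)]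
      proof (elim disjE bexE)
        fix x assume x: "x \<in> A" "t = P x"
        have le: "X x < e" using st x e PA by simp
        have "e \<noteq> 0"
        proof
          assume "e = 0" then show False using Ab[OF x(1)] PA[OF x(1)] le e unfolding \<beta>_def by simp
        qed
        then have "0 < e" using E_range[OF e(1)] by auto
        then show False using pos_e[of "X x"] le x PA[OF x(1)] by simp
      next
        fix e' assume e': "e' \<in> E" "t = - e'"
        then have "0 < e" "e' < e" using E_range[OF e'(1)] st e by auto
        then show False using pos_e[of e'] e' by simp
      next
        fix q assume q: "q \<in> Q" "t = P q"
        show False
        proof (cases "e = 0")
          case True
          then obtain q' where "q' \<in> Q" "\<nu> q' < \<nu> q" using Q_below e q by blast
          then show False using no[OF ZQ[of q']] Qb[of q'] Pless[of q' q] q e True unfolding \<beta>_def by auto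
        next
          case False
          then have e0: "0 < e" using E_range[OF e(1)] by auto
          have "0 \<notin> E"
          proof
            assume "0 \<in> E"
            then have "\<beta> \<in> Z" "\<beta> = 0" using ZE[of 0] unfolding \<beta>_def by simp_all
            then show False using no[of \<beta>] e0 Qb[OF q(1)] e q by simp
          qed
          then have "1 < t" using Qb[OF q(1)] q unfolding \<beta>_def by simp
          then show False using pos_e[OF e0, of "-1"] e0 by simp
        qed
      next
        assume "t = b" then show False using tb Eb[OF e(1)] e by simp
      qed
      then show ?thesis ..
    next
      assume "s = b" then show ?thesis using sb by simp
    qed
  next
    fix z v assume z: "z \<in> Z" "lab z = Gp (vertex_pt v)"
    show "\<exists>\<delta>>0. \<forall>z'\<in>Z. \<bar>z' - z\<bar> < \<delta> \<longrightarrow> z' = z" using Zcases[OF z(1)]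
    proof (elim disjE bexE)
      fix x assume x: "x \<in> A" "z = P x"
      have "z \<notin> uminus ` E" using PE[OF A_V[OF x(1)]] x by auto
      then obtain \<epsilon> where e: "\<epsilon> > 0" "\<forall>z'\<in>P ` A \<union> uminus ` E. \<bar>z' - z\<bar> < \<epsilon> \<longrightarrow> z' = z" using S1(1) by blast
      show ?thesis
      proof (intro exI[of _ "min \<epsilon> (\<beta> - z)"] conjI ballI impI)
        fix z' assume "z' \<in> Z" "\<bar>z' - z\<bar> < min \<epsilon> (\<beta> - z)"
        then show "z' = z" using e Z2[of z'] unfolding ZU by auto
      qed (use e Ab[OF x(1)] x in auto)
    next
      fix x assume x: "x \<in> Q" "z = P x"
      have "z \<notin> L" using Qb[OF x(1)] x unfolding L_def by auto
      then obtain \<epsilon> where e: "\<epsilon> > 0" "\<forall>z'\<in>P ` Q \<union> L. \<bar>z' - z\<bar> < \<epsilon> \<longrightarrow> z' = z" using S2(1) by blast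
      show ?thesis
      proof (intro exI[of _ "min \<epsilon> (z - \<beta>)"] conjI ballI impI)
        fix z' assume "z' \<in> Z" "\<bar>z' - z\<bar> < min \<epsilon> (z - \<beta>)"
        then show "z' = z" using e Z1[of z'] unfolding ZU by auto
      qed (use e Qb[OF x(1)] x in auto)
    next
      fix e assume "e \<in> E" "z = - e" then show ?thesis using labE z by simp
    next
      assume zb: "z = b"
      then have n1: "1 \<notin> E" using z labb by auto
      obtain d where d: "d \<in> Q" "\<forall>c\<in>Q. \<nu> c \<le> \<nu> d" using a1(2)[OF n1] by blast
      show ?thesis
      proof (intro exI[of _ "b - P d"] conjI ballI impI)
        fix z' assume z': "z' \<in> Z" "\<bar>z' - z\<bar> < b - P d"
        have "P c \<le> P d" if "c \<in> Q" for c using d that Pless[OF d(1) that] by force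
        then show "z' = z" using Zcases[OF z'(1)] z' zb Ab Eb Qb[OF d(1)] by (elim disjE bexE) (force simp: abs_if split: if_splits)+
      qed (use Qb[OF d(1)] in auto)
    qed
  next
    fix z \<omega> S C assume z: "z \<in> Z" "lab z = Ep \<omega>" and S: "finite S" "S \<subseteq> fst H" "C \<in> comps H S" "\<forall>r\<in>\<omega>. tail_in r C"
    have vC: "lab (P y) \<in> end_nbhd H S C" if "y \<in> V" "y \<in> C" for y
      using labV[OF that(1)] H.vertex_gpt that H(2) unfolding end_nbhd_def by (auto simp: vertex_pt_def)
    have eC: "Ep (w e) \<in> end_nbhd H S C" if "e \<in> E" "\<forall>r\<in>w e. tail_in r C" for e
      using w(1)[OF that(1)] that unfolding end_nbhd_def by auto
    have main: "\<exists>\<delta>>0. (\<forall>y\<in>V. \<bar>pos y - e\<bar> < \<delta> \<longrightarrow> lab (P y) \<in> end_nbhd H S C) \<and> (\<forall>e'\<in>E. \<bar>e' - e\<bar> < \<delta> \<longrightarrow> lab (- e') \<in> end_nbhd H S C)"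
      if e: "e \<in> E" "\<omega> = w e" for e
    proof -
      obtain \<delta> where "\<delta> > 0" "(\<forall>z\<in>V. \<bar>pos z - e\<bar> < \<delta> \<longrightarrow> z \<in> C) \<and> (\<forall>e'\<in>E. \<bar>e' - e\<bar> < \<delta> \<longrightarrow> (\<forall>r\<in>w e'. tail_in r C))"
        using wc[OF e(1) S(1) _ S(3)] S e H(2) by auto
      then show ?thesis using vC eC labE by (intro exI[of _ \<delta>]) auto
    qed
    show "\<exists>\<delta>>0. \<forall>z'\<in>Z. \<bar>z' - z\<bar> < \<delta> \<longrightarrow> lab z' \<in> end_nbhd H S C"
      using Zcases[OF z(1)]
    proof (elim disjE bexE)
      fix e assume e: "e \<in> E" "z = - e"
      then have "\<omega> = w e" using labE z by simp
      then obtain \<delta> where d: "\<delta> > 0" "\<forall>y\<in>V. \<bar>pos y - e\<bar> < \<delta> \<longrightarrow> lab (P y) \<in> end_nbhd H S C"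
        "\<forall>e'\<in>E. \<bar>e' - e\<bar> < \<delta> \<longrightarrow> lab (- e') \<in> end_nbhd H S C" using main[OF e(1)] by blast
      \<comment> \<open>Only the end at 0 is approached by the second strand at this place; from any
        other \<open>- e\<close> it stays away by at least \<open>\<beta> - z\<close>.\<close>
      have "\<exists>\<eta>>0. \<forall>q\<in>Q. \<bar>P q - z\<bar> < \<eta> \<longrightarrow> lab (P q) \<in> end_nbhd H S C"
      proof (cases "e = 0")
        case True
        then obtain N where N: "\<forall>q\<in>Q. \<nu> q < N \<longrightarrow> pos q < \<delta>" using Q_below e d(1) by blast
        have "lab (P q) \<in> end_nbhd H S C" if q: "q \<in> Q" "\<bar>P q - z\<bar> < squash N" for q
        proof -
          have "\<beta> = 0" using True e unfolding \<beta>_def by simp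
          then have "squash (\<nu> q) < squash N" using q PQ[OF q(1)] True e squash_range[of "\<nu> q"] by auto
          then have "pos q < \<delta>" using N q squash_less by blast
          then show ?thesis using d(2) Q_V[OF q(1)] pos01[OF Q_V[OF q(1)]] True by auto
        qed
        then show ?thesis using squash_range[of N] by blast
      next
        case False
        then have zb: "z < \<beta>" using E_range[OF e(1)] e unfolding \<beta>_def by auto
        show ?thesis
        proof (intro exI[of _ "\<beta> - z"] conjI ballI impI)
          fix q assume "q \<in> Q" "\<bar>P q - z\<bar> < \<beta> - z"
          then show "lab (P q) \<in> end_nbhd H S C" using Qb[of q] by auto
        qed (use zb in auto)
      qed
      then obtain \<eta> where eta: "\<eta> > 0" "\<forall>q\<in>Q. \<bar>P q - z\<bar> < \<eta> \<longrightarrow> lab (P q) \<in> end_nbhd H S C" by blast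
      \<comment> \<open>The bound \<open>\<delta> / 2\<close> compensates for the factor 2 in
        \<open>X_close\<close>, and the bound 1 excludes \<open>b\<close>.\<close>
      show ?thesis
      proof (intro exI[of _ "min (min \<eta> (\<delta> / 2)) 1"] conjI ballI impI)
        fix z' assume z': "z' \<in> Z" "\<bar>z' - z\<bar> < min (min \<eta> (\<delta> / 2)) 1"
        show "lab z' \<in> end_nbhd H S C" using Zcases[OF z'(1)]
        proof (elim disjE bexE)
          fix x assume x: "x \<in> A" "z' = P x"
          then have "\<bar>X x - e\<bar> < \<delta> / 2" using z' e PA[OF x(1)] by (auto simp: abs_minus_commute)
          then have "\<bar>pos x - e\<bar> < \<delta>" using X_close[OF A_V[OF x(1)] e(1)] by auto
          then show ?thesis using d(2) A_V x by blast
        next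
          fix q assume "q \<in> Q" "z' = P q" then show ?thesis using eta z' by auto
        next
          fix e' assume e': "e' \<in> E" "z' = - e'"
          then have "\<bar>e' - e\<bar> < \<delta>" using z' e d(1) by (auto simp: abs_minus_commute)
          then show ?thesis using d(3) e' by blast
        next
          assume "z' = b" then show ?thesis using z' Eb[OF e(1)] e unfolding b_def by auto
        qed
      qed (use eta d in auto)
    next
      assume zb: "z = b"
      then have e: "1 \<in> E" "\<omega> = w 1" using z labb by (auto split: if_splits)
      obtain \<delta> where d: "\<delta> > 0" "\<forall>y\<in>V. \<bar>pos y - 1\<bar> < \<delta> \<longrightarrow> lab (P y) \<in> end_nbhd H S C" using main[OF e] by blast
      obtain N where N: "\<forall>q\<in>Q. N < \<nu> q \<longrightarrow> 1 - \<delta> < pos q" using Q_above[OF e(1)] d(1) by blast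
      show ?thesis
      proof (intro exI[of _ "1 - squash N"] conjI ballI impI)
        fix z' assume z': "z' \<in> Z" "\<bar>z' - z\<bar> < 1 - squash N"
        have far: False if "z' \<le> \<beta>" using z' that zb squash_range[of N] unfolding b_def by auto
        show "lab z' \<in> end_nbhd H S C" using Zcases[OF z'(1)]
        proof (elim disjE bexE)
          fix x assume "x \<in> A" "z' = P x" then show ?thesis using far Ab by force
        next
          fix e' assume "e' \<in> E" "z' = - e'" then show ?thesis using far Eb by force
        next
          fix q assume q: "q \<in> Q" "z' = P q"
          then have "squash N < squash (\<nu> q)" using z' zb PQ[OF q(1)] squash_range[of "\<nu> q"] unfolding b_def by auto
          then have "1 - \<delta> < pos q" using N q squash_less by blast
          then show ?thesis using d(2) Q_V[OF q(1)] pos01[OF Q_V[OF q(1)]] q by auto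
        next
          assume "z' = b" then show ?thesis using labb e eC S by auto
        qed
      qed (use squash_range[of N] in auto)
    next
      fix x assume "x \<in> A" "z = P x" then show ?thesis using labV A_V z by auto
    next
      fix x assume "x \<in> Q" "z = P x" then show ?thesis using labV Q_V z by auto
    qed
  next
    show "c0 \<in> Z" "d0 \<in> Z" "a < c0" "c0 < d0" using cd unfolding Z_def by auto
    have "d0 \<noteq> b" using cd Pb by auto
    moreover have "d0 \<le> b" using cd Zab unfolding Z_def by auto
    ultimately show "d0 < b" by simp
  qed
qed

end

subsection \<open>Ends of the square\<close>

context lf_graph
begin

definition nbhd :: "'v set \<Rightarrow> 'v set" where "nbhd S = S \<union> {u. \<exists>s\<in>S. {s, u} \<in> snd G}"

lemma nbhd_finite: "finite S \<Longrightarrow> S \<subseteq> fst G \<Longrightarrow> finite (nbhd S) \<and> nbhd S \<subseteq> fst G"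
  unfolding nbhd_def using finite_neighbourhood by blast

lemma fst_square [simp]: "fst (graph_square G) = fst G" unfolding graph_square_def by simp

lemma square_edge: "{u, w} \<in> snd (graph_square G) \<longleftrightarrow>
    {u, w} \<in> snd G \<or> u \<noteq> w \<and> (\<exists>v. {u, v} \<in> snd G \<and> {v, w} \<in> snd G)"
proof
  assume "{u, w} \<in> snd (graph_square G)"
  then consider "{u, w} \<in> snd G" | a v b where "{u, w} = {a, b}" "a \<noteq> b" "{a, v} \<in> snd G" "{v, b} \<in> snd G"
    unfolding graph_square_def by auto
  then show "{u, w} \<in> snd G \<or> u \<noteq> w \<and> (\<exists>v. {u, v} \<in> snd G \<and> {v, w} \<in> snd G)"
  proof cases
    case (2 a v b)
    then show ?thesis by (auto simp: doubleton_eq_iff insert_commute)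
  qed blast
qed (auto simp: graph_square_def)

lemma lf_graph_square: "lf_graph (graph_square G)"
proof
  show "simple_graph (graph_square G)" unfolding simple_graph_def
  proof
    fix e assume "e \<in> snd (graph_square G)"
    then consider "e \<in> snd G" | a v b where "e = {a, b}" "a \<noteq> b" "{a, v} \<in> snd G" "{v, b} \<in> snd G"
      unfolding graph_square_def by auto
    then show "\<exists>u v. e = {u, v} \<and> u \<noteq> v \<and> u \<in> fst (graph_square G) \<and> v \<in> fst (graph_square G)"
    proof cases
      case 1 then show ?thesis using simple unfolding simple_graph_def by simp
    next
      case (2 a v b)
      then show ?thesis using edge_vertices[of a v] edge_vertices[of v b] by auto
    qed
  qed
  show "locally_finite (graph_square G)" unfolding locally_finite_def
  proof
    fix v assume "v \<in> fst (graph_square G)"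
    then have v: "{v} \<subseteq> fst G" by simp
    have "finite (nbhd (nbhd {v}))" using nbhd_finite[of "{v}"] nbhd_finite[of "nbhd {v}"] v by simp
    then have "finite ((\<lambda>u. {v, u}) ` nbhd (nbhd {v}))" by simp
    moreover have "{e \<in> snd (graph_square G). v \<in> e} \<subseteq> (\<lambda>u. {v, u}) ` nbhd (nbhd {v})"
    proof
      fix e assume e: "e \<in> {e \<in> snd (graph_square G). v \<in> e}"
      then obtain a b where "e = {a, b}" "v \<in> {a, b}"
        using \<open>simple_graph (graph_square G)\<close> unfolding simple_graph_def by blast
      then obtain u where u: "e = {v, u}" by (auto simp: insert_commute)
      then have "u \<in> nbhd (nbhd {v})" using e square_edge[of v u] unfolding nbhd_def by auto
      then show "e \<in> (\<lambda>u. {v, u}) ` nbhd (nbhd {v})" using u by blast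
    qed
    ultimately show "finite {e \<in> snd (graph_square G). v \<in> e}" by (rule rev_finite_subset)
  qed
qed

lemma ray_square: "is_ray G r \<Longrightarrow> is_ray (graph_square G) r"
  unfolding is_ray_def graph_square_def by auto

lemma reach_square: "reach G W x y \<Longrightarrow> W \<subseteq> W' \<Longrightarrow> reach (graph_square G) W' x y"
  unfolding reach_def by (erule rtranclp_mono[THEN predicate2D, rotated]) (auto simp: graph_square_def)

text \<open>If both ends of an added edge avoid \<open>nbhd S\<close>, its middle vertex avoids
  \<open>S\<close>, so the edge can be replaced by a path of length two in \<open>G\<close> without
  \<open>S\<close>.\<close>

lemma reach_of_square:
  assumes "reach (graph_square G) (fst G - nbhd S) x y"
  shows "reach G (fst G - S) x y"
  using assms unfolding reach_def[of "graph_square G"]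
proof (induction rule: rtranclp_induct)
  case base show ?case by (simp add: reach_def)
next
  case (step y z)
  have yz: "y \<in> fst G - S" "z \<in> fst G - S" using step(2) unfolding nbhd_def by auto
  have "reach G (fst G - S) y z" using step(2)[THEN conjunct1, unfolded square_edge]
  proof (elim disjE conjE exE)
    assume "{y, z} \<in> snd G" then show ?thesis by (rule reach_edge[OF _ yz])
  next
    fix v assume v: "{y, v} \<in> snd G" "{v, z} \<in> snd G"
    have "v \<notin> S" using step(2) v(1) unfolding nbhd_def by (auto simp: insert_commute)
    then have vS: "v \<in> fst G - S" using edge_vertices v by blast
    show ?thesis by (rule reach_trans[OF reach_edge[OF v(1) yz(1) vS] reach_edge[OF v(2) vS yz(2)]])
  qed
  then show ?case by (rule reach_trans[OF step(3)])
qed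

text \<open>Obtained by separating with \<open>nbhd S\<close> in the square. It shows that distinct
  ends of \<open>G\<close> yield distinct ends of the square, as the injectivity of the labels
  requires.\<close>

lemma ray_equiv_of_square:
  assumes "ray_equiv (graph_square G) r r'" "is_ray G r" "is_ray G r'"
  shows "ray_equiv G r r'"
  unfolding ray_equiv_def
proof (intro allI impI)
  interpret sq: lf_graph "graph_square G" by (rule lf_graph_square)
  fix S assume S: "finite S \<and> S \<subseteq> fst G"
  then have "finite (nbhd S) \<and> nbhd S \<subseteq> fst (graph_square G)" using nbhd_finite by simp
  then obtain C where C: "C \<in> comps (graph_square G) (nbhd S)" "tail_in r C" "tail_in r' C"
    using assms(1) unfolding ray_equiv_def by blast
  obtain D where D: "D \<in> comps G S" "tail_in r D" using ray_comp[OF assms(2)] S by blast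
  obtain x where x: "x \<in> C" "x \<in> D" using tail_in_same[OF C(2) D(2)] by blast
  have "C \<subseteq> D"
  proof
    fix y assume "y \<in> C"
    then have "reach (graph_square G) (fst G - nbhd S) x y" using sq.comp_reach[OF C(1) x(1)] by simp
    then show "y \<in> D" using comp_reach_in[OF D(1) x(2)] reach_of_square by blast
  qed
  then show "\<exists>C\<in>comps G S. tail_in r C \<and> tail_in r' C" using D C tail_in_mono by blast
qed

lemma comp_square_subset:
  assumes "C \<in> comps G S'" "D \<in> comps (graph_square G) S" "S \<subseteq> S'" "x \<in> C" "x \<in> D"
  shows "C \<subseteq> D"
proof
  interpret sq: lf_graph "graph_square G" by (rule lf_graph_square)
  fix y assume "y \<in> C"
  then have "reach G (fst G - S') x y" using comp_reach assms by blast
  then have "reach (graph_square G) (fst (graph_square G) - S) x y"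
    by (rule reach_square) (use assms(3) in auto)
  then show "y \<in> D" by (rule sq.comp_reach_in[OF assms(2,5)])
qed

subsection \<open>Standard subspaces\<close>

lemma graph_pts_subset: "graph_pts G F \<subseteq> std_closure G F"
  unfolding std_closure_def by (rule closure_of_subset) (auto simp: graph_pts_def fpoints_def)

lemma std_closure_fpoints: "std_closure G F \<subseteq> fpoints G"
  unfolding std_closure_def using closure_of_subset_topspace[of FT] by simp

lemma open_coord_pos: "w \<in> fst G \<Longrightarrow> openin FT {x \<in> fpoints G. 0 < coord w x}"
  using openin_continuous_map_preimage[OF continuous_coord, of w "{0<..}"] by simp

text \<open>Taking the closure adds only ends. Points near a vertex have a positive coordinate
  there, and points near an inner point of an edge lie on the same edge, so a point of
  \<open>F\<close> nearby determines the vertex or the edge.\<close>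

lemma closure_graph_pts:
  assumes F: "subgraph F G" and x: "Gp p \<in> std_closure G F"
  shows "is_gpt G p \<and> ((\<exists>v\<in>fst F. p = vertex_pt v) \<or> (\<exists>u v. {u, v} \<in> snd F \<and> u \<noteq> v \<and> {w. p w \<noteq> 0} = {u, v}))"
proof -
  have p: "is_gpt G p" using subsetD[OF std_closure_fpoints x] unfolding fpoints_def by auto
  have meets: "\<exists>q. is_gpt G q \<and> ({w. q w \<noteq> 0} \<in> snd F \<or> (\<exists>v\<in>fst F. {w. q w \<noteq> 0} = {v})) \<and> Gp q \<in> U"
    if U: "openin FT U" "Gp p \<in> U" for U
  proof -
    have "\<exists>y. y \<in> graph_pts G F \<and> y \<in> U" using x U unfolding std_closure_def in_closure_of by blast
    then show ?thesis unfolding graph_pts_def by blast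
  qed
  have pf: "Gp p \<in> fpoints G" using p unfolding fpoints_def by blast
  show ?thesis using gpt_support[OF p]
  proof (elim disjE exE conjE bexE)
    fix v assume v: "v \<in> fst G" "p = vertex_pt v"
    then have "Gp p \<in> {x \<in> fpoints G. 0 < coord v x}" using pf by (simp add: coord_def vertex_pt_def)
    then obtain q where q: "{w. q w \<noteq> 0} \<in> snd F \<or> (\<exists>v\<in>fst F. {w. q w \<noteq> 0} = {v})"
      "Gp q \<in> {x \<in> fpoints G. 0 < coord v x}"
      using meets[OF open_coord_pos[OF v(1)]] by blast
    then have vq: "v \<in> {w. q w \<noteq> 0}" by (simp add: coord_def)
    from q(1) have "v \<in> fst F"
    proof
      assume "{w. q w \<noteq> 0} \<in> snd F"
      then have "{w. q w \<noteq> 0} \<subseteq> fst F" using F unfolding subgraph_def by simp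
      then show ?thesis using vq by (rule subsetD)
    next
      assume "\<exists>v\<in>fst F. {w. q w \<noteq> 0} = {v}"
      then obtain y where "y \<in> fst F" "{w. q w \<noteq> 0} = {y}" by (elim bexE)
      then show ?thesis using vq by simp
    qed
    then show ?thesis using p v(2) by blast
  next
    fix u v assume e: "{u, v} \<in> snd G" "u \<noteq> v" "{w. p w \<noteq> 0} = {u, v}" "p u + p v = 1" "0 < p u" "0 < p v"
    have uv: "u \<in> fst G" "v \<in> fst G" using edge_vertices e by blast+
    have "openin FT ({x \<in> fpoints G. 0 < coord u x} \<inter> {x \<in> fpoints G. 0 < coord v x})"
      using open_coord_pos uv by blast
    moreover have "Gp p \<in> {x \<in> fpoints G. 0 < coord u x} \<inter> {x \<in> fpoints G. 0 < coord v x}"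
      using pf e by (simp add: coord_def)
    ultimately obtain q where q: "is_gpt G q" "{w. q w \<noteq> 0} \<in> snd F \<or> (\<exists>v\<in>fst F. {w. q w \<noteq> 0} = {v})"
      "Gp q \<in> {x \<in> fpoints G. 0 < coord u x} \<inter> {x \<in> fpoints G. 0 < coord v x}"
      using meets by blast
    then have sub: "u \<in> {w. q w \<noteq> 0}" "v \<in> {w. q w \<noteq> 0}" by (auto simp: coord_def)
    have "{w. q w \<noteq> 0} = {u, v}" using gpt_support[OF q(1)]
    proof (elim disjE exE conjE bexE)
      fix y assume "{w. q w \<noteq> 0} = {y}" then show ?thesis using sub e by auto
    next
      fix y z assume "{w. q w \<noteq> 0} = {y, z}" then show ?thesis using sub e by auto
    qed
    then have "{u, v} \<in> snd F" using q(2) e(2) by (auto simp: doubleton_eq_iff)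
    then show ?thesis using p e by blast
  qed
qed

lemma continuous_mix:
  assumes e: "{u, v} \<in> snd G"
  shows "continuous_map (top_of_set {0..1}) FT (\<lambda>c. Gp (mix u v c))"
proof (rule continuous_into_FT)
  fix t :: real assume "t \<in> {0..1}"
  then show "Gp (mix u v t) \<in> fpoints G" using mix_gpt[OF e] unfolding fpoints_def by auto
next
  fix t :: real and N assume t: "t \<in> {0..1}" and "basic_nbhd G (Gp (mix u v t)) N"
  then obtain \<epsilon> where eps: "\<epsilon> > 0" "N = vball G (mix u v t) \<epsilon>" unfolding basic_nbhd_def by auto
  have "Gp (mix u v t') \<in> N" if "t' \<in> {0..1}" "\<bar>t' - t\<bar> < \<epsilon>" for t'
    unfolding eps vball_def using mix_gpt[OF e, of t'] that mix_diff[of u v t' _ t] by (auto intro: le_less_trans)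
  then show "\<exists>\<delta>>0. \<forall>t'\<in>{0..1}. \<bar>t' - t\<bar> < \<delta> \<longrightarrow> Gp (mix u v t') \<in> N" using eps by blast
qed

end

subsection \<open>The spine of a topological caterpillar\<close>

locale caterpillar = lf_graph +
  fixes T :: "'a graph" and h :: "real \<Rightarrow> 'a fpoint"
  assumes conn: "connected_graph G"
    and three: "\<exists>a\<in>fst G. \<exists>b\<in>fst G. \<exists>c\<in>fst G. a \<noteq> b \<and> a \<noteq> c \<and> b \<noteq> c"
    and T: "subgraph T G" and arc_conn: "arc_connected_in FT (std_closure G T)" and span: "spanning G T"
    and h: "homeomorphic_map (top_of_set {0..1}) (subtopology FT (std_closure G (del_vertices T (leaves T)))) h"
begin

abbreviation "P \<equiv> del_vertices T (leaves T)"
abbreviation "Arc \<equiv> std_closure G P"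
abbreviation "SP \<equiv> fst P"

definition hi :: "'a fpoint \<Rightarrow> real" where
  "hi = (SOME g. homeomorphic_maps (top_of_set {0..1}) (subtopology FT Arc) h g)"

definition \<tau> :: "'a \<Rightarrow> real" where "\<tau> s = hi (Gp (vertex_pt s))"

definition E :: "real set" where "E = {t \<in> {0..1}. \<exists>\<omega>. h t = Ep \<omega>}"

definition sp :: "'a \<Rightarrow> 'a" where "sp z = (if z \<in> SP then z else SOME u. {z, u} \<in> snd T)"

text \<open>\<open>spanning\<close> refers to the closure of \<open>T\<close>, whose vertices are
  vertices of \<open>T\<close> by \<open>closure_graph_pts\<close>.\<close>

lemma fst_T: "fst T = fst G"
proof
  show "fst T \<subseteq> fst G" using T unfolding subgraph_def by blast
  show "fst G \<subseteq> fst T"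
  proof
    fix v assume "v \<in> fst G"
    then have "Gp (vertex_pt v) \<in> std_closure G T" using span unfolding spanning_def by blast
    from closure_graph_pts[OF T this] show "v \<in> fst T"
    proof (elim conjE disjE exE bexE)
      fix u w assume "u \<noteq> w" "{x. vertex_pt v x \<noteq> 0} = {u, w}"
      moreover have "{x. vertex_pt v x \<noteq> 0} = {v}" by (auto simp: vertex_pt_def)
      ultimately show ?thesis by auto
    qed auto
  qed
qed

lemma SP_eq: "SP = fst G - leaves T" unfolding del_vertices_def fst_T by simp

lemma P_sub: "subgraph P G" using T unfolding subgraph_def del_vertices_def by auto

lemma P_edge: "{u, v} \<in> snd P \<Longrightarrow> {u, v} \<in> snd G \<and> u \<in> SP \<and> v \<in> SP \<and> u \<noteq> v"
  using P_sub edge_vertices unfolding subgraph_def by blast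

lemma T_edges: "snd T \<subseteq> snd G" using T unfolding subgraph_def by simp

lemma T_edge: "{u, v} \<in> snd T \<Longrightarrow> {u, v} \<in> snd G" using T_edges by blast

lemma leaf_edge:
  assumes "z \<in> leaves T"
  shows "\<exists>u. {z, u} \<in> snd T" "\<And>u e. {z, u} \<in> snd T \<Longrightarrow> e \<in> snd T \<Longrightarrow> z \<in> e \<Longrightarrow> e = {z, u}"
proof -
  have "card {e \<in> snd T. z \<in> e} = 1" using assms unfolding leaves_def degree_def by simp
  then obtain e0 where e0: "{e \<in> snd T. z \<in> e} = {e0}" using card_1_singletonE by blast
  then have z0: "e0 \<in> snd T" "z \<in> e0" by auto
  then have "e0 \<in> snd G" using T_edges by blast
  then obtain x y where "e0 = {x, y}" using simple unfolding simple_graph_def by blast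
  then show "\<exists>u. {z, u} \<in> snd T" using z0 by (auto simp: insert_commute)
  show "e = {z, u}" if "{z, u} \<in> snd T" "e \<in> snd T" "z \<in> e" for u e
  proof -
    have "e \<in> {e \<in> snd T. z \<in> e}" "{z, u} \<in> {e \<in> snd T. z \<in> e}" using that by auto
    then show ?thesis unfolding e0 by simp
  qed
qed

text \<open>Two adjacent leaves would form an isolated edge of \<open>T\<close>; on the closure of \<open>T\<close> the sum of
  their two coordinates would then only take the values 0 and 1.\<close>

lemma leaf_neighbour:
  assumes z: "z \<in> leaves T" and e: "{z, u} \<in> snd T"
  shows "u \<in> SP"
proof (rule ccontr)
  assume "u \<notin> SP"
  have zu: "z \<in> fst G" "u \<in> fst G" "z \<noteq> u" using edge_vertices[OF T_edge[OF e]] by auto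
  then have u: "u \<in> leaves T" using \<open>u \<notin> SP\<close> unfolding SP_eq by blast
  define f where "f x = coord z x + coord u x" for x
  have f: "continuous_map FT euclideanreal f" unfolding f_def using continuous_coord zu
    by (intro continuous_map_add) auto
  have "graph_pts G T \<subseteq> {x \<in> topspace FT. f x \<in> {0, 1}}"
  proof
    fix x assume "x \<in> graph_pts G T"
    then obtain p where p: "x = Gp p" "is_gpt G p" "{w. p w \<noteq> 0} \<in> snd T \<or> (\<exists>v\<in>fst T. {w. p w \<noteq> 0} = {v})"
      unfolding graph_pts_def by blast
    have "p z + p u \<in> {0, 1}" using gpt_support[OF p(2)]
    proof (elim disjE exE conjE bexE)
      fix v assume "p = vertex_pt v" then show ?thesis using zu by (auto simp: vertex_pt_def)
    next
      fix a b assume ab: "a \<noteq> b" "{w. p w \<noteq> 0} = {a, b}" "p a + p b = 1"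
      then have "{w. p w \<noteq> 0} \<in> snd T" using p(3) by auto
      then have i: "p z \<noteq> 0 \<Longrightarrow> {a, b} = {z, u}" "p u \<noteq> 0 \<Longrightarrow> {a, b} = {z, u}"
        using leaf_edge(2)[OF z e, of "{w. p w \<noteq> 0}"] leaf_edge(2)[OF u, of z "{w. p w \<noteq> 0}"] e ab
        by (auto simp: insert_commute)
      show ?thesis
      proof (cases "p z \<noteq> 0 \<or> p u \<noteq> 0")
        case True
        then have "a = z \<and> b = u \<or> a = u \<and> b = z" using i by (auto simp: doubleton_eq_iff)
        then show ?thesis using ab(3) by auto
      qed auto
    qed
    then show "x \<in> {x \<in> topspace FT. f x \<in> {0, 1}}" using p unfolding f_def coord_def by (simp add: fpoints_def)
  qed
  moreover have "closedin FT {x \<in> topspace FT. f x \<in> {0, 1}}"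
    by (rule closedin_continuous_map_preimage[OF f]) simp
  ultimately have cl: "std_closure G T \<subseteq> {x \<in> topspace FT. f x \<in> {0, 1}}"
    unfolding std_closure_def by (rule closure_of_minimal)
  \<comment> \<open>Along an arc from \<open>z\<close> to a third vertex the sum falls from 1 to 0,
    so by the intermediate value theorem it takes the value 1/2.\<close>
  obtain w where w: "w \<in> fst G" "w \<noteq> z" "w \<noteq> u" using three by metis
  have "Gp (vertex_pt z) \<in> std_closure G T" "Gp (vertex_pt w) \<in> std_closure G T" "Gp (vertex_pt z) \<noteq> Gp (vertex_pt w)"
    using span zu w unfolding spanning_def by auto
  then obtain A g where g: "A \<subseteq> std_closure G T" "homeomorphic_map (top_of_set {0..1::real}) (subtopology FT A) g"
    "g 0 = Gp (vertex_pt z)" "g 1 = Gp (vertex_pt w)" using arc_conn unfolding arc_connected_in_def by blast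
  have gc: "continuous_map (top_of_set {0..1}) (subtopology FT A) g" using g(2) homeomorphic_imp_continuous_map by blast
  then have gA: "g t \<in> A" if "t \<in> {0..1}" for t
    using that continuous_map_image_subset_topspace[OF gc] by auto
  have "continuous_map (top_of_set {0..1}) FT g" using gc continuous_map_into_fulltopology by blast
  then have "continuous_map (top_of_set {0..1}) euclideanreal (f \<circ> g)" using f continuous_map_compose by blast
  then have c: "continuous_on {0..1} (f \<circ> g)" by simp
  have "(f \<circ> g) 0 = 1" "(f \<circ> g) 1 = 0" using g w zu by (auto simp: f_def coord_def vertex_pt_def)
  then obtain t where "0 \<le> t" "t \<le> 1" "(f \<circ> g) t = 1/2" using IVT2'[of "f \<circ> g" 1 "1/2" 0] c by auto
  moreover then have "f (g t) \<in> {0, 1}" using cl g(1) gA[of t] by auto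
  ultimately show False by simp
qed

lemma hi: "homeomorphic_maps (top_of_set {0..1}) (subtopology FT Arc) h hi"
proof -
  have "\<exists>g. homeomorphic_maps (top_of_set {0..1}) (subtopology FT Arc) h g"
    using h homeomorphic_map_maps by blast
  then show ?thesis unfolding hi_def by (rule someI_ex)
qed

lemma h_cont: "continuous_map (top_of_set {0..1}) FT h"
  using hi unfolding homeomorphic_maps_def using continuous_map_into_fulltopology by blast

lemma hi_cont: "continuous_map (subtopology FT Arc) (top_of_set {0..1}) hi"
  using hi unfolding homeomorphic_maps_def by blast

lemma Arc_sub: "Arc \<subseteq> fpoints G" by (rule std_closure_fpoints)

lemma hi_h: "t \<in> {0..1} \<Longrightarrow> hi (h t) = t" using hi unfolding homeomorphic_maps_def by auto

lemma h_hi: "x \<in> Arc \<Longrightarrow> h (hi x) = x" using hi Arc_sub unfolding homeomorphic_maps_def by auto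

lemma hi_range: "x \<in> Arc \<Longrightarrow> hi x \<in> {0..1}"
proof -
  assume "x \<in> Arc"
  then have "hi x \<in> hi ` topspace (subtopology FT Arc)" using Arc_sub by auto
  then show ?thesis using continuous_map_image_subset_topspace[OF hi_cont] by auto
qed

lemma h_Arc: "t \<in> {0..1} \<Longrightarrow> h t \<in> Arc"
proof -
  assume "t \<in> {0..1}"
  then have "h t \<in> h ` topspace (top_of_set {0..1})" by auto
  moreover have "continuous_map (top_of_set {0..1}) (subtopology FT Arc) h"
    using hi unfolding homeomorphic_maps_def by blast
  ultimately show ?thesis using continuous_map_image_subset_topspace by fastforce
qed

lemma h_fpoints: "t \<in> {0..1} \<Longrightarrow> h t \<in> fpoints G" using h_Arc Arc_sub by blast

lemma SP_Arc: "s \<in> SP \<Longrightarrow> Gp (vertex_pt s) \<in> Arc"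
proof -
  assume s: "s \<in> SP"
  then have "s \<in> fst G" unfolding SP_eq by blast
  then have "Gp (vertex_pt s) \<in> graph_pts G P" unfolding graph_pts_def using s vertex_gpt
    by (auto simp: vertex_pt_def split: if_splits intro!: bexI[of _ s])
  then show ?thesis using graph_pts_subset by blast
qed

lemma tau01: "s \<in> SP \<Longrightarrow> \<tau> s \<in> {0..1}" unfolding \<tau>_def using hi_range SP_Arc by blast

lemma h_tau: "s \<in> SP \<Longrightarrow> h (\<tau> s) = Gp (vertex_pt s)" unfolding \<tau>_def using h_hi SP_Arc by blast

lemma tau_eq: "t \<in> {0..1} \<Longrightarrow> h t = Gp (vertex_pt s) \<Longrightarrow> \<tau> s = t" unfolding \<tau>_def using hi_h by metis

lemma tau_inj: "inj_on \<tau> SP"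
  by (rule inj_onI) (metis h_tau fpoint.inject(1) vertex_pt_inj)

lemma h_cases:
  assumes t: "t \<in> {0..1}" "t \<notin> E"
  shows "(\<exists>s\<in>SP. t = \<tau> s) \<or>
    (\<exists>u v p. {u, v} \<in> snd P \<and> u \<noteq> v \<and> h t = Gp p \<and> is_gpt G p \<and> {w. p w \<noteq> 0} = {u, v})"
proof -
  obtain p where p: "h t = Gp p" using t unfolding E_def by (cases "h t") auto
  then show ?thesis using closure_graph_pts[OF P_sub, of p] h_Arc[OF t(1)] tau_eq[OF t(1)] by metis
qed

text \<open>The segment of the edge followed by \<open>hi\<close> is a continuous injection of [0,1]
  into the reals, hence strictly monotone, and it fills the interval between \<open>\<tau> u\<close>
  and \<open>\<tau> v\<close>.\<close>

lemma edge_interval: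
  assumes e: "{u, v} \<in> snd P"
  shows "\<And>t. min (\<tau> u) (\<tau> v) < t \<Longrightarrow> t < max (\<tau> u) (\<tau> v) \<Longrightarrow> \<exists>c. 0 < c \<and> c < 1 \<and> h t = Gp (mix u v c)"
    and "\<And>t p. t \<in> {0..1} \<Longrightarrow> h t = Gp p \<Longrightarrow> is_gpt G p \<Longrightarrow> {w. p w \<noteq> 0} = {u, v} \<Longrightarrow>
      min (\<tau> u) (\<tau> v) < t \<and> t < max (\<tau> u) (\<tau> v)"
proof -
  have uv: "{u, v} \<in> snd G" "u \<in> SP" "v \<in> SP" "u \<noteq> v" using P_edge[OF e] by auto
  let ?g = "\<lambda>c. Gp (mix u v c)"
  have in_Arc: "?g c \<in> Arc" if c: "c \<in> {0..1}" for c
  proof -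
    consider "c = 0" | "c = 1" | "0 < c" "c < 1" using c by fastforce
    then show ?thesis
    proof cases
      case 3
      then have "?g c \<in> graph_pts G P" unfolding graph_pts_def
        using mix_gpt[OF uv(1), of c] mix_support[OF uv(4), of c] e by auto
      then show ?thesis using graph_pts_subset by blast
    qed (use SP_Arc uv in auto)
  qed
  define k where "k = hi \<circ> ?g"
  have "continuous_map (top_of_set {0..1}) (subtopology FT Arc) ?g"
    using continuous_mix[OF uv(1)] in_Arc by (auto simp: continuous_map_in_subtopology)
  then have "continuous_map (top_of_set {0..1}) (top_of_set {0..1}) k"
    unfolding k_def using hi_cont continuous_map_compose by blast
  then have kc: "continuous_on {0..1} k" by (simp add: continuous_map_in_subtopology)
  have k01: "k 0 = \<tau> u" "k 1 = \<tau> v" unfolding k_def \<tau>_def by simp_all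
  have hk: "h (k c) = ?g c" if "c \<in> {0..1}" for c unfolding k_def using h_hi in_Arc[OF that] by simp
  have kinj: "inj_on k {0..1}"
  proof (rule inj_onI)
    fix c d assume cd: "c \<in> {0..1}" "d \<in> {0..1}" "k c = k d"
    then have "mix u v c = mix u v d" using hk[of c] hk[of d] by simp
    then have "mix u v c v = mix u v d v" by simp
    then show "c = d" using uv by (simp add: mix_def vertex_pt_def)
  qed
  show "\<exists>c. 0 < c \<and> c < 1 \<and> h t = Gp (mix u v c)" if t: "min (\<tau> u) (\<tau> v) < t" "t < max (\<tau> u) (\<tau> v)" for t
  proof -
    have "\<exists>c. 0 \<le> c \<and> c \<le> 1 \<and> k c = t"
    proof (cases "\<tau> u \<le> \<tau> v")
      case True then show ?thesis using IVT'[of k 0 t 1] k01 kc t by auto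
    next
      case False then show ?thesis using IVT2'[of k 1 t 0] k01 kc t by auto
    qed
    then obtain c where c: "0 \<le> c" "c \<le> 1" "k c = t" by blast
    have "c \<noteq> 0" "c \<noteq> 1" using c k01 t by (auto simp: min_def max_def split: if_splits)
    then show ?thesis using c hk[of c] by (intro exI[of _ c]) auto
  qed
  show "min (\<tau> u) (\<tau> v) < t \<and> t < max (\<tau> u) (\<tau> v)"
    if t: "t \<in> {0..1}" "h t = Gp p" "is_gpt G p" "{w. p w \<noteq> 0} = {u, v}" for t p
  proof -
    note m = gpt_inner_mix[OF t(3,4) uv(4)]
    note p = m[THEN conjunct1, symmetric] m[THEN conjunct2, THEN conjunct1] m[THEN conjunct2, THEN conjunct2]
    have "k (p v) = t" unfolding k_def comp_def p(1) t(2)[symmetric] by (rule hi_h[OF t(1)])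
    moreover have "(k 0 < k (p v) \<and> k (p v) < k 1) \<or> (k 1 < k (p v) \<and> k (p v) < k 0)"
      using continuous_inj_imp_mono[OF p(2,3) kc kinj] by blast
    ultimately show ?thesis using k01 by auto
  qed
qed

lemma edge_interval_empty:
  assumes e: "{u, v} \<in> snd P" and t: "min (\<tau> u) (\<tau> v) < t" "t < max (\<tau> u) (\<tau> v)"
  shows "t \<notin> E" "\<And>s. s \<in> SP \<Longrightarrow> \<tau> s \<noteq> t"
proof -
  obtain c where c: "0 < c" "c < 1" "h t = Gp (mix u v c)" using edge_interval(1)[OF e t] by blast
  then show "t \<notin> E" unfolding E_def by simp
  fix s assume s: "s \<in> SP"
  show "\<tau> s \<noteq> t"
  proof
    assume "\<tau> s = t"
    then have eq: "vertex_pt s = mix u v c" using h_tau[OF s] c by simp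
    have "{w. vertex_pt s w \<noteq> 0} = {s}" by (auto simp: vertex_pt_def)
    then show False using mix_support[of u v c] P_edge[OF e] c eq by auto
  qed
qed

lemma tau_E: "s \<in> SP \<Longrightarrow> \<tau> s \<notin> E" unfolding E_def using h_tau by auto

text \<open>The points of the complex form an open set, and the complement of its preimage under
  \<open>h\<close> is \<open>E\<close>.\<close>

lemma E_closed: "closed E"
proof -
  have "openin FT (Gp ` {p. is_gpt G p})" unfolding openin_FT
  proof (intro conjI ballI)
    fix x assume "x \<in> Gp ` {p. is_gpt G p}"
    then obtain p where "x = Gp p" "is_gpt G p" by blast
    then show "\<exists>N. basic_nbhd G x N \<and> N \<subseteq> Gp ` {p. is_gpt G p}"
      using basic_nbhd_Gp[of p 1] by (intro exI[of _ "vball G p 1"]) (auto simp: vball_def)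
  qed (auto simp: fpoints_def)
  then have "openin (top_of_set {0..1}) {t \<in> topspace (top_of_set {0..1}). h t \<in> Gp ` {p. is_gpt G p}}"
    using openin_continuous_map_preimage[OF h_cont] by blast
  from closedin_diff[OF closedin_topspace this]
  have "closedin (top_of_set {0..1}) ({0..1} - {t \<in> {0..1}. h t \<in> Gp ` {p. is_gpt G p}})" by simp
  moreover have "{0..1} - {t \<in> {0..1}. h t \<in> Gp ` {p. is_gpt G p}} = E"
  proof -
    have "h t \<in> Gp ` {p. is_gpt G p} \<longleftrightarrow> \<not> (\<exists>\<omega>. h t = Ep \<omega>)" if "t \<in> {0..1}" for t
      using h_fpoints[OF that] by (cases "h t") (auto simp: fpoints_def)
    then show ?thesis unfolding E_def by auto
  qed
  ultimately show ?thesis using closedin_closed_trans closed_atLeastAtMost by metis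
qed

lemma E_end: "e \<in> E \<Longrightarrow> \<exists>\<omega>\<in>ends G. h e = Ep \<omega>"
proof -
  assume "e \<in> E"
  then obtain \<omega> where "h e = Ep \<omega>" "e \<in> {0..1}" unfolding E_def by blast
  then show ?thesis using h_fpoints[of e] by (auto simp: fpoints_def)
qed

text \<open>Continuity of \<open>h\<close> at \<open>e\<close>, read off at the parameters of spine
  vertices and of ends.\<close>

lemma end_limit:
  assumes e: "e \<in> E" "h e = Ep \<omega>" "\<omega> \<in> ends G" and S: "finite S" "S \<subseteq> fst G" "C \<in> comps G S" "\<forall>r\<in>\<omega>. tail_in r C"
  shows "\<exists>\<delta>>0. (\<forall>s\<in>SP. \<bar>\<tau> s - e\<bar> < \<delta> \<longrightarrow> s \<in> C) \<and>
    (\<forall>e'\<in>E. \<bar>e' - e\<bar> < \<delta> \<longrightarrow> (\<forall>\<omega>'. h e' = Ep \<omega>' \<longrightarrow> (\<forall>r\<in>\<omega>'. tail_in r C)))"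
proof -
  have "openin (top_of_set {0..1}) {t \<in> topspace (top_of_set {0..1}). h t \<in> end_nbhd G S C}"
    using openin_continuous_map_preimage[OF h_cont open_end_nbhd[OF S(1-3)]] .
  moreover have "e \<in> {t \<in> topspace (top_of_set {0..1}). h t \<in> end_nbhd G S C}"
    using e S unfolding E_def end_nbhd_def by auto
  ultimately obtain \<delta> where d: "\<delta> > 0" "\<forall>t\<in>{0..1}. dist t e < \<delta> \<longrightarrow> h t \<in> end_nbhd G S C"
    unfolding openin_euclidean_subtopology_iff by auto
  have "s \<in> C" if s: "s \<in> SP" "\<bar>\<tau> s - e\<bar> < \<delta>" for s
    using d(2) tau01[OF s(1)] s h_tau[OF s(1)] vertex_in_end_nbhd by (metis dist_real_def)
  moreover have "\<forall>r\<in>\<omega>'. tail_in r C" if e': "e' \<in> E" "\<bar>e' - e\<bar> < \<delta>" "h e' = Ep \<omega>'" for e' \<omega>'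
  proof -
    have "Ep \<omega>' \<in> end_nbhd G S C" using d(2) e' unfolding E_def dist_real_def by force
    then show ?thesis unfolding end_nbhd_def by auto
  qed
  ultimately show ?thesis using d by blast
qed

lemma sp_SP: "z \<in> fst G \<Longrightarrow> sp z \<in> SP" and sp_adj: "z \<in> fst G \<Longrightarrow> z \<notin> SP \<Longrightarrow> {z, sp z} \<in> snd G"
proof -
  assume z: "z \<in> fst G"
  have *: "{z, sp z} \<in> snd T" "z \<in> leaves T" if "z \<notin> SP"
  proof -
    show "z \<in> leaves T" using that z unfolding SP_eq by blast
    then show "{z, sp z} \<in> snd T" using someI_ex[OF leaf_edge(1)] that unfolding sp_def by simp
  qed
  show "sp z \<in> SP" using leaf_neighbour * by (cases "z \<in> SP") (auto simp: sp_def)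
  show "z \<notin> SP \<Longrightarrow> {z, sp z} \<in> snd G" using * T_edge by blast
qed

text \<open>The ray lives in \<open>G\<close> and may leave the caterpillar, but its projection to
  the spine eventually stays in the same component \<open>C\<close>; continuity of \<open>hi\<close>
  at the end turns this into convergence of parameters.\<close>

lemma ray_limit:
  assumes e: "e \<in> E" "h e = Ep \<omega>" "\<omega> \<in> ends G" and r: "r \<in> \<omega>"
  shows "(\<lambda>n. \<tau> (sp (r n))) \<longlonglongrightarrow> e"
proof (rule LIMSEQ_I)
  fix \<delta> :: real assume d: "0 < \<delta>"
  have ray: "is_ray G r" using end_ray e r by blast
  have e01: "e \<in> {0..1}" using e unfolding E_def by blast
  have "openin (top_of_set {0..1::real}) ({0..1} \<inter> ball e \<delta>)" by (rule openin_open_Int) simp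
  then have "openin (subtopology FT Arc) {x \<in> topspace (subtopology FT Arc). hi x \<in> {0..1} \<inter> ball e \<delta>}"
    using openin_continuous_map_preimage[OF hi_cont] by blast
  then obtain U where U: "openin FT U" "{x \<in> topspace (subtopology FT Arc). hi x \<in> {0..1} \<inter> ball e \<delta>} = U \<inter> Arc"
    unfolding openin_subtopology by blast
  have "Ep \<omega> \<in> Arc" "hi (Ep \<omega>) = e" using h_Arc[OF e01] hi_h[OF e01] e by auto
  then have "Ep \<omega> \<in> U \<inter> Arc" unfolding U(2)[symmetric] using Arc_sub d e01 by auto
  then obtain N where N: "basic_nbhd G (Ep \<omega>) N" "N \<subseteq> U" using U(1) unfolding openin_FT by blast
  then obtain S C where S: "finite S" "S \<subseteq> fst G" "C \<in> comps G S" "\<forall>r\<in>\<omega>. tail_in r C" "N = end_nbhd G S C"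
    unfolding basic_nbhd_def by auto
  obtain n1 where n1: "\<forall>m\<ge>n1. r m \<in> C" using S(4) r unfolding tail_in_def by blast
  \<comment> \<open>Avoiding also the neighbours of \<open>S\<close> ensures that the spine vertex
    of a leaf on the ray is not in \<open>S\<close>.\<close>
  obtain n2 where n2: "\<forall>m\<ge>n2. r m \<notin> nbhd S" using ray_avoids[OF ray nbhd_finite[OF S(1,2), THEN conjunct1]] by blast
  have "\<bar>\<tau> (sp (r n)) - e\<bar> < \<delta>" if n: "n \<ge> max n1 n2" for n
  proof -
    have rn: "r n \<in> C" "r n \<notin> nbhd S" "r n \<in> fst G" using n1 n2 n ray_vertex[OF ray] by auto
    define s where "s = sp (r n)"
    have s: "s \<in> SP" unfolding s_def using sp_SP rn by blast
    have "s \<in> C"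
    proof (cases "r n \<in> SP")
      case True then show ?thesis using rn unfolding s_def sp_def by simp
    next
      case False
      then have ed: "{r n, s} \<in> snd G" unfolding s_def using sp_adj rn by blast
      then have "s \<notin> S" using rn(2) unfolding nbhd_def by (auto simp: insert_commute)
      then show ?thesis using comp_edge[OF S(3) rn(1) ed] by blast
    qed
    then have "Gp (vertex_pt s) \<in> end_nbhd G S C" unfolding end_nbhd_def
      using s vertex_gpt[of s] unfolding SP_eq by (auto simp: vertex_pt_def)
    then have "Gp (vertex_pt s) \<in> U \<inter> Arc" using N S(5) SP_Arc[OF s] by blast
    then have "hi (Gp (vertex_pt s)) \<in> ball e \<delta>" unfolding U(2)[symmetric] by blast
    then show ?thesis unfolding \<tau>_def s_def by (simp add: dist_real_def abs_minus_commute)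
  qed
  then show "\<exists>n0. \<forall>n\<ge>n0. norm (\<tau> (sp (r n)) - e) < \<delta>" by (intro exI[of _ "max n1 n2"]) simp
qed

lemma spine_axioms: "spine (fst G) SP (\<lambda>u v. {u, v} \<in> snd G) sp \<tau> E"
proof
  show "{v, u} \<in> snd G" if "{u, v} \<in> snd G" for u v using that by (simp add: insert_commute)
  show "u \<in> fst G \<and> v \<in> fst G \<and> u \<noteq> v" if "{u, v} \<in> snd G" for u v using edge_vertices that by blast
  show "(\<lambda>u v. {u, v} \<in> snd G)\<^sup>*\<^sup>* u v" if "u \<in> fst G" "v \<in> fst G" for u v
  proof -
    have "reach G (fst G) u v" using conn that unfolding connected_graph_def by blast
    then show ?thesis unfolding reach_def by (rule rtranclp_mono[THEN predicate2D, rotated]) auto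
  qed
  show "SP \<subseteq> fst G" unfolding SP_eq by blast
  show "sp z \<in> SP" if "z \<in> fst G" for z using sp_SP that .
  show "sp s = s" if "s \<in> SP" for s using that unfolding sp_def by simp
  show "{z, sp z} \<in> snd G" if "z \<in> fst G" "z \<notin> SP" for z using sp_adj that .
  show "finite {z \<in> fst G. sp z = s}" if s: "s \<in> SP" for s
  proof (rule finite_subset)
    show "{z \<in> fst G. sp z = s} \<subseteq> insert s {u. {s, u} \<in> snd G}"
    proof
      fix z assume "z \<in> {z \<in> fst G. sp z = s}"
      then show "z \<in> insert s {u. {s, u} \<in> snd G}"
        using sp_adj[of z] by (cases "z \<in> SP") (auto simp: sp_def insert_commute)
    qed
    have "s \<in> fst G" using s unfolding SP_eq by blast
    then show "finite (insert s {u. {s, u} \<in> snd G})" using finite_neighbours by simp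
  qed
  show "closed E" by (rule E_closed)
  show "E \<subseteq> {0..1}" unfolding E_def by blast
  show "\<tau> s \<in> {0..1}" if "s \<in> SP" for s using tau01 that .
  show "inj_on \<tau> SP" by (rule tau_inj)
  show "\<tau> s \<notin> E" if "s \<in> SP" for s using tau_E that .
  show "\<exists>\<epsilon>>0. finite {s \<in> SP. \<bar>\<tau> s - t\<bar> < \<epsilon>}" if t: "t \<in> {0..1}" "t \<notin> E" for t
  proof -
    obtain p where p: "h t = Gp p" using t unfolding E_def by (cases "h t") auto
    then have "is_gpt G p" using h_fpoints[OF t(1)] unfolding fpoints_def by auto
    then obtain S where S: "finite S" "S \<subseteq> fst G" "(\<Sum>w\<in>S. coord w (Gp p)) = 1" using Gp_support_sum by blast
    \<comment> \<open>The sum is 1 at \<open>h t\<close> and 0 at every vertex outside the finite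
      set \<open>S\<close>, so near \<open>t\<close> only spine vertices in \<open>S\<close> can
      occur.\<close>
    define f where "f x = (\<Sum>w\<in>S. coord w x)" for x
    have "continuous_map FT euclideanreal f" unfolding f_def using S continuous_coord by (intro continuous_map_sum) auto
    then have "continuous_map (top_of_set {0..1}) euclideanreal (f \<circ> h)" using h_cont continuous_map_compose by blast
    then have "continuous_on {0..1} (f \<circ> h)" by simp
    moreover have "(f \<circ> h) t = 1" unfolding f_def using p S by simp
    ultimately obtain \<epsilon> where e: "\<epsilon> > 0" "\<forall>t'\<in>{0..1}. dist t' t < \<epsilon> \<longrightarrow> dist ((f \<circ> h) t') 1 < 1"
      using t(1) unfolding continuous_on_iff by (metis zero_less_one)
    have "s \<in> S" if s: "s \<in> SP" "\<bar>\<tau> s - t\<bar> < \<epsilon>" for s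
    proof (rule ccontr)
      assume n: "s \<notin> S"
      have "dist (f (h (\<tau> s))) 1 < 1" using e(2) tau01[OF s(1)] s(2) by (auto simp: dist_real_def)
      moreover have "f (h (\<tau> s)) = 0" unfolding h_tau[OF s(1)] f_def coord_def vertex_pt_def using n
        by (auto intro!: sum.neutral)
      ultimately show False by (simp add: dist_real_def)
    qed
    then have "{s \<in> SP. \<bar>\<tau> s - t\<bar> < \<epsilon>} \<subseteq> S" by blast
    then show ?thesis using e S finite_subset by blast
  qed
  show "{s, s'} \<in> snd G" if s: "s \<in> SP" "s' \<in> SP" "\<tau> s < \<tau> s'" "\<forall>u\<in>SP. \<not> (\<tau> s < \<tau> u \<and> \<tau> u < \<tau> s')"
    "\<forall>e\<in>E. \<not> (\<tau> s < e \<and> e < \<tau> s')" for s s'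
  proof -
    \<comment> \<open>The midpoint is neither an end nor a spine vertex, so it is an inner point of
      an edge. The interval of that edge contains no further spine vertices, which forces its end
      points to be \<open>\<tau> s\<close> and \<open>\<tau> s'\<close>.\<close>
    define t where "t = (\<tau> s + \<tau> s') / 2"
    have t: "\<tau> s < t" "t < \<tau> s'" unfolding t_def using s by auto
    have "t \<in> {0..1}" using tau01[OF s(1)] tau01[OF s(2)] t by auto
    moreover have "t \<notin> E" using s(5) t by blast
    moreover have "\<not> (\<exists>u\<in>SP. t = \<tau> u)" using s(4) t by blast
    ultimately obtain u v p where uv: "{u, v} \<in> snd P" "h t = Gp p" "is_gpt G p" "{w. p w \<noteq> 0} = {u, v}"
      using h_cases by blast
    have i: "min (\<tau> u) (\<tau> v) < t" "t < max (\<tau> u) (\<tau> v)" using edge_interval(2)[OF uv(1) \<open>t \<in> {0..1}\<close> uv(2-4)] by auto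
    have S: "u \<in> SP" "v \<in> SP" using P_edge[OF uv(1)] by auto
    have no: "\<not> (min (\<tau> u) (\<tau> v) < \<tau> x \<and> \<tau> x < max (\<tau> u) (\<tau> v))" if "x \<in> SP" for x
      using edge_interval_empty(2)[OF uv(1)] that by blast
    have "min (\<tau> u) (\<tau> v) = \<tau> s" "max (\<tau> u) (\<tau> v) = \<tau> s'"
      using no[OF s(1)] no[OF s(2)] s(4) S i t by (auto simp: min_def max_def split: if_splits; force)+
    then have "\<tau> u = \<tau> s \<and> \<tau> v = \<tau> s' \<or> \<tau> u = \<tau> s' \<and> \<tau> v = \<tau> s" by (auto simp: min_def max_def split: if_splits)
    then have "u = s \<and> v = s' \<or> u = s' \<and> v = s" using tau_inj S s(1,2) unfolding inj_on_def by blast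
    then show ?thesis using P_edge[OF uv(1)] by (auto simp: insert_commute)
  qed
  show "\<exists>s\<in>SP. \<exists>s'\<in>SP. \<tau> s \<le> t \<and> t \<le> \<tau> s' \<and> (\<forall>e\<in>E. \<not> (\<tau> s \<le> e \<and> e \<le> \<tau> s'))" if t: "t \<in> {0..1}" "t \<notin> E" for t
    using h_cases[OF t]
  proof (elim disjE exE conjE bexE)
    fix s assume "s \<in> SP" "t = \<tau> s"
    then show ?thesis using tau_E by (intro bexI[of _ s]) (auto dest: antisym)
  next
    fix u v p assume uv: "{u, v} \<in> snd P" "h t = Gp p" "is_gpt G p" "{w. p w \<noteq> 0} = {u, v}"
    have i: "min (\<tau> u) (\<tau> v) < t" "t < max (\<tau> u) (\<tau> v)" using edge_interval(2)[OF uv(1) t(1) uv(2-4)] by auto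
    have S: "u \<in> SP" "v \<in> SP" using P_edge[OF uv(1)] by auto
    have no: "\<not> (min (\<tau> u) (\<tau> v) \<le> e \<and> e \<le> max (\<tau> u) (\<tau> v))" if e: "e \<in> E" for e
    proof
      assume "min (\<tau> u) (\<tau> v) \<le> e \<and> e \<le> max (\<tau> u) (\<tau> v)"
      moreover have "e \<noteq> \<tau> u" "e \<noteq> \<tau> v" using tau_E S e by auto
      ultimately have "min (\<tau> u) (\<tau> v) < e" "e < max (\<tau> u) (\<tau> v)" by (auto simp: min_def max_def split: if_splits)
      then show False using edge_interval_empty(1)[OF uv(1)] e by blast
    qed
    show ?thesis
    proof (cases "\<tau> u \<le> \<tau> v")
      case True then show ?thesis using i no S by (intro bexI[of _ u] bexI[of _ v]) auto
    next
      case False then show ?thesis using i no S by (intro bexI[of _ v] bexI[of _ u]) auto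
    qed
  qed
  show "\<exists>r. (\<forall>n. {r n, r (Suc n)} \<in> snd G) \<and> (\<lambda>n. \<tau> (sp (r n))) \<longlonglongrightarrow> x" if x: "x \<in> E" for x
  proof -
    obtain \<omega> where o: "\<omega> \<in> ends G" "h x = Ep \<omega>" using E_end[OF x] by blast
    obtain r where r: "r \<in> \<omega>" using end_nonempty[OF o(1)] by blast
    then show ?thesis using ray_limit[OF x o(2,1) r] end_ray[OF o(1) r] unfolding is_ray_def by blast
  qed
qed

sublocale spine "fst G" SP "\<lambda>u v. {u, v} \<in> snd G" sp \<tau> E by (rule spine_axioms)

lemma hamiltonian_square: "hamiltonian (graph_square G)"
proof -
  interpret sq: lf_graph "graph_square G" by (rule lf_graph_square)
  obtain A Q X \<nu> where "stranded (fst G) SP (\<lambda>u v. {u, v} \<in> snd G) sp \<tau> E A Q X \<nu>" using stranded_ex by blast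
  then interpret st: stranded "fst G" SP "\<lambda>u v. {u, v} \<in> snd G" sp \<tau> E A Q X \<nu> .
  \<comment> \<open>A ray of \<open>G\<close> in the end at \<open>e\<close>; its class in the
    square is going to be the end \<open>w e\<close>.\<close>
  define rr where "rr e = (SOME r. \<exists>\<omega>\<in>ends G. h e = Ep \<omega> \<and> r \<in> \<omega>)" for e
  have rr: "\<exists>\<omega>\<in>ends G. h e = Ep \<omega> \<and> rr e \<in> \<omega>" if e: "e \<in> E" for e
  proof -
    obtain \<omega> where o: "\<omega> \<in> ends G" "h e = Ep \<omega>" using E_end[OF e] by blast
    obtain r where "r \<in> \<omega>" using end_nonempty[OF o(1)] by blast
    then show ?thesis unfolding rr_def using someI_ex[of "\<lambda>r. \<exists>\<omega>\<in>ends G. h e = Ep \<omega> \<and> r \<in> \<omega>"] o by blast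
  qed
  have rr_ray: "is_ray G (rr e)" if "e \<in> E" for e using rr[OF that] end_ray by blast
  define w where "w e = {s. is_ray (graph_square G) s \<and> ray_equiv (graph_square G) (rr e) s}" for e
  obtain v1 v2 v3 where v: "v1 \<in> fst G" "v2 \<in> fst G" "v3 \<in> fst G" "v1 \<noteq> v2" "v1 \<noteq> v3" "v2 \<noteq> v3" using three by blast
  show ?thesis
  proof (rule st.hamiltonian_if_stranded[where w = w and ?v1.0 = v1 and ?v2.0 = v2 and ?v3.0 = v3])
    show "lf_graph (graph_square G)" by (rule lf_graph_square)
    show "{u, v} \<in> snd (graph_square G)" if "adj2 u v" for u v using that unfolding adj2_def square_edge .
    show "w e \<in> ends (graph_square G)" if e: "e \<in> E" for e
      unfolding w_def ends_def using ray_square[OF rr_ray[OF e]] by blast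
    show "inj_on w E"
    proof (rule inj_onI)
      fix e e' assume e: "e \<in> E" "e' \<in> E" "w e = w e'"
      have "rr e' \<in> w e'" unfolding w_def using ray_square[OF rr_ray[OF e(2)]] sq.ray_equiv_refl by blast
      then have "ray_equiv (graph_square G) (rr e) (rr e')" using e(3) unfolding w_def by blast
      then have eq: "ray_equiv G (rr e) (rr e')" using ray_equiv_of_square rr_ray e by blast
      obtain \<omega> \<omega>' where o: "\<omega> \<in> ends G" "h e = Ep \<omega>" "rr e \<in> \<omega>" "\<omega>' \<in> ends G" "h e' = Ep \<omega>'" "rr e' \<in> \<omega>'"
        using rr[OF e(1)] rr[OF e(2)] by blast
      have "rr e' \<in> \<omega>" using end_eq[OF o(1,3)] eq rr_ray[OF e(2)] by blast
      then have "\<omega> = \<omega>'" using end_eq[OF o(1)] end_eq[OF o(4,6)] by blast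
      then have "h e = h e'" using o by simp
      then show "e = e'" using hi_h e unfolding E_def by (metis (no_types, lifting) mem_Collect_eq)
    qed
    fix e S C assume e: "e \<in> E" and S: "finite S" "S \<subseteq> fst G" and C: "C \<in> comps (graph_square G) S" "\<forall>r\<in>w e. tail_in r C"
    obtain \<omega> where o: "\<omega> \<in> ends G" "h e = Ep \<omega>" "rr e \<in> \<omega>" using rr[OF e] by blast
    \<comment> \<open>Separating by \<open>nbhd S\<close> in \<open>G\<close> leaves room for one
      step from a spine vertex to its leaves without meeting \<open>S\<close>.\<close>
    have fin: "finite (nbhd S)" "nbhd S \<subseteq> fst G" using nbhd_finite S by auto
    obtain D where D: "D \<in> comps G (nbhd S)" "\<forall>r\<in>\<omega>. tail_in r D" using end_comp[OF o(1) fin] by blast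
    have "rr e \<in> w e" unfolding w_def using ray_square[OF rr_ray[OF e]] sq.ray_equiv_refl by blast
    then obtain x where x: "x \<in> D" "x \<in> C" using tail_in_same[of "rr e" D C] C(2) D(2) o(3) by blast
    have DC: "D \<subseteq> C" by (rule comp_square_subset[OF D(1) C(1) _ x]) (auto simp: nbhd_def)
    obtain \<delta> where d: "\<delta> > 0" "\<forall>s\<in>SP. \<bar>\<tau> s - e\<bar> < \<delta> \<longrightarrow> s \<in> D"
      "\<forall>e'\<in>E. \<bar>e' - e\<bar> < \<delta> \<longrightarrow> (\<forall>\<omega>'. h e' = Ep \<omega>' \<longrightarrow> (\<forall>r\<in>\<omega>'. tail_in r D))"
      using end_limit[OF e o(2,1) fin D] by blast
    have "z \<in> C" if z: "z \<in> fst G" "\<bar>pos z - e\<bar> < \<delta>" for z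
    proof -
      have s: "sp z \<in> D" using d(2) sp_SP[OF z(1)] z(2) unfolding pos_def by blast
      show ?thesis
      proof (cases "z \<in> SP")
        case True then show ?thesis using s DC sp_id by auto
      next
        case False
        have ed: "{z, sp z} \<in> snd G" using sp_adj z False by blast
        \<comment> \<open>A leaf in \<open>S\<close> would have its spine vertex in
          \<open>nbhd S\<close>.\<close>
        have "sp z \<notin> nbhd S" using comp_subset[OF D(1)] s by blast
        then have "z \<notin> S" using ed unfolding nbhd_def by blast
        moreover have "{sp z, z} \<in> snd (graph_square G)" using ed square_edge by (simp add: insert_commute)
        ultimately show ?thesis using sq.comp_edge[OF C(1)] s DC by blast
      qed
    qed
    moreover have "\<forall>r\<in>w e'. tail_in r C" if e': "e' \<in> E" "\<bar>e' - e\<bar> < \<delta>" for e'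
    proof
      fix r assume r: "r \<in> w e'"
      obtain \<omega>' where "h e' = Ep \<omega>'" "rr e' \<in> \<omega>'" using rr[OF e'(1)] by blast
      then have "tail_in (rr e') C" using d(3) e' DC tail_in_mono by blast
      then show "tail_in r C" using r sq.ray_equiv_tail[OF _ S(1) _ C(1)] S unfolding w_def by auto
    qed
    ultimately show "\<exists>\<delta>>0. (\<forall>z\<in>fst G. \<bar>pos z - e\<bar> < \<delta> \<longrightarrow> z \<in> C) \<and> (\<forall>e'\<in>E. \<bar>e' - e\<bar> < \<delta> \<longrightarrow> (\<forall>r\<in>w e'. tail_in r C))"
      using d(1) by blast
  qed (use v in auto)
qed

end

theorem theorem1p5:
  fixes G :: "'v graph"
  assumes "simple_graph G"
    and "locally_finite G"
    and "connected_graph G"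
    and "\<exists>a\<in>fst G. \<exists>b\<in>fst G. \<exists>c\<in>fst G. a \<noteq> b \<and> a \<noteq> c \<and> b \<noteq> c"
    and "\<exists>T. topological_caterpillar G T \<and> spanning G T"
  shows "hamiltonian (graph_square G)"
proof -
  obtain T where T: "topological_caterpillar G T" "spanning G T" using assms(5) by blast
  then obtain h where h: "homeomorphic_map (top_of_set {0..1::real})
      (subtopology (freudenthal G) (std_closure G (del_vertices T (leaves T)))) h"
    unfolding topological_caterpillar_def is_arc_def by blast
  interpret caterpillar G T h
    by unfold_locales (use assms T h in \<open>auto simp: topological_caterpillar_def topological_tree_def\<close>)
  show ?thesis by (rule hamiltonian_square)
qed

end
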